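(* Let $\lambda$ be an infinite regular cardinal and let $\mathbb{S}$ be a $\lambda$-ary partial Horn theory over an $S$-sorted $\lambda$-ary signature $\Sigma$ such that $\mathbf{PMod}\,\mathbb{S}$ satisfies the ascending chain condition. Let $(\Omega,E)$ be an $\mathbb{S}$-relative $\lambda$-ary algebraic theory with the forgetful functor $U\colon\mathbf{Alg}(\Omega,E)\to\mathbf{PMod}\,\mathbb{S}$. Then, for every replete full subcategory $\mathscr{E}\subseteq\mathbf{Alg}(\Omega,E)$, the following are equivalent: (i) $\mathscr{E}$ is definable by $\mathbb{S}$-relative $\lambda$-ary judgments, i.e., there exists a set $E'$ of $\mathbb{S}$-relative $\lambda$-ary judgments satisfying $\mathscr{E}=\mathbf{Alg}(\Omega,E\cup E')$. (ii) $\mathscr{E}\subseteq\mathbf{Alg}(\Omega,E)$ is closed under products, $\Sigma$-closed subobjects, and $(U,\lambda)$-pure quotients.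
   Context: Partial Horn logic. For a set $S$ (of sorts), an $S$-sorted $\lambda$-ary signature $\Sigma$ consists of a set of function symbols, each with an arity $f\colon\sqcap_{i<\alpha}s_i\to s$ ($\alpha<\lambda$; $s_i,s\in S$), and a set of relation symbols, each with an arity $R\colon\sqcap_{i<\alpha}s_i$ ($\alpha<\lambda$). For each sort there is a fixed set of $\lambda$ many variables (disjoint for distinct sorts). Raw terms are built from variables by function symbols respecting sorts; raw ($\lambda$-ary) Horn formulas are built from $R(\tau_i)_{i<\alpha}$, $\tau=\tau'$ (raw terms of the same sort) and $\top$ by conjunctions $\bigwedge_{i<\alpha}\phi_i$ with $\alpha<\lambda$. A context is a tuple $\vec x=(x_i:s_i)_{i<\alpha}$, $\alpha<\lambda$, of distinct variables. A term $\vec x.\tau$ (Horn formula $\vec x.\phi$) is a raw term (raw Horn formula) with a context containing all its variables. A Horn sequent $\phi\vdash_{\vec x}\psi$ is a pair of Horn formulas in the same context. A $\lambda$-ary partial Horn theory over $\Sigma$ is a set of Horn sequents over $\Sigma$. $\tau{\downarrow}$ abbreviates $\tau=\tau$. A partial $\Sigma$-structure $M$ consists of sets $M_s$ ($s\in S$), a partial map $[\![f]\!]_M\colon\prod_{i<\alpha}M_{s_i}\rightharpoonup M_s$ for each $f$, and a subset $[\![R]\!]_M\subseteq\prod_{i<\alpha}M_{s_i}$ for each $R$. Terms are interpreted as partial maps $[\![\vec x.\tau]\!]_M$ (a composite $f(\tau_j)_j$ is defined at $\vec m$ iff all $\tau_j$ are and $[\![f]\!]_M$ is defined at their values). Horn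 formulas are interpreted as subsets $[\![\vec x.\phi]\!]_M\subseteq\prod_i M_{s_i}$: $R(\tau_j)_j$ holds iff all $\tau_j$ are defined and the tuple of values lies in $[\![R]\!]_M$; $\tau=\tau'$ holds iff both are defined and equal; $\top$ always holds; conjunction is intersection. A sequent $\phi\vdash_{\vec x}\psi$ is valid in $M$ if $[\![\vec x.\phi]\!]_M\subseteq[\![\vec x.\psi]\!]_M$; $M$ is a partial $\mathbb{S}$-model if all sequents of $\mathbb{S}$ are valid in it. A $\Sigma$-homomorphism $h\colon M\to N$ is a family of total maps $h_s\colon M_s\to N_s$ such that whenever $[\![f]\!]_M(\vec a)$ is defined, $[\![f]\!]_N(h(\vec a))$ is defined and equals $h([\![f]\!]_M(\vec a))$, and $\vec a\in[\![R]\!]_M$ implies $h(\vec a)\in[\![R]\!]_N$. $\mathbf{PMod}\,\mathbb{S}$ is the category of partial $\mathbb{S}$-models and $\Sigma$-homomorphisms. Relative algebraic theories. An $\mathbb{S}$-relative ($\lambda$-ary) signature is a set $\Omega$ such that each $\omega\in\Omega$ is equipped with a $\lambda$-ary Horn formula $\mathrm{ar}(\omega)$ over $\Sigma$ and a sort $\mathrm{sort}(\omega)\in S$. $\Sigma+\Omega$ is the signature obtained by adding each $\omega$ as a function symbol $\omega\colon\sqcap_{i<\alpha}s_i\to\mathrm{sort}(\omega)$, where $(x_i:s_i)_{i<\alpha}$ is the context of $\mathrm{ar}(\omega)$. An $\mathbb{S}$-relative ($\lambda$-ary) judgment is a $\lambda$-ary Horn sequent $\phi\vdash_{\vec x}\psi$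 over $\Sigma+\Omega$ such that $\phi$ is over $\Sigma$. An $\mathbb{S}$-relative ($\lambda$-ary) algebraic theory is a pair $(\Omega,E)$ with $\Omega$ an $\mathbb{S}$-relative signature and $E$ a set of $\mathbb{S}$-relative judgments. An $\Omega$-algebra $\mathbb{A}$ is a partial $\mathbb{S}$-model $A$ with a total map $[\![\omega]\!]_{\mathbb{A}}\colon[\![\mathrm{ar}(\omega)]\!]_A\to A_{\mathrm{sort}(\omega)}$ for each $\omega\in\Omega$; it is regarded as a partial $(\Sigma+\Omega)$-structure in which $\omega$ is a partial map with domain $[\![\mathrm{ar}(\omega)]\!]_A$. $\mathbf{Alg}(\Omega,E)$ is the category of $\Omega$-algebras in which all judgments of $E$ are valid, with $(\Sigma+\Omega)$-homomorphisms. $U$ sends $\mathbb{A}$ to $A$. A monomorphism $h\colon\mathbb{A}\to\mathbb{B}$ in $\mathbf{Alg}(\Omega,E)$ is $\Sigma$-closed if for all function symbols $f$ and relation symbols $R$ of $\Sigma$ and tuples $\vec a$ from $A$: if $[\![f]\!]_B(h(\vec a))$ is defined then $[\![f]\!]_A(\vec a)$ is defined; if $h(\vec a)\in[\![R]\!]_B$ then $\vec a\in[\![R]\!]_A$. A morphism $p\colon X\to Y$ in a category is a $\lambda$-pure epimorphism if every morphism $\Gamma\to Y$ from a $\lambda$-presentable object $\Gamma$ factors through $p$. A morphism $p\colon X\to Y$ is a $(U,\lambda)$-pure epimorphism if $Up$ is a $\lambda$-pure epimorphism; then $Y$ is a $(U,\lambda)$-pure quotient of $X$. A full subcategory is replete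 if it is closed under isomorphic objects. Two objects $X,Y$ of a category are strongly connected if there exist morphisms $X\to Y$ and $Y\to X$. A category satisfies the ascending chain condition (ACC) if for every chain $X_0\to X_1\to X_2\to\cdots$ indexed by $\mathbb{N}$ there exists $N\in\mathbb{N}$ such that the objects $X_n$, $n\ge N$, are strongly connected to each other. *)

theory Defs
  imports Main "HOL-Library.FuncSet"
begin

unbundle cardinal_syntax

section \<open>Size conventions\<close>

text \<open>
  The cardinal \<open>\<lambda>\<close> is a well-ordered type \<open>'k\<close> whose order relation is a regular infinite
  cardinal. The elements \<open>\<alpha> :: 'k\<close> are exactly the ordinals \<open>\<alpha> < \<lambda>\<close>, and the index set of an
  \<open>\<alpha>\<close>-tuple is \<open>{..<\<alpha>}\<close>. For \<open>\<lambda> = \<aleph>\<^sub>0\<close> one takes \<open>'k = nat\<close>.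

  The category of sets is rendered by a universe type \<open>'u\<close> whose cardinality is strongly
  inaccessible: the sets of the paper are the sets of cardinality smaller than that of \<open>'u\<close>.
  (Uncountability of \<open>'u\<close> follows once an infinite \<open>\<lambda>\<close> is assumed to be small.)
\<close>

definition lam :: "'k::wellorder rel" where
  "lam = {(i, j). i \<le> j}"

definition small :: "'u itself \<Rightarrow> 'a set \<Rightarrow> bool" where
  "small _ A \<longleftrightarrow> |A| <o |UNIV :: 'u set|"

definition inaccessible :: "'u itself \<Rightarrow> bool" where
  "inaccessible U \<longleftrightarrow> Cinfinite |UNIV :: 'u set| \<and> regularCard |UNIV :: 'u set| \<and>
     (\<forall>A :: 'u set. small U A \<longrightarrow> small U (Pow A))"


section \<open>Categories\<close>

text \<open>\<open>Comp C X g f\<close> is the composite of \<open>f : X \<rightarrow> Y\<close> and \<open>g : Y \<rightarrow> Z\<close>; the domain \<open>X\<close> is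
  recorded because morphisms will be extensional functions.\<close>

record ('o, 'm) category =
  Ob :: "'o set"
  Hom :: "'o \<Rightarrow> 'o \<Rightarrow> 'm set"
  Id :: "'o \<Rightarrow> 'm"
  Comp :: "'o \<Rightarrow> 'm \<Rightarrow> 'm \<Rightarrow> 'm"

definition is_category :: "('o, 'm) category \<Rightarrow> bool" where
  "is_category C \<longleftrightarrow>
     (\<forall>X\<in>Ob C. Id C X \<in> Hom C X X) \<and>
     (\<forall>X\<in>Ob C. \<forall>Y\<in>Ob C. \<forall>Z\<in>Ob C. \<forall>f\<in>Hom C X Y. \<forall>g\<in>Hom C Y Z. Comp C X g f \<in> Hom C X Z) \<and>
     (\<forall>X\<in>Ob C. \<forall>Y\<in>Ob C. \<forall>f\<in>Hom C X Y. Comp C X f (Id C X) = f \<and> Comp C X (Id C Y) f = f) \<and>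
     (\<forall>W\<in>Ob C. \<forall>X\<in>Ob C. \<forall>Y\<in>Ob C. \<forall>Z\<in>Ob C. \<forall>f\<in>Hom C W X. \<forall>g\<in>Hom C X Y. \<forall>h\<in>Hom C Y Z.
        Comp C W h (Comp C W g f) = Comp C W (Comp C X h g) f)"

definition iso_objects :: "('o, 'm) category \<Rightarrow> 'o \<Rightarrow> 'o \<Rightarrow> bool" where
  "iso_objects C X Y \<longleftrightarrow>
     (\<exists>f\<in>Hom C X Y. \<exists>g\<in>Hom C Y X. Comp C X g f = Id C X \<and> Comp C Y f g = Id C Y)"

definition mono_in :: "('o, 'm) category \<Rightarrow> 'o \<Rightarrow> 'o \<Rightarrow> 'm \<Rightarrow> bool" where
  "mono_in C X Y h \<longleftrightarrow> h \<in> Hom C X Y \<and>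
     (\<forall>Z\<in>Ob C. \<forall>f\<in>Hom C Z X. \<forall>g\<in>Hom C Z X. Comp C Z h f = Comp C Z h g \<longrightarrow> f = g)"

text \<open>A full subcategory is given by its set of objects.\<close>

definition replete_full_subcategory :: "('o, 'm) category \<Rightarrow> 'o set \<Rightarrow> bool" where
  "replete_full_subcategory C E \<longleftrightarrow> E \<subseteq> Ob C \<and>
     (\<forall>X\<in>E. \<forall>Y\<in>Ob C. iso_objects C X Y \<longrightarrow> Y \<in> E)"

definition is_product ::
  "('o, 'm) category \<Rightarrow> 'i set \<Rightarrow> ('i \<Rightarrow> 'o) \<Rightarrow> 'o \<Rightarrow> ('i \<Rightarrow> 'm) \<Rightarrow> bool" where
  "is_product C J A P p \<longleftrightarrow> P \<in> Ob C \<and> (\<forall>j\<in>J. A j \<in> Ob C \<and> p j \<in> Hom C P (A j)) \<and>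
     (\<forall>Q\<in>Ob C. \<forall>q. (\<forall>j\<in>J. q j \<in> Hom C Q (A j)) \<longrightarrow>
        (\<exists>!u. u \<in> Hom C Q P \<and> (\<forall>j\<in>J. Comp C Q (p j) u = q j)))"

definition closed_under_products :: "'u itself \<Rightarrow> ('o, 'm) category \<Rightarrow> 'o set \<Rightarrow> bool" where
  "closed_under_products U C E \<longleftrightarrow>
     (\<forall>(J :: 'u set) A P p. small U J \<and> (\<forall>j\<in>J. A j \<in> E) \<and> is_product C J A P p \<longrightarrow> P \<in> E)"

definition strongly_connected :: "('o, 'm) category \<Rightarrow> 'o \<Rightarrow> 'o \<Rightarrow> bool" where
  "strongly_connected C X Y \<longleftrightarrow> Hom C X Y \<noteq> {} \<and> Hom C Y X \<noteq> {}"

definition ACC :: "('o, 'm) category \<Rightarrow> bool" where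
  "ACC C \<longleftrightarrow>
     (\<forall>(X :: nat \<Rightarrow> 'o) c. (\<forall>n. X n \<in> Ob C \<and> c n \<in> Hom C (X n) (X (Suc n))) \<longrightarrow>
        (\<exists>N. \<forall>m\<ge>N. \<forall>n\<ge>N. strongly_connected C (X m) (X n)))"


subsection \<open>Presentable objects\<close>

definition directed_poset :: "'k rel \<Rightarrow> 'i set \<Rightarrow> 'i rel \<Rightarrow> bool" where
  "directed_poset k I le \<longleftrightarrow> partial_order_on I le \<and>
     (\<forall>J\<subseteq>I. |J| <o k \<longrightarrow> (\<exists>u\<in>I. \<forall>j\<in>J. (j, u) \<in> le))"

definition is_diagram ::
  "('o, 'm) category \<Rightarrow> 'i set \<Rightarrow> 'i rel \<Rightarrow> ('i \<Rightarrow> 'o) \<Rightarrow> ('i \<Rightarrow> 'i \<Rightarrow> 'm) \<Rightarrow> bool" where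
  "is_diagram C I le D d \<longleftrightarrow>
     (\<forall>i\<in>I. D i \<in> Ob C \<and> d i i = Id C (D i)) \<and>
     (\<forall>(i, j)\<in>le. d i j \<in> Hom C (D i) (D j)) \<and>
     (\<forall>i j k. (i, j) \<in> le \<and> (j, k) \<in> le \<longrightarrow> Comp C (D i) (d j k) (d i j) = d i k)"

definition is_cocone ::
  "('o, 'm) category \<Rightarrow> 'i set \<Rightarrow> 'i rel \<Rightarrow> ('i \<Rightarrow> 'o) \<Rightarrow> ('i \<Rightarrow> 'i \<Rightarrow> 'm) \<Rightarrow>
     'o \<Rightarrow> ('i \<Rightarrow> 'm) \<Rightarrow> bool" where
  "is_cocone C I le D d L c \<longleftrightarrow> L \<in> Ob C \<and> (\<forall>i\<in>I. c i \<in> Hom C (D i) L) \<and>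
     (\<forall>(i, j)\<in>le. Comp C (D i) (c j) (d i j) = c i)"

definition is_colimit ::
  "('o, 'm) category \<Rightarrow> 'i set \<Rightarrow> 'i rel \<Rightarrow> ('i \<Rightarrow> 'o) \<Rightarrow> ('i \<Rightarrow> 'i \<Rightarrow> 'm) \<Rightarrow>
     'o \<Rightarrow> ('i \<Rightarrow> 'm) \<Rightarrow> bool" where
  "is_colimit C I le D d L c \<longleftrightarrow> is_cocone C I le D d L c \<and>
     (\<forall>L' c'. is_cocone C I le D d L' c' \<longrightarrow>
        (\<exists>!u. u \<in> Hom C L L' \<and> (\<forall>i\<in>I. Comp C (D i) u (c i) = c' i)))"

text \<open>
  \<open>\<Gamma>\<close> is \<open>k\<close>-presentable iff \<open>Hom(\<Gamma>, -)\<close> preserves small \<open>k\<close>-directed colimits, that is, iff for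
  each such colimit \<open>L = colim\<^sub>i D\<^sub>i\<close> the canonical map \<open>colim\<^sub>i Hom(\<Gamma>, D\<^sub>i) \<rightarrow> Hom(\<Gamma>, L)\<close> is
  bijective. The last two conjuncts are its surjectivity and its injectivity; two elements of
  \<open>Hom(\<Gamma>, D\<^sub>i)\<close> are equal in the directed colimit of sets iff some \<open>d\<^sub>i\<^sub>j\<close> identifies them.
\<close>

definition presentable :: "'u itself \<Rightarrow> 'k rel \<Rightarrow> ('o, 'm) category \<Rightarrow> 'o \<Rightarrow> bool" where
  "presentable U k C \<Gamma> \<longleftrightarrow> \<Gamma> \<in> Ob C \<and>
     (\<forall>(I :: 'u set) le D d L c.
        small U I \<and> directed_poset k I le \<and> is_diagram C I le D d \<and> is_colimit C I le D d L c \<longrightarrow>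
          (\<forall>f\<in>Hom C \<Gamma> L. \<exists>i\<in>I. \<exists>g\<in>Hom C \<Gamma> (D i). Comp C \<Gamma> (c i) g = f) \<and>
          (\<forall>i\<in>I. \<forall>g\<in>Hom C \<Gamma> (D i). \<forall>g'\<in>Hom C \<Gamma> (D i).
             Comp C \<Gamma> (c i) g = Comp C \<Gamma> (c i) g' \<longrightarrow>
             (\<exists>j. (i, j) \<in> le \<and> Comp C \<Gamma> (d i j) g = Comp C \<Gamma> (d i j) g')))"

definition pure_epi ::
  "'u itself \<Rightarrow> 'k rel \<Rightarrow> ('o, 'm) category \<Rightarrow> 'o \<Rightarrow> 'o \<Rightarrow> 'm \<Rightarrow> bool" where
  "pure_epi U k C X Y p \<longleftrightarrow> p \<in> Hom C X Y \<and>
     (\<forall>\<Gamma>. presentable U k C \<Gamma> \<longrightarrow>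
        (\<forall>f\<in>Hom C \<Gamma> Y. \<exists>g\<in>Hom C \<Gamma> X. Comp C \<Gamma> p g = f))"


section \<open>Signatures, terms and Horn formulas\<close>

text \<open>An arity \<open>(\<alpha>, s)\<close> stands for \<open>\<sqinter>\<^sub>i\<^sub><\<^sub>\<alpha> s\<^sub>i\<close>; the values \<open>s i\<close> for \<open>i \<ge> \<alpha>\<close> are irrelevant.\<close>

type_synonym ('s, 'k) arity = "'k \<times> ('k \<Rightarrow> 's)"

record ('s, 'f, 'r, 'k) signature =
  sorts :: "'s set"
  funs :: "'f set"
  rels :: "'r set"
  fdom :: "'f \<Rightarrow> ('s, 'k) arity"
  fcod :: "'f \<Rightarrow> 's"
  rdom :: "'r \<Rightarrow> ('s, 'k) arity"

definition is_signature :: "('s, 'f, 'r, 'k::wellorder) signature \<Rightarrow> bool" where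
  "is_signature \<Sigma> \<longleftrightarrow>
     (\<forall>f\<in>funs \<Sigma>. fcod \<Sigma> f \<in> sorts \<Sigma> \<and> (\<forall>i<fst (fdom \<Sigma> f). snd (fdom \<Sigma> f) i \<in> sorts \<Sigma>)) \<and>
     (\<forall>R\<in>rels \<Sigma>. \<forall>i<fst (rdom \<Sigma> R). snd (rdom \<Sigma> R) i \<in> sorts \<Sigma>)"

definition small_signature :: "'u itself \<Rightarrow> ('s, 'f, 'r, 'k) signature \<Rightarrow> bool" where
  "small_signature U \<Sigma> \<longleftrightarrow> small U (sorts \<Sigma>) \<and> small U (funs \<Sigma>) \<and> small U (rels \<Sigma>)"

text \<open>
  The variables of sort \<open>s\<close> are the pairs \<open>(s, i)\<close> with \<open>i :: 'k\<close>. In \<open>App f \<tau>\<close>, \<open>Rel R \<tau>\<close> and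
  \<open>Conj \<alpha> \<phi>\<close> only the entries with index below the arity of \<open>f\<close>, of \<open>R\<close>, resp. below \<open>\<alpha>\<close>
  matter; all definitions below ignore the others.
\<close>

type_synonym ('s, 'k) var = "'s \<times> 'k"

datatype ('s, 'f, 'k) trm =
    Var "('s, 'k) var"
  | App 'f "'k \<Rightarrow> ('s, 'f, 'k) trm"

datatype ('s, 'f, 'r, 'k) fm =
    Rel 'r "'k \<Rightarrow> ('s, 'f, 'k) trm"
  | Eq "('s, 'f, 'k) trm" "('s, 'f, 'k) trm"
  | Top
  | Conj 'k "'k \<Rightarrow> ('s, 'f, 'r, 'k) fm"

text \<open>\<open>is_term \<Sigma> V \<tau> s\<close>: \<open>\<tau>\<close> is a raw term over \<open>\<Sigma>\<close> of sort \<open>s\<close> with all its variables in \<open>V\<close>;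
  similarly for formulas.\<close>

inductive is_term ::
  "('s, 'f, 'r, 'k::wellorder) signature \<Rightarrow> ('s, 'k) var set \<Rightarrow> ('s, 'f, 'k) trm \<Rightarrow> 's \<Rightarrow> bool"
  for \<Sigma> V where
  "v \<in> V \<Longrightarrow> fst v \<in> sorts \<Sigma> \<Longrightarrow> is_term \<Sigma> V (Var v) (fst v)"
| "f \<in> funs \<Sigma> \<Longrightarrow> (\<And>i. i < fst (fdom \<Sigma> f) \<Longrightarrow> is_term \<Sigma> V (\<tau> i) (snd (fdom \<Sigma> f) i)) \<Longrightarrow>
     is_term \<Sigma> V (App f \<tau>) (fcod \<Sigma> f)"

inductive is_formula ::
  "('s, 'f, 'r, 'k::wellorder) signature \<Rightarrow> ('s, 'k) var set \<Rightarrow> ('s, 'f, 'r, 'k) fm \<Rightarrow> bool"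
  for \<Sigma> V where
  "R \<in> rels \<Sigma> \<Longrightarrow> (\<And>i. i < fst (rdom \<Sigma> R) \<Longrightarrow> is_term \<Sigma> V (\<tau> i) (snd (rdom \<Sigma> R) i)) \<Longrightarrow>
     is_formula \<Sigma> V (Rel R \<tau>)"
| "is_term \<Sigma> V \<tau> s \<Longrightarrow> is_term \<Sigma> V \<tau>' s \<Longrightarrow> is_formula \<Sigma> V (Eq \<tau> \<tau>')"
| "is_formula \<Sigma> V Top"
| "(\<And>i. i < \<alpha> \<Longrightarrow> is_formula \<Sigma> V (\<phi> i)) \<Longrightarrow> is_formula \<Sigma> V (Conj \<alpha> \<phi>)"

text \<open>A context \<open>(\<alpha>, x)\<close> is the tuple of distinct variables \<open>x i\<close>, \<open>i < \<alpha>\<close>.\<close>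

type_synonym ('s, 'k) ctx = "'k \<times> ('k \<Rightarrow> ('s, 'k) var)"

definition is_ctx :: "('s, 'f, 'r, 'k::wellorder) signature \<Rightarrow> ('s, 'k) ctx \<Rightarrow> bool" where
  "is_ctx \<Sigma> x \<longleftrightarrow> inj_on (snd x) {..<fst x} \<and> (\<forall>i<fst x. fst (snd x i) \<in> sorts \<Sigma>)"

definition ctx_vars :: "('s, 'k::wellorder) ctx \<Rightarrow> ('s, 'k) var set" where
  "ctx_vars x = snd x ` {..<fst x}"

definition ctx_arity :: "('s, 'k) ctx \<Rightarrow> ('s, 'k) arity" where
  "ctx_arity x = (fst x, \<lambda>i. fst (snd x i))"

type_synonym ('s, 'f, 'r, 'k) hformula = "('s, 'k) ctx \<times> ('s, 'f, 'r, 'k) fm"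

fun is_hformula ::
  "('s, 'f, 'r, 'k::wellorder) signature \<Rightarrow> ('s, 'f, 'r, 'k) hformula \<Rightarrow> bool" where
  "is_hformula \<Sigma> (x, \<phi>) \<longleftrightarrow> is_ctx \<Sigma> x \<and> is_formula \<Sigma> (ctx_vars x) \<phi>"

text \<open>The triple \<open>(x, \<phi>, \<psi>)\<close> is the sequent \<open>\<phi> \<turnstile>\<^sub>x \<psi>\<close>.\<close>

type_synonym ('s, 'f, 'r, 'k) sequent =
  "('s, 'k) ctx \<times> ('s, 'f, 'r, 'k) fm \<times> ('s, 'f, 'r, 'k) fm"

fun is_sequent ::
  "('s, 'f, 'r, 'k::wellorder) signature \<Rightarrow> ('s, 'f, 'r, 'k) sequent \<Rightarrow> bool" where
  "is_sequent \<Sigma> (x, \<phi>, \<psi>) \<longleftrightarrow> is_hformula \<Sigma> (x, \<phi>) \<and> is_hformula \<Sigma> (x, \<psi>)"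

definition horn_theory ::
  "('s, 'f, 'r, 'k::wellorder) signature \<Rightarrow> ('s, 'f, 'r, 'k) sequent set \<Rightarrow> bool" where
  "horn_theory \<Sigma> \<S> \<longleftrightarrow> (\<forall>q\<in>\<S>. is_sequent \<Sigma> q)"


section \<open>Partial structures\<close>

record ('s, 'f, 'r, 'k, 'u) pstructure =
  car :: "'s \<Rightarrow> 'u set"
  fint :: "'f \<Rightarrow> ('k \<Rightarrow> 'u) \<Rightarrow> 'u option"
  rint :: "'r \<Rightarrow> ('k \<Rightarrow> 'u) set"

definition tuples ::
  "('s, 'f, 'r, 'k::wellorder, 'u) pstructure \<Rightarrow> ('s, 'k) arity \<Rightarrow> ('k \<Rightarrow> 'u) set" where
  "tuples M a = (\<Pi>\<^sub>E i\<in>{..<fst a}. car M (snd a i))"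

text \<open>The values at symbols outside \<open>\<Sigma>\<close> are normalised, so that equal \<open>\<Sigma>\<close>-structures are equal
  as records.\<close>

definition is_structure ::
  "('s, 'f, 'r, 'k::wellorder) signature \<Rightarrow> ('s, 'f, 'r, 'k, 'u) pstructure \<Rightarrow> bool" where
  "is_structure \<Sigma> M \<longleftrightarrow>
     (\<forall>s\<in>sorts \<Sigma>. small TYPE('u) (car M s)) \<and>
     (\<forall>f\<in>funs \<Sigma>. \<forall>a b. fint M f a = Some b \<longrightarrow>
        a \<in> tuples M (fdom \<Sigma> f) \<and> b \<in> car M (fcod \<Sigma> f)) \<and>
     (\<forall>R\<in>rels \<Sigma>. rint M R \<subseteq> tuples M (rdom \<Sigma> R)) \<and>
     (\<forall>s. s \<notin> sorts \<Sigma> \<longrightarrow> car M s = {}) \<and>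
     (\<forall>f. f \<notin> funs \<Sigma> \<longrightarrow> fint M f = (\<lambda>_. None)) \<and>
     (\<forall>R. R \<notin> rels \<Sigma> \<longrightarrow> rint M R = {})"

primrec eval ::
  "('s, 'f, 'r, 'k::wellorder) signature \<Rightarrow> ('s, 'f, 'r, 'k, 'u) pstructure \<Rightarrow>
     (('s, 'k) var \<Rightarrow> 'u) \<Rightarrow> ('s, 'f, 'k) trm \<Rightarrow> 'u option" where
  "eval \<Sigma> M e (Var v) = Some (e v)"
| "eval \<Sigma> M e (App f \<tau>) =
     (if \<forall>i<fst (fdom \<Sigma> f). eval \<Sigma> M e (\<tau> i) \<noteq> None
      then fint M f (\<lambda>i\<in>{..<fst (fdom \<Sigma> f)}. the (eval \<Sigma> M e (\<tau> i)))
      else None)"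

primrec holds ::
  "('s, 'f, 'r, 'k::wellorder) signature \<Rightarrow> ('s, 'f, 'r, 'k, 'u) pstructure \<Rightarrow>
     (('s, 'k) var \<Rightarrow> 'u) \<Rightarrow> ('s, 'f, 'r, 'k) fm \<Rightarrow> bool" where
  "holds \<Sigma> M e (Rel R \<tau>) \<longleftrightarrow>
     (\<forall>i<fst (rdom \<Sigma> R). eval \<Sigma> M e (\<tau> i) \<noteq> None) \<and>
     (\<lambda>i\<in>{..<fst (rdom \<Sigma> R)}. the (eval \<Sigma> M e (\<tau> i))) \<in> rint M R"
| "holds \<Sigma> M e (Eq \<tau> \<tau>') \<longleftrightarrow> eval \<Sigma> M e \<tau> \<noteq> None \<and> eval \<Sigma> M e \<tau> = eval \<Sigma> M e \<tau>'"
| "holds \<Sigma> M e Top \<longleftrightarrow> True"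
| "holds \<Sigma> M e (Conj \<alpha> \<phi>) \<longleftrightarrow> (\<forall>i<\<alpha>. holds \<Sigma> M e (\<phi> i))"

text \<open>The assignment \<open>x\<^sub>i \<mapsto> m\<^sub>i\<close> given by a tuple \<open>m\<close> for the context \<open>x\<close>.\<close>

definition assign :: "('s, 'k::wellorder) ctx \<Rightarrow> ('k \<Rightarrow> 'u) \<Rightarrow> ('s, 'k) var \<Rightarrow> 'u" where
  "assign x m v = m (inv_into {..<fst x} (snd x) v)"

fun interp ::
  "('s, 'f, 'r, 'k::wellorder) signature \<Rightarrow> ('s, 'f, 'r, 'k, 'u) pstructure \<Rightarrow>
     ('s, 'f, 'r, 'k) hformula \<Rightarrow> ('k \<Rightarrow> 'u) set" where
  "interp \<Sigma> M (x, \<phi>) = {m \<in> tuples M (ctx_arity x). holds \<Sigma> M (assign x m) \<phi>}"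

fun valid ::
  "('s, 'f, 'r, 'k::wellorder) signature \<Rightarrow> ('s, 'f, 'r, 'k, 'u) pstructure \<Rightarrow>
     ('s, 'f, 'r, 'k) sequent \<Rightarrow> bool" where
  "valid \<Sigma> M (x, \<phi>, \<psi>) \<longleftrightarrow> interp \<Sigma> M (x, \<phi>) \<subseteq> interp \<Sigma> M (x, \<psi>)"

definition is_model ::
  "('s, 'f, 'r, 'k::wellorder) signature \<Rightarrow> ('s, 'f, 'r, 'k) sequent set \<Rightarrow>
     ('s, 'f, 'r, 'k, 'u) pstructure \<Rightarrow> bool" where
  "is_model \<Sigma> \<S> M \<longleftrightarrow> is_structure \<Sigma> M \<and> (\<forall>q\<in>\<S>. valid \<Sigma> M q)"

type_synonym ('s, 'u) hom = "'s \<Rightarrow> 'u \<Rightarrow> 'u"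

definition map_tuple :: "('s, 'k::wellorder) arity \<Rightarrow> ('s, 'u) hom \<Rightarrow> ('k \<Rightarrow> 'u) \<Rightarrow> 'k \<Rightarrow> 'u" where
  "map_tuple a h m = (\<lambda>i\<in>{..<fst a}. h (snd a i) (m i))"

definition homs ::
  "('s, 'f, 'r, 'k::wellorder) signature \<Rightarrow> ('s, 'f, 'r, 'k, 'u) pstructure \<Rightarrow>
     ('s, 'f, 'r, 'k, 'u) pstructure \<Rightarrow> ('s, 'u) hom set" where
  "homs \<Sigma> M N = {h.
     (\<forall>s. h s \<in> car M s \<rightarrow>\<^sub>E car N s) \<and>
     (\<forall>f\<in>funs \<Sigma>. \<forall>a b. fint M f a = Some b \<longrightarrow>
        fint N f (map_tuple (fdom \<Sigma> f) h a) = Some (h (fcod \<Sigma> f) b)) \<and>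
     (\<forall>R\<in>rels \<Sigma>. \<forall>a\<in>rint M R. map_tuple (rdom \<Sigma> R) h a \<in> rint N R)}"

definition structure_category ::
  "('s, 'f, 'r, 'k::wellorder) signature \<Rightarrow> ('s, 'f, 'r, 'k, 'u) pstructure set \<Rightarrow>
     (('s, 'f, 'r, 'k, 'u) pstructure, ('s, 'u) hom) category" where
  "structure_category \<Sigma> K =
     \<lparr>Ob = K,
      Hom = homs \<Sigma>,
      Id = (\<lambda>M s. \<lambda>a\<in>car M s. a),
      Comp = (\<lambda>M g f s. compose (car M s) (g s) (f s))\<rparr>"

lemma map_tuple_compose:
  assumes "a \<in> tuples M t"
  shows "map_tuple t (\<lambda>s. compose (car M s) (g s) (f s)) a = map_tuple t g (map_tuple t f a)"
  using assms by (auto simp: map_tuple_def tuples_def compose_def fun_eq_iff PiE_iff)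

lemma map_tuple_id:
  assumes "a \<in> tuples M t"
  shows "map_tuple t (\<lambda>s. \<lambda>x\<in>car M s. x) a = a"
  using assms by (auto simp: map_tuple_def tuples_def fun_eq_iff PiE_iff extensional_def)

lemma is_category_structure_category:
  fixes K :: "('s, 'f, 'r, 'k::wellorder, 'u) pstructure set"
  assumes "\<And>M. M \<in> K \<Longrightarrow> is_structure \<Sigma> M"
  shows "is_category (structure_category \<Sigma> K)"
proof -
  have id: "(\<lambda>s. \<lambda>x\<in>car M s. x) \<in> homs \<Sigma> M M" if "M \<in> K" for M
  proof -
    have "b \<in> car M (fcod \<Sigma> k)" "map_tuple (fdom \<Sigma> k) (\<lambda>s. \<lambda>x\<in>car M s. x) a = a"
      if "k \<in> funs \<Sigma>" "fint M k a = Some b" for k a b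
      using assms[OF \<open>M \<in> K\<close>] that by (auto simp: is_structure_def intro: map_tuple_id)
    moreover have "map_tuple (rdom \<Sigma> R) (\<lambda>s. \<lambda>x\<in>car M s. x) a = a"
      if "R \<in> rels \<Sigma>" "a \<in> rint M R" for R a
      using assms[OF \<open>M \<in> K\<close>] that by (intro map_tuple_id) (auto simp: is_structure_def)
    ultimately show ?thesis by (simp add: homs_def)
  qed
  have comp: "(\<lambda>s. compose (car M s) (g s) (f s)) \<in> homs \<Sigma> M P"
    if "M \<in> K" and f: "f \<in> homs \<Sigma> M N" and g: "g \<in> homs \<Sigma> N P" for M N P f g
  proof -
    have fs: "f s \<in> car M s \<rightarrow>\<^sub>E car N s" and gs: "g s \<in> car N s \<rightarrow>\<^sub>E car P s" for s
      using f g by (auto simp: homs_def)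
    have "compose (car M s) (g s) (f s) \<in> car M s \<rightarrow>\<^sub>E car P s" for s
      using fs[of s] gs[of s] by (auto simp: compose_def)
    moreover have "fint P k (map_tuple (fdom \<Sigma> k) (\<lambda>s. compose (car M s) (g s) (f s)) a) =
        Some (compose (car M (fcod \<Sigma> k)) (g (fcod \<Sigma> k)) (f (fcod \<Sigma> k)) b)"
      if k: "k \<in> funs \<Sigma>" and ab: "fint M k a = Some b" for k a b
    proof -
      have "a \<in> tuples M (fdom \<Sigma> k)" "b \<in> car M (fcod \<Sigma> k)"
        using assms[OF \<open>M \<in> K\<close>] k ab by (auto simp: is_structure_def)
      then show ?thesis
        using f g k ab by (auto simp: map_tuple_compose homs_def compose_eq)
    qed
    moreover have "map_tuple (rdom \<Sigma> R) (\<lambda>s. compose (car M s) (g s) (f s)) a \<in> rint P R"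
      if R: "R \<in> rels \<Sigma>" and a: "a \<in> rint M R" for R a
    proof -
      have "a \<in> tuples M (rdom \<Sigma> R)"
        using assms[OF \<open>M \<in> K\<close>] R a by (auto simp: is_structure_def)
      then show ?thesis
        using f g R a by (auto simp: map_tuple_compose homs_def)
    qed
    ultimately show ?thesis by (simp add: homs_def)
  qed
  have maps: "f s \<in> car M s \<rightarrow>\<^sub>E car N s" if "f \<in> homs \<Sigma> M N" for M N f s
    using that by (simp add: homs_def)
  have unit: "compose A f (\<lambda>x\<in>A. x) = f" "compose A (\<lambda>x\<in>B. x) f = f"
    if "f \<in> A \<rightarrow>\<^sub>E B" for A B and f :: "'u \<Rightarrow> 'u"
    using PiE_mem[OF that] PiE_arb[OF that] by (auto simp: compose_def)
  have assoc: "compose A h (compose A g f) = compose A (compose B h g) f"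
    if "f \<in> A \<rightarrow>\<^sub>E B" for A B and f g h :: "'u \<Rightarrow> 'u"
    using PiE_mem[OF that] by (auto simp: compose_def)
  show ?thesis
    unfolding is_category_def structure_category_def
    by (auto intro!: id comp ext unit[OF maps, THEN fun_cong] assoc[OF maps, THEN fun_cong])
qed

definition PMod ::
  "('s, 'f, 'r, 'k::wellorder) signature \<Rightarrow> ('s, 'f, 'r, 'k) sequent set \<Rightarrow>
     (('s, 'f, 'r, 'k, 'u) pstructure, ('s, 'u) hom) category" where
  "PMod \<Sigma> \<S> = structure_category \<Sigma> {M. is_model \<Sigma> \<S> M}"


section \<open>Relative algebraic theories\<close>

record ('s, 'f, 'r, 'k, 'w) rel_signature =
  ops :: "'w set"
  ar :: "'w \<Rightarrow> ('s, 'f, 'r, 'k) hformula"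
  opsort :: "'w \<Rightarrow> 's"

definition is_rel_signature ::
  "('s, 'f, 'r, 'k::wellorder) signature \<Rightarrow> ('s, 'f, 'r, 'k, 'w) rel_signature \<Rightarrow> bool" where
  "is_rel_signature \<Sigma> \<Omega> \<longleftrightarrow> (\<forall>\<omega>\<in>ops \<Omega>. is_hformula \<Sigma> (ar \<Omega> \<omega>) \<and> opsort \<Omega> \<omega> \<in> sorts \<Sigma>)"

text \<open>The signature \<open>\<Sigma> + \<Omega>\<close>.\<close>

definition sig_plus ::
  "('s, 'f, 'r, 'k) signature \<Rightarrow> ('s, 'f, 'r, 'k, 'w) rel_signature \<Rightarrow>
     ('s, 'f + 'w, 'r, 'k) signature" where
  "sig_plus \<Sigma> \<Omega> =
     \<lparr>sorts = sorts \<Sigma>,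
      funs = funs \<Sigma> <+> ops \<Omega>,
      rels = rels \<Sigma>,
      fdom = case_sum (fdom \<Sigma>) (\<lambda>\<omega>. ctx_arity (fst (ar \<Omega> \<omega>))),
      fcod = case_sum (fcod \<Sigma>) (opsort \<Omega>),
      rdom = rdom \<Sigma>\<rparr>"

text \<open>Formulas over \<open>\<Sigma>\<close> are regarded as formulas over \<open>\<Sigma> + \<Omega>\<close> by renaming \<open>f\<close> to \<open>Inl f\<close>.\<close>

fun is_judgment ::
  "('s, 'f, 'r, 'k::wellorder) signature \<Rightarrow> ('s, 'f, 'r, 'k, 'w) rel_signature \<Rightarrow>
     ('s, 'f + 'w, 'r, 'k) sequent \<Rightarrow> bool" where
  "is_judgment \<Sigma> \<Omega> (x, \<phi>, \<psi>) \<longleftrightarrow> is_sequent (sig_plus \<Sigma> \<Omega>) (x, \<phi>, \<psi>) \<and>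
     (\<exists>\<phi>\<^sub>0. is_hformula \<Sigma> (x, \<phi>\<^sub>0) \<and> \<phi> = map_fm id Inl id \<phi>\<^sub>0)"

definition rel_alg_theory ::
  "('s, 'f, 'r, 'k::wellorder) signature \<Rightarrow> ('s, 'f, 'r, 'k, 'w) rel_signature \<Rightarrow>
     ('s, 'f + 'w, 'r, 'k) sequent set \<Rightarrow> bool" where
  "rel_alg_theory \<Sigma> \<Omega> E \<longleftrightarrow> is_rel_signature \<Sigma> \<Omega> \<and> (\<forall>q\<in>E. is_judgment \<Sigma> \<Omega> q)"

text \<open>The forgetful functor \<open>U\<close> on objects. On morphisms it is the identity, since a
  \<open>(\<Sigma> + \<Omega>)\<close>-homomorphism and its underlying \<open>\<Sigma>\<close>-homomorphism are the same family of maps.\<close>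

definition reduct ::
  "('s, 'f + 'w, 'r, 'k, 'u) pstructure \<Rightarrow> ('s, 'f, 'r, 'k, 'u) pstructure" where
  "reduct A = \<lparr>car = car A, fint = (\<lambda>f. fint A (Inl f)), rint = rint A\<rparr>"

definition is_algebra ::
  "('s, 'f, 'r, 'k::wellorder) signature \<Rightarrow> ('s, 'f, 'r, 'k) sequent set \<Rightarrow>
     ('s, 'f, 'r, 'k, 'w) rel_signature \<Rightarrow> ('s, 'f + 'w, 'r, 'k, 'u) pstructure \<Rightarrow> bool" where
  "is_algebra \<Sigma> \<S> \<Omega> A \<longleftrightarrow>
     is_structure (sig_plus \<Sigma> \<Omega>) A \<and> is_model \<Sigma> \<S> (reduct A) \<and>
     (\<forall>\<omega>\<in>ops \<Omega>. dom (fint A (Inr \<omega>)) = interp \<Sigma> (reduct A) (ar \<Omega> \<omega>))"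

definition Alg ::
  "('s, 'f, 'r, 'k::wellorder) signature \<Rightarrow> ('s, 'f, 'r, 'k) sequent set \<Rightarrow>
     ('s, 'f, 'r, 'k, 'w) rel_signature \<Rightarrow> ('s, 'f + 'w, 'r, 'k) sequent set \<Rightarrow>
     (('s, 'f + 'w, 'r, 'k, 'u) pstructure, ('s, 'u) hom) category" where
  "Alg \<Sigma> \<S> \<Omega> E = structure_category (sig_plus \<Sigma> \<Omega>)
     {A. is_algebra \<Sigma> \<S> \<Omega> A \<and> (\<forall>q\<in>E. valid (sig_plus \<Sigma> \<Omega>) A q)}"

lemma is_category_PMod: "is_category (PMod \<Sigma> \<S>)"
  unfolding PMod_def by (rule is_category_structure_category) (simp add: is_model_def)

lemma is_category_Alg: "is_category (Alg \<Sigma> \<S> \<Omega> E)"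
  unfolding Alg_def by (rule is_category_structure_category) (simp add: is_algebra_def)

text \<open>The forgetful functor \<open>U\<close> is well defined on objects and on morphisms.\<close>

lemma reduct_in_PMod: "A \<in> Ob (Alg \<Sigma> \<S> \<Omega> E) \<Longrightarrow> reduct A \<in> Ob (PMod \<Sigma> \<S>)"
  by (simp add: Alg_def PMod_def structure_category_def is_algebra_def)

lemma homs_reduct: "h \<in> homs (sig_plus \<Sigma> \<Omega>) A B \<Longrightarrow> h \<in> homs \<Sigma> (reduct A) (reduct B)"
  unfolding homs_def sig_plus_def reduct_def by (fastforce dest: bspec[OF _ InlI])

definition sigma_closed ::
  "('s, 'f, 'r, 'k::wellorder) signature \<Rightarrow> ('s, 'f + 'w, 'r, 'k, 'u) pstructure \<Rightarrow>
     ('s, 'f + 'w, 'r, 'k, 'u) pstructure \<Rightarrow> ('s, 'u) hom \<Rightarrow> bool" where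
  "sigma_closed \<Sigma> A B h \<longleftrightarrow>
     (\<forall>f\<in>funs \<Sigma>. \<forall>a\<in>tuples A (fdom \<Sigma> f).
        fint B (Inl f) (map_tuple (fdom \<Sigma> f) h a) \<noteq> None \<longrightarrow> fint A (Inl f) a \<noteq> None) \<and>
     (\<forall>R\<in>rels \<Sigma>. \<forall>a\<in>tuples A (rdom \<Sigma> R).
        map_tuple (rdom \<Sigma> R) h a \<in> rint B R \<longrightarrow> a \<in> rint A R)"

definition closed_under_sigma_closed_subobjects ::
  "('s, 'f, 'r, 'k::wellorder) signature \<Rightarrow>
     (('s, 'f + 'w, 'r, 'k, 'u) pstructure, ('s, 'u) hom) category \<Rightarrow>
     ('s, 'f + 'w, 'r, 'k, 'u) pstructure set \<Rightarrow> bool" where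
  "closed_under_sigma_closed_subobjects \<Sigma> C K \<longleftrightarrow>
     (\<forall>A\<in>Ob C. \<forall>B\<in>K. \<forall>h. mono_in C A B h \<and> sigma_closed \<Sigma> A B h \<longrightarrow> A \<in> K)"

text \<open>Closure under \<open>(U, \<lambda>)\<close>-pure quotients.\<close>

definition closed_under_pure_quotients ::
  "('s, 'f, 'r, 'k::wellorder) signature \<Rightarrow> ('s, 'f, 'r, 'k) sequent set \<Rightarrow>
     (('s, 'f + 'w, 'r, 'k, 'u) pstructure, ('s, 'u) hom) category \<Rightarrow>
     ('s, 'f + 'w, 'r, 'k, 'u) pstructure set \<Rightarrow> bool" where
  "closed_under_pure_quotients \<Sigma> \<S> C K \<longleftrightarrow>
     (\<forall>A\<in>K. \<forall>B\<in>Ob C. \<forall>p\<in>Hom C A B.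
        pure_epi TYPE('u) (lam :: 'k rel) (PMod \<Sigma> \<S>) (reduct A) (reduct B) p \<longrightarrow> B \<in> K)"

end

theory Submission
  imports Defs
begin

text \<open>
  Judgments are inherited along families of homomorphisms that jointly reflect equality,
  definedness and relations; this covers products and \<open>\<Sigma>\<close>-closed subobjects. They are inherited by
  \<open>(U, \<lambda>)\<close>-pure quotients because the model presented by the premise of a judgment is
  \<open>\<lambda>\<close>-presentable.

  Conversely, let \<open>A\<close> satisfy all judgments valid in a closed class. Each set \<open>X\<close> of fewer than \<open>\<lambda>\<close>
  atomic facts \<open>f(a) = b\<close>, \<open>R(a)\<close> of the reduct of \<open>A\<close> presents a free algebra \<open>F\<^sub>X\<close> of the class,
  and the judgments satisfied by \<open>A\<close> give a homomorphism from \<open>F\<^sub>X\<close> to \<open>A\<close>. By the ascending chain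
  condition the reducts of the \<open>F\<^sub>X\<close> are strongly connected for all large \<open>X\<close>. The families in the
  product of these \<open>F\<^sub>X\<close> that are eventually coherent form a \<open>\<Sigma>\<close>-closed subalgebra, and evaluation
  at a late stage maps it to \<open>A\<close>. This map is pure: a morphism from a \<open>\<lambda>\<close>-presentable object to the
  reduct of \<open>A\<close>, followed by the canonical section into the directed colimit of the \<open>F\<^sub>X\<close>, factors
  through some \<open>F\<^sub>X\<close>, and strong connectedness extends the connecting maps out of \<open>F\<^sub>X\<close> to a coherent
  family.
\<close>

section \<open>Small sets\<close>

text \<open>Closure under directed colimits is not among the assumptions, so a colimit of free
  algebras has to be replaced by an algebra cut out of a product. The obstacle is that a coherent
  family starting at a stage \<open>X\<close> lives only on the stages above \<open>X\<close> and is
  not yet an element of the product. The ascending chain condition fills the gap: beyond some stage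
  there are \<open>\<Sigma>\<close>-homomorphisms between any two stages, in particular from
  \<open>X\<close> to the stages not above it. These need not respect \<open>\<Omega>\<close>, since
  purity is tested in \<open>PMod\<close>, and evaluation looks only at late stages, so the
  filled-in values do not matter. A second obstacle is that \<open>A\<close> is not known to be a
  colimit of the \<open>free X\<close>, which belong to the class while \<open>A\<close> is not yet
  known to. Its reduct is only a retract of the colimit of their reducts, but a retract suffices for
  factoring maps out of presentable objects. A third one is size. A free algebra is built from all
  its interpretations in a class that is not small; its terms are bounded by sets of paths, and one
  witness for each failing fact leaves a small family to which closure under products
  applies.\<close>

lemma small_mono: "small U B \<Longrightarrow> |A| \<le>o |B| \<Longrightarrow> small U A"
  by (metis small_def ordLeq_ordLess_trans)

lemma small_subset: "small U B \<Longrightarrow> A \<subseteq> B \<Longrightarrow> small U A"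
  by (meson small_mono card_of_mono1)

lemma small_image: "small U A \<Longrightarrow> small U (f ` A)"
  by (meson small_mono card_of_image)

lemma small_inj_on: "small U B \<Longrightarrow> inj_on f A \<Longrightarrow> f ` A \<subseteq> B \<Longrightarrow> small U A"
  by (meson small_mono card_of_ordLeqI image_subset_iff)

text \<open>Carriers must be subsets of \<open>'u\<close>, while the constructions below produce
  sets of functions or pairs. Such an injection turns these into carriers, and other index sets into
  subsets of \<open>'u\<close>.\<close>

lemma small_code:
  assumes "small TYPE('u) A"
  obtains f :: "'a \<Rightarrow> 'u" where "inj_on f A"
proof -
  have "|A| \<le>o |UNIV :: 'u set|"
    using assms unfolding small_def by (rule ordLess_imp_ordLeq)
  then show thesis using that by (auto simp: card_of_ordLeq[symmetric])
qed

locale universe =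
  fixes U :: "'u itself"
  assumes inacc: "inaccessible TYPE('u)"
begin

lemma Cinfinite_u: "Cinfinite |UNIV :: 'u set|"
  and regular_u: "regularCard |UNIV :: 'u set|"
  using inacc by (auto simp: inaccessible_def)

lemma infinite_u: "infinite (UNIV :: 'u set)"
  using Cinfinite_u by (simp add: cinfinite_def Field_card_of)

lemma small_UN:
  "small TYPE('u) I \<Longrightarrow> (\<And>i. i \<in> I \<Longrightarrow> small TYPE('u) (A i)) \<Longrightarrow> small TYPE('u) (\<Union>i\<in>I. A i)"
  unfolding small_def by (rule regularCard_UNION_bound[OF Cinfinite_u regular_u])

lemma small_Times: "small TYPE('u) A \<Longrightarrow> small TYPE('u) B \<Longrightarrow> small TYPE('u) (A \<times> B)"
proof -
  assume A: "small TYPE('u) A" and B: "small TYPE('u) B"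
  have "A \<times> B = (\<Union>a\<in>A. Pair a ` B)" by auto
  then show ?thesis by (auto intro!: small_UN A small_image B)
qed

lemma small_Sigma:
  "small TYPE('u) A \<Longrightarrow> (\<And>a. a \<in> A \<Longrightarrow> small TYPE('u) (B a)) \<Longrightarrow> small TYPE('u) (Sigma A B)"
proof -
  assume A: "small TYPE('u) A" and B: "\<And>a. a \<in> A \<Longrightarrow> small TYPE('u) (B a)"
  have "Sigma A B = (\<Union>a\<in>A. Pair a ` B a)" by auto
  then show ?thesis by (auto intro!: small_UN A small_image B)
qed

lemma small_finite: "finite A \<Longrightarrow> small TYPE('u) A"
  unfolding small_def
  by (rule finite_ordLess_infinite[OF card_of_Well_order card_of_Well_order])
    (simp_all add: Field_card_of infinite_u)

lemma small_Un: "small TYPE('u) A \<Longrightarrow> small TYPE('u) B \<Longrightarrow> small TYPE('u) (A \<union> B)"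
  unfolding small_def
  using Cinfinite_u by (intro Un_Cinfinite_bound_strict) auto

lemma small_Plus: "small TYPE('u) A \<Longrightarrow> small TYPE('u) B \<Longrightarrow> small TYPE('u) (A <+> B)"
  unfolding Plus_def by (intro small_Un small_image)

lemma small_Pow: "small TYPE('u) A \<Longrightarrow> small TYPE('u) (Pow A)"
proof -
  assume A: "small TYPE('u) A"
  then obtain f :: "'a \<Rightarrow> 'u" where f: "inj_on f A" by (rule small_code)
  have "small TYPE('u) (Pow (f ` A))"
    using inacc small_image[OF A, of f] by (auto simp: inaccessible_def)
  then show ?thesis
    by (rule small_inj_on[OF _ inj_on_image_Pow[OF f]]) auto
qed

text \<open>A function in the product is determined by its graph, a subset of
  \<open>Sigma J A\<close>, so the bound comes from closure of the universe under power
  sets.\<close>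

lemma small_PiE:
  assumes J: "small TYPE('u) J" and A: "\<And>j. j \<in> J \<Longrightarrow> small TYPE('u) (A j)"
  shows "small TYPE('u) (Pi\<^sub>E J A)"
proof (rule small_inj_on)
  show "small TYPE('u) (Pow (Sigma J A))" using assms by (intro small_Pow small_Sigma)
  show "inj_on (\<lambda>g. {(j, g j) |j. j \<in> J}) (Pi\<^sub>E J A)"
  proof (rule inj_onI)
    fix f g assume f: "f \<in> Pi\<^sub>E J A" and g: "g \<in> Pi\<^sub>E J A"
      and eq: "{(j, f j) |j. j \<in> J} = {(j, g j) |j. j \<in> J}"
    show "f = g"
      by (rule PiE_ext[OF f g]) (use eq in blast)
  qed
qed auto

text \<open>Lists of indices are the addresses in a term tree; this bound is what later keeps the
  number of terms small.\<close>

lemma small_lists: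
  fixes A :: "'a set"
  assumes A: "small TYPE('u) A" and nat: "small TYPE('u) (UNIV :: nat set)"
  shows "small TYPE('u) (lists A)"
proof -
  have "small TYPE('u) {l. set l \<subseteq> A \<and> length l = n}" for n
  proof (induction n)
    case 0
    have "{l. set l \<subseteq> A \<and> length l = 0} = {[]}" by auto
    then show ?case by (simp add: small_finite)
  next
    case (Suc n)
    have "{l. set l \<subseteq> A \<and> length l = Suc n} =
        (\<lambda>(a, l). a # l) ` (A \<times> {l. set l \<subseteq> A \<and> length l = n})"
      by (auto simp: length_Suc_conv image_def)
    then show ?case using small_image[OF small_Times[OF A Suc.IH]] by simp
  qed
  then have "small TYPE('u) (\<Union>n\<in>UNIV. {l. set l \<subseteq> A \<and> length l = n})"
    using nat by (intro small_UN) auto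
  moreover have "lists A = (\<Union>n\<in>UNIV. {l. set l \<subseteq> A \<and> length l = n})" by auto
  ultimately show ?thesis by simp
qed

end


section \<open>Sets of size less than \<open>\<lambda>\<close>\<close>

locale regular_index =
  fixes K :: "'k::wellorder itself"
  assumes lam_inf: "Cinfinite (lam :: 'k rel)" and lam_reg: "regularCard (lam :: 'k rel)"
begin

lemma lam_underS: "underS (lam :: 'k rel) \<alpha> = {..<\<alpha>}"
  by (auto simp: underS_def lam_def)

lemma Field_lam: "Field (lam :: 'k rel) = UNIV"
  by (auto simp: Field_def lam_def)

text \<open>Here it matters that \<open>lam\<close> is a cardinal and not just a well-order: it
  exceeds each of its proper initial segments.\<close>

lemma lam_initial: "|{..<\<alpha>::'k}| <o (lam :: 'k rel)"
  using card_of_underS[of "lam :: 'k rel" \<alpha>] lam_inf by (simp add: lam_underS Field_lam)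

lemma lam_infinite: "infinite (UNIV :: 'k set)"
  using lam_inf by (simp add: cinfinite_def Field_lam)

lemma lam_UN:
  "|I| <o (lam :: 'k rel) \<Longrightarrow> (\<And>i. i \<in> I \<Longrightarrow> |A i| <o (lam :: 'k rel)) \<Longrightarrow>
     |\<Union>i\<in>I. A i| <o (lam :: 'k rel)"
  by (rule regularCard_UNION_bound[OF lam_inf lam_reg])

lemma lam_image: "|A| <o (lam :: 'k rel) \<Longrightarrow> |f ` A| <o (lam :: 'k rel)"
  by (meson card_of_image ordLeq_ordLess_trans)

lemma lam_finite: "finite A \<Longrightarrow> |A| <o (lam :: 'k rel)"
  using lam_inf
  by (intro finite_ordLess_infinite[OF card_of_Well_order])
    (auto simp: Field_card_of Field_lam lam_infinite card_order_on_def)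

lemma lam_Un: "|A| <o (lam :: 'k rel) \<Longrightarrow> |B| <o (lam :: 'k rel) \<Longrightarrow> |A \<union> B| <o (lam :: 'k rel)"
  using lam_inf by (intro Un_Cinfinite_bound_strict) auto

text \<open>Contexts and conjunctions are indexed only by initial segments
  \<open>{..<\<alpha>}\<close>. A smaller well-order is isomorphic to a proper initial segment of
  \<open>lam\<close>, which gives the enumeration.\<close>

lemma lam_enum:
  assumes "|A| <o (lam :: 'k rel)"
  obtains \<alpha> :: 'k and e where "bij_betw e {..<\<alpha>} A"
proof -
  have wo: "Well_order (lam :: 'k rel)" using lam_inf by (simp add: card_order_on_def)
  obtain \<alpha> where \<alpha>: "|A| =o Restr (lam :: 'k rel) (underS lam \<alpha>)"
    using assms ordLess_iff_ordIso_Restr[OF wo card_of_Well_order[of A]] by auto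
  then obtain h where "iso |A| (Restr (lam :: 'k rel) (underS lam \<alpha>)) h"
    by (auto simp: ordIso_def)
  then have "bij_betw h A (Field (Restr (lam :: 'k rel) (underS lam \<alpha>)))"
    by (simp add: iso_def Field_card_of)
  moreover have "Field (Restr (lam :: 'k rel) (underS lam \<alpha>)) = {..<\<alpha>}"
    unfolding lam_underS by (auto simp: Field_def lam_def)
  ultimately show thesis using that bij_betw_inv_into by metis
qed

end

section \<open>Homomorphisms and satisfaction\<close>

definition wf_asg ::
  "('s, 'f, 'r, 'k::wellorder, 'u) pstructure \<Rightarrow> ('s, 'k) var set \<Rightarrow> (('s, 'k) var \<Rightarrow> 'u) \<Rightarrow> bool" where
  "wf_asg M V e \<longleftrightarrow> (\<forall>v\<in>V. e v \<in> car M (fst v))"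

definition push :: "('s, 'u) hom \<Rightarrow> (('s, 'k) var \<Rightarrow> 'u) \<Rightarrow> ('s, 'k) var \<Rightarrow> 'u" where
  "push h e = (\<lambda>v. h (fst v) (e v))"

lemma hom_mem: "h \<in> homs \<Sigma> M N \<Longrightarrow> x \<in> car M s \<Longrightarrow> h s x \<in> car N s"
  by (auto simp: homs_def)

lemma hom_ext: "h \<in> homs \<Sigma> M N \<Longrightarrow> h s \<in> extensional (car M s)"
  by (auto simp: homs_def PiE_def)

lemma hom_eqI:
  assumes "h \<in> homs \<Sigma> M N" "h' \<in> homs \<Sigma> M N'" "\<And>s x. x \<in> car M s \<Longrightarrow> h s x = h' s x"
  shows "h = h'"
proof
  fix s
  show "h s = h' s"
    using hom_ext[OF assms(1), of s] hom_ext[OF assms(2), of s] assms(3)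
    by (rule extensionalityI)
qed

lemma hom_fun:
  "h \<in> homs \<Sigma> M N \<Longrightarrow> f \<in> funs \<Sigma> \<Longrightarrow> fint M f a = Some b \<Longrightarrow>
     fint N f (map_tuple (fdom \<Sigma> f) h a) = Some (h (fcod \<Sigma> f) b)"
  by (auto simp: homs_def)

lemma hom_rel:
  "h \<in> homs \<Sigma> M N \<Longrightarrow> R \<in> rels \<Sigma> \<Longrightarrow> a \<in> rint M R \<Longrightarrow> map_tuple (rdom \<Sigma> R) h a \<in> rint N R"
  by (auto simp: homs_def)

lemma homsI:
  assumes "\<And>s x. x \<in> car M s \<Longrightarrow> h s x \<in> car N s" "\<And>s. h s \<in> extensional (car M s)"
    "\<And>f a b. f \<in> funs \<Sigma> \<Longrightarrow> fint M f a = Some b \<Longrightarrow>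
       fint N f (map_tuple (fdom \<Sigma> f) h a) = Some (h (fcod \<Sigma> f) b)"
    "\<And>R a. R \<in> rels \<Sigma> \<Longrightarrow> a \<in> rint M R \<Longrightarrow> map_tuple (rdom \<Sigma> R) h a \<in> rint N R"
  shows "h \<in> homs \<Sigma> M N"
  using assms unfolding homs_def by (auto simp: PiE_def)

lemma structure_fun:
  "is_structure \<Sigma> M \<Longrightarrow> fint M f a = Some b \<Longrightarrow>
     f \<in> funs \<Sigma> \<and> a \<in> tuples M (fdom \<Sigma> f) \<and> b \<in> car M (fcod \<Sigma> f)"
  unfolding is_structure_def by (metis option.distinct(1))

lemma structure_rel: "is_structure \<Sigma> M \<Longrightarrow> a \<in> rint M R \<Longrightarrow> R \<in> rels \<Sigma> \<and> a \<in> tuples M (rdom \<Sigma> R)"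
  unfolding is_structure_def by blast

lemma tuples_mem: "a \<in> tuples M t \<Longrightarrow> i < fst t \<Longrightarrow> a i \<in> car M (snd t i)"
  by (auto simp: tuples_def)

lemma tuplesI:
  "(\<And>i. i < fst t \<Longrightarrow> a i \<in> car M (snd t i)) \<Longrightarrow> a \<in> extensional {..<fst t} \<Longrightarrow> a \<in> tuples M t"
  by (auto simp: tuples_def PiE_def)

lemma map_tuple_in:
  "a \<in> tuples M t \<Longrightarrow> (\<And>s x. x \<in> car M s \<Longrightarrow> h s x \<in> car N s) \<Longrightarrow> map_tuple t h a \<in> tuples N t"
  by (rule tuplesI) (auto simp: map_tuple_def tuples_mem)

lemma map_tuple_mem:
  "h \<in> homs \<Sigma> M N \<Longrightarrow> a \<in> tuples M t \<Longrightarrow> map_tuple t h a \<in> tuples N t"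
  by (rule map_tuple_in) (auto intro: hom_mem)

lemma tuples_eqI:
  "a \<in> tuples M t \<Longrightarrow> b \<in> tuples N t \<Longrightarrow> (\<And>i. i < fst t \<Longrightarrow> a i = b i) \<Longrightarrow> a = b"
  unfolding tuples_def by (rule PiE_ext) auto

lemma map_tuple_eq_iff:
  "map_tuple t h a = map_tuple t h' b \<longleftrightarrow> (\<forall>i<fst t. h (snd t i) (a i) = h' (snd t i) (b i))"
  by (auto simp: map_tuple_def fun_eq_iff restrict_def)

abbreviation comp_hom ::
  "('s, 'f, 'r, 'k, 'u) pstructure \<Rightarrow> ('s, 'u) hom \<Rightarrow> ('s, 'u) hom \<Rightarrow> ('s, 'u) hom" where
  "comp_hom M g f \<equiv> (\<lambda>s. compose (car M s) (g s) (f s))"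

lemma comp_hom_mem:
  assumes "is_structure \<Sigma> M" "f \<in> homs \<Sigma> M N" "g \<in> homs \<Sigma> N P"
  shows "comp_hom M g f \<in> homs \<Sigma> M P"
proof (rule homsI)
  fix k a b assume k: "k \<in> funs \<Sigma>" and b: "fint M k a = Some b"
  note s = structure_fun[OF assms(1) b]
  show "fint P k (map_tuple (fdom \<Sigma> k) (comp_hom M g f) a) = Some (comp_hom M g f (fcod \<Sigma> k) b)"
    using hom_fun[OF assms(3) k hom_fun[OF assms(2) k b]] s
    by (simp add: map_tuple_compose compose_eq)
next
  fix R a assume R: "R \<in> rels \<Sigma>" and a: "a \<in> rint M R"
  show "map_tuple (rdom \<Sigma> R) (comp_hom M g f) a \<in> rint P R"
    using hom_rel[OF assms(3) R hom_rel[OF assms(2) R a]] structure_rel[OF assms(1) a]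
    by (simp add: map_tuple_compose)
qed (use assms in \<open>auto simp: compose_eq intro: hom_mem\<close>)

lemma comp_homD:
  assumes "comp_hom M g f = h" "x \<in> car M s" shows "g s (f s x) = h s x"
  using assms by (auto simp: compose_eq)

lemma id_hom:
  assumes "is_structure \<Sigma> M" shows "(\<lambda>s. \<lambda>x\<in>car M s. x) \<in> homs \<Sigma> M M"
  by (rule homsI)
    (use structure_fun[OF assms] structure_rel[OF assms] in \<open>auto simp: map_tuple_id[of _ M]\<close>)

section \<open>Terms and formulas along homomorphisms\<close>

lemma eval_cong:
  assumes "is_term \<Sigma> V \<tau> s" "\<And>v. v \<in> V \<Longrightarrow> e v = e' v"
  shows "eval \<Sigma> M e \<tau> = eval \<Sigma> M e' \<tau>"
  using assms(1)
proof induction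
  case (2 f \<tau>)
  have "(\<lambda>i\<in>{..<fst (fdom \<Sigma> f)}. the (eval \<Sigma> M e (\<tau> i))) =
      (\<lambda>i\<in>{..<fst (fdom \<Sigma> f)}. the (eval \<Sigma> M e' (\<tau> i)))"
    using 2 by (auto simp: fun_eq_iff)
  then show ?case using 2 by auto
qed (use assms(2) in auto)

lemma holds_cong:
  assumes "is_formula \<Sigma> V \<phi>" "\<And>v. v \<in> V \<Longrightarrow> e v = e' v"
  shows "holds \<Sigma> M e \<phi> \<longleftrightarrow> holds \<Sigma> M e' \<phi>"
  using assms(1)
proof induction
  case (1 R \<tau>)
  have *: "i < fst (rdom \<Sigma> R) \<Longrightarrow> eval \<Sigma> M e (\<tau> i) = eval \<Sigma> M e' (\<tau> i)" for i
    by (rule eval_cong[OF 1(2)]) (use assms(2) in auto)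
  have "(\<lambda>i\<in>{..<fst (rdom \<Sigma> R)}. the (eval \<Sigma> M e (\<tau> i))) =
      (\<lambda>i\<in>{..<fst (rdom \<Sigma> R)}. the (eval \<Sigma> M e' (\<tau> i)))"
    using * by (auto simp: fun_eq_iff)
  then show ?case using * by auto
next
  case (2 \<tau> s \<tau>')
  have "eval \<Sigma> M e \<tau> = eval \<Sigma> M e' \<tau>" "eval \<Sigma> M e \<tau>' = eval \<Sigma> M e' \<tau>'"
    by (rule eval_cong[OF 2(1)] eval_cong[OF 2(2)], use assms(2) in simp)+
  then show ?case by simp
qed auto

lemma eval_mem:
  assumes "is_structure \<Sigma> M" "is_term \<Sigma> V \<tau> s" "wf_asg M V e" "eval \<Sigma> M e \<tau> = Some y"
  shows "y \<in> car M s"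
  using assms(2,4)
proof (induction arbitrary: y)
  case (1 v)
  then show ?case using assms(3) by (auto simp: wf_asg_def)
next
  case (2 f \<tau>)
  then show ?case using structure_fun[OF assms(1)] by (simp split: if_splits)
qed

lemma wf_push: "wf_asg M V e \<Longrightarrow> h \<in> homs \<Sigma> M N \<Longrightarrow> wf_asg N V (push h e)"
  by (auto simp: wf_asg_def push_def hom_mem)

lemma eval_hom:
  assumes "h \<in> homs \<Sigma> M N" "is_term \<Sigma> V \<tau> s" "eval \<Sigma> M e \<tau> = Some y"
  shows "eval \<Sigma> N (push h e) \<tau> = Some (h s y)"
  using assms(2,3)
proof (induction arbitrary: y)
  case (2 f \<tau>)
  define t where "t = fdom \<Sigma> f"
  define a where "a = (\<lambda>i\<in>{..<fst t}. the (eval \<Sigma> M e (\<tau> i)))"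
  have d: "eval \<Sigma> M e (\<tau> i) = Some (a i)" if "i < fst t" for i
    using 2(4) that by (auto simp: a_def t_def split: if_splits)
  have fy: "fint M f a = Some y" using 2(4) by (auto simp: a_def t_def split: if_splits)
  have d': "eval \<Sigma> N (push h e) (\<tau> i) = Some (h (snd t i) (a i))" if "i < fst t" for i
    using 2(3) d that by (auto simp: t_def)
  have "(\<lambda>i\<in>{..<fst t}. the (eval \<Sigma> N (push h e) (\<tau> i))) = map_tuple t h a"
    using d' by (auto simp: fun_eq_iff map_tuple_def)
  then show ?case using hom_fun[OF assms(1) 2(1) fy] d' by (auto simp: t_def)
qed (auto simp: push_def)

lemma holds_hom:
  assumes "h \<in> homs \<Sigma> M N" "is_formula \<Sigma> V \<phi>" "holds \<Sigma> M e \<phi>"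
  shows "holds \<Sigma> N (push h e) \<phi>"
  using assms(2,3)
proof induction
  case (1 R \<tau>)
  define t where "t = rdom \<Sigma> R"
  define a where "a = (\<lambda>i\<in>{..<fst t}. the (eval \<Sigma> M e (\<tau> i)))"
  have d: "eval \<Sigma> M e (\<tau> i) = Some (a i)" if "i < fst t" for i
    using 1(3) that by (auto simp: a_def t_def split: if_splits)
  have ra: "a \<in> rint M R" using 1(3) by (auto simp: a_def t_def)
  have d': "eval \<Sigma> N (push h e) (\<tau> i) = Some (h (snd t i) (a i))" if "i < fst t" for i
    using eval_hom[OF assms(1) 1(2) d] that by (auto simp: t_def)
  have "(\<lambda>i\<in>{..<fst t}. the (eval \<Sigma> N (push h e) (\<tau> i))) = map_tuple t h a"
    using d' by (auto simp: fun_eq_iff map_tuple_def)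
  then show ?case using hom_rel[OF assms(1) 1(1) ra] d' by (auto simp: t_def)
next
  case (2 \<tau> s \<tau>')
  then obtain y where "eval \<Sigma> M e \<tau> = Some y" "eval \<Sigma> M e \<tau>' = Some y" by fastforce
  then show ?case using eval_hom[OF assms(1) 2(1)] eval_hom[OF assms(1) 2(2)] by simp
qed auto


section \<open>Contexts\<close>

lemma assign_var: "is_ctx \<Sigma> x \<Longrightarrow> i < fst x \<Longrightarrow> assign x m (snd x i) = m i"
  by (simp add: assign_def is_ctx_def inv_into_f_f)

lemma ctx_vars_cases:
  assumes "v \<in> ctx_vars x" obtains i where "i < fst x" "v = snd x i"
  using assms by (auto simp: ctx_vars_def)

lemma wf_assign: "is_ctx \<Sigma> x \<Longrightarrow> m \<in> tuples M (ctx_arity x) \<Longrightarrow> wf_asg M (ctx_vars x) (assign x m)"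
  by (auto simp: wf_asg_def ctx_vars_def assign_var ctx_arity_def dest: tuples_mem)

definition unassign :: "('s, 'k::wellorder) ctx \<Rightarrow> (('s, 'k) var \<Rightarrow> 'u) \<Rightarrow> 'k \<Rightarrow> 'u" where
  "unassign x e = (\<lambda>i\<in>{..<fst x}. e (snd x i))"

lemma unassign_mem: "wf_asg M (ctx_vars x) e \<Longrightarrow> unassign x e \<in> tuples M (ctx_arity x)"
  by (auto simp: wf_asg_def ctx_vars_def unassign_def tuples_def ctx_arity_def)

lemma assign_unassign: "is_ctx \<Sigma> x \<Longrightarrow> v \<in> ctx_vars x \<Longrightarrow> assign x (unassign x e) v = e v"
  by (auto simp: ctx_vars_def assign_var unassign_def)

lemma assign_map_tuple:
  "is_ctx \<Sigma> x \<Longrightarrow> v \<in> ctx_vars x \<Longrightarrow>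
     assign x (map_tuple (ctx_arity x) h m) v = push h (assign x m) v"
  by (auto simp: ctx_vars_def assign_var push_def map_tuple_def ctx_arity_def)

lemma interp_iff:
  "is_hformula \<Sigma> (x, \<phi>) \<Longrightarrow> wf_asg M (ctx_vars x) e \<Longrightarrow>
     unassign x e \<in> interp \<Sigma> M (x, \<phi>) \<longleftrightarrow> holds \<Sigma> M e \<phi>"
  using holds_cong[of \<Sigma> "ctx_vars x" \<phi> "assign x (unassign x e)" e M]
  by (auto simp: unassign_mem assign_unassign)

text \<open>From here on validity is handled through assignments of variables, which avoids the
  inverse of the context enumeration. Only the values on \<open>ctx_vars x\<close> matter, so total
  assignments represent all tuples.\<close>

lemma valid_iff:
  assumes "is_sequent \<Sigma> (x, \<phi>, \<psi>)"
  shows "valid \<Sigma> M (x, \<phi>, \<psi>) \<longleftrightarrow>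
    (\<forall>e. wf_asg M (ctx_vars x) e \<longrightarrow> holds \<Sigma> M e \<phi> \<longrightarrow> holds \<Sigma> M e \<psi>)"
    (is "?L \<longleftrightarrow> ?R")
proof
  assume ?L
  then show ?R using interp_iff[of \<Sigma> x] assms by (auto simp del: interp.simps)
next
  assume ?R
  then show ?L using assms wf_assign[of \<Sigma> x] by auto
qed


section \<open>Jointly closed families of homomorphisms\<close>

text \<open>Up to coding, \<open>P\<close> is a substructure of the product of the
  \<open>M j\<close> in which an operation is defined, or a relation holds, as soon as this is so in
  every coordinate. The condition is phrased with a family because \<open>J\<close> may be too large
  for that product to exist. For empty \<open>J\<close> it forces at most one element per sort, with
  total operations and full relations.\<close>

definition jemb ::
  "('s, 'f, 'r, 'k::wellorder) signature \<Rightarrow> 'j set \<Rightarrow> ('j \<Rightarrow> ('s, 'f, 'r, 'k, 'u) pstructure) \<Rightarrow>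
     ('s, 'f, 'r, 'k, 'u) pstructure \<Rightarrow> ('j \<Rightarrow> ('s, 'u) hom) \<Rightarrow> bool" where
  "jemb \<Sigma> J M P \<pi> \<longleftrightarrow> is_structure \<Sigma> P \<and> (\<forall>j\<in>J. is_structure \<Sigma> (M j) \<and> \<pi> j \<in> homs \<Sigma> P (M j)) \<and>
     (\<forall>s. \<forall>x\<in>car P s. \<forall>y\<in>car P s. (\<forall>j\<in>J. \<pi> j s x = \<pi> j s y) \<longrightarrow> x = y) \<and>
     (\<forall>f\<in>funs \<Sigma>. \<forall>a\<in>tuples P (fdom \<Sigma> f).
        (\<forall>j\<in>J. fint (M j) f (map_tuple (fdom \<Sigma> f) (\<pi> j) a) \<noteq> None) \<longrightarrow> fint P f a \<noteq> None) \<and>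
     (\<forall>R\<in>rels \<Sigma>. \<forall>a\<in>tuples P (rdom \<Sigma> R).
        (\<forall>j\<in>J. map_tuple (rdom \<Sigma> R) (\<pi> j) a \<in> rint (M j) R) \<longrightarrow> a \<in> rint P R)"

context
  fixes \<Sigma> :: "('s, 'f, 'r, 'k::wellorder) signature" and J :: "'j set"
    and M :: "'j \<Rightarrow> ('s, 'f, 'r, 'k, 'u) pstructure" and P :: "('s, 'f, 'r, 'k, 'u) pstructure"
    and \<pi> :: "'j \<Rightarrow> ('s, 'u) hom"
  assumes je: "jemb \<Sigma> J M P \<pi>"
begin

lemma jemb_structure: "is_structure \<Sigma> P"
  and jemb_structures: "j \<in> J \<Longrightarrow> is_structure \<Sigma> (M j)"
  and jemb_hom: "j \<in> J \<Longrightarrow> \<pi> j \<in> homs \<Sigma> P (M j)"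
  and jemb_inj: "x \<in> car P s \<Longrightarrow> y \<in> car P s \<Longrightarrow> (\<And>j. j \<in> J \<Longrightarrow> \<pi> j s x = \<pi> j s y) \<Longrightarrow> x = y"
  and jemb_fun: "f \<in> funs \<Sigma> \<Longrightarrow> a \<in> tuples P (fdom \<Sigma> f) \<Longrightarrow>
        (\<And>j. j \<in> J \<Longrightarrow> fint (M j) f (map_tuple (fdom \<Sigma> f) (\<pi> j) a) \<noteq> None) \<Longrightarrow> fint P f a \<noteq> None"
  and jemb_rel: "R \<in> rels \<Sigma> \<Longrightarrow> a \<in> tuples P (rdom \<Sigma> R) \<Longrightarrow>
        (\<And>j. j \<in> J \<Longrightarrow> map_tuple (rdom \<Sigma> R) (\<pi> j) a \<in> rint (M j) R) \<Longrightarrow> a \<in> rint P R"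
  using je unfolding jemb_def by blast+

text \<open>Once the arguments of a symbol have values in \<open>P\<close>, each
  \<open>\<pi> j\<close> sends them to the arguments computed in \<open>M j\<close>, so reflection
  for a single symbol applies. Induction on the term does the rest.\<close>

lemma jemb_eval:
  assumes "is_term \<Sigma> V \<tau> s" "wf_asg P V e" "\<And>j. j \<in> J \<Longrightarrow> eval \<Sigma> (M j) (push (\<pi> j) e) \<tau> \<noteq> None"
  shows "eval \<Sigma> P e \<tau> \<noteq> None"
  using assms(1,3)
proof induction
  case (2 f \<tau>)
  define t where "t = fdom \<Sigma> f"
  define a where "a = (\<lambda>i\<in>{..<fst t}. the (eval \<Sigma> P e (\<tau> i)))"
  have ne: "eval \<Sigma> P e (\<tau> i) = Some (a i)" if i: "i < fst t" for i
  proof -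
    have "eval \<Sigma> P e (\<tau> i) \<noteq> None"
    proof (rule 2(3))
      show "i < fst (fdom \<Sigma> f)" using i by (simp add: t_def)
      fix j assume "j \<in> J"
      then show "eval \<Sigma> (M j) (push (\<pi> j) e) (\<tau> i) \<noteq> None"
        using 2(4)[of j] i by (auto simp: t_def split: if_splits)
    qed
    then show ?thesis using i by (auto simp: a_def)
  qed
  have a: "a \<in> tuples P t"
    using eval_mem[OF jemb_structure 2(2) assms(2) ne]
    by (intro tuplesI) (auto simp: t_def, auto simp: a_def t_def)
  have "fint P f a \<noteq> None"
  proof (rule jemb_fun[OF 2(1)])
    fix j assume j: "j \<in> J"
    have "eval \<Sigma> (M j) (push (\<pi> j) e) (\<tau> i) = Some (\<pi> j (snd t i) (a i))" if "i < fst t" for i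
      using eval_hom[OF jemb_hom[OF j] 2(2) ne] that by (auto simp: t_def)
    then have "(\<lambda>i\<in>{..<fst t}. the (eval \<Sigma> (M j) (push (\<pi> j) e) (\<tau> i))) = map_tuple t (\<pi> j) a"
      by (auto simp: map_tuple_def fun_eq_iff)
    then show "fint (M j) f (map_tuple (fdom \<Sigma> f) (\<pi> j) a) \<noteq> None"
      using 2(4)[OF j] by (auto simp: t_def split: if_splits)
  qed (use a in \<open>simp add: t_def\<close>)
  then show ?case using ne by (auto simp: a_def t_def)
qed auto

lemma jemb_holds:
  assumes "is_formula \<Sigma> V \<phi>" "wf_asg P V e" "\<And>j. j \<in> J \<Longrightarrow> holds \<Sigma> (M j) (push (\<pi> j) e) \<phi>"
  shows "holds \<Sigma> P e \<phi>"
  using assms(1,3)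
proof induction
  case (1 R \<tau>)
  define t where "t = rdom \<Sigma> R"
  define a where "a = (\<lambda>i\<in>{..<fst t}. the (eval \<Sigma> P e (\<tau> i)))"
  have ne: "eval \<Sigma> P e (\<tau> i) = Some (a i)" if "i < fst t" for i
    using jemb_eval[OF 1(2) assms(2), of i] 1(3) that by (auto simp: a_def t_def)
  have a: "a \<in> tuples P t"
    using eval_mem[OF jemb_structure 1(2) assms(2) ne]
    by (intro tuplesI) (auto simp: t_def, auto simp: a_def t_def)
  have "a \<in> rint P R"
  proof (rule jemb_rel[OF 1(1)])
    fix j assume j: "j \<in> J"
    have "eval \<Sigma> (M j) (push (\<pi> j) e) (\<tau> i) = Some (\<pi> j (snd t i) (a i))" if "i < fst t" for i
      using eval_hom[OF jemb_hom[OF j] 1(2) ne] that by (auto simp: t_def)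
    then have "(\<lambda>i\<in>{..<fst t}. the (eval \<Sigma> (M j) (push (\<pi> j) e) (\<tau> i))) = map_tuple t (\<pi> j) a"
      by (auto simp: map_tuple_def fun_eq_iff)
    then show "map_tuple (rdom \<Sigma> R) (\<pi> j) a \<in> rint (M j) R"
      using 1(3)[OF j] by (auto simp: t_def)
  qed (use a in \<open>simp add: t_def\<close>)
  then show ?case using ne by (auto simp: a_def t_def)
next
  case (2 \<tau> s \<tau>')
  have *: "eval \<Sigma> (M j) (push (\<pi> j) e) \<tau> \<noteq> None" "eval \<Sigma> (M j) (push (\<pi> j) e) \<tau>' \<noteq> None"
    if "j \<in> J" for j using 2(3)[OF that] unfolding holds.simps by metis+
  obtain x where x: "eval \<Sigma> P e \<tau> = Some x"
    using jemb_eval[OF 2(1) assms(2) *(1)] by auto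
  obtain y where y: "eval \<Sigma> P e \<tau>' = Some y"
    using jemb_eval[OF 2(2) assms(2) *(2)] by auto
  have "x = y"
  proof (rule jemb_inj)
    show "x \<in> car P s" "y \<in> car P s"
      using eval_mem[OF jemb_structure 2(1) assms(2) x] eval_mem[OF jemb_structure 2(2) assms(2) y]
      by auto
    fix j assume j: "j \<in> J"
    show "\<pi> j s x = \<pi> j s y"
      using eval_hom[OF jemb_hom[OF j] 2(1) x] eval_hom[OF jemb_hom[OF j] 2(2) y] 2(3)[OF j] by auto
  qed
  then show ?case using x y by auto
qed auto

lemma jemb_holds_iff:
  assumes "is_formula \<Sigma> V \<phi>" "wf_asg P V e"
  shows "holds \<Sigma> P e \<phi> \<longleftrightarrow> (\<forall>j\<in>J. holds \<Sigma> (M j) (push (\<pi> j) e) \<phi>)"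
  using jemb_holds[OF assms] holds_hom[OF jemb_hom assms(1)] by blast

text \<open>The premise travels forward along every \<open>\<pi> j\<close>, validity in
  \<open>M j\<close> gives the conclusion there, and joint reflection brings it back to
  \<open>P\<close>.\<close>

lemma jemb_valid:
  assumes "is_sequent \<Sigma> q" "\<And>j. j \<in> J \<Longrightarrow> valid \<Sigma> (M j) q"
  shows "valid \<Sigma> P q"
proof -
  obtain x \<phi> \<psi> where q: "q = (x, \<phi>, \<psi>)" by (cases q) auto
  have \<phi>: "is_formula \<Sigma> (ctx_vars x) \<phi>" and \<psi>: "is_formula \<Sigma> (ctx_vars x) \<psi>"
    using assms(1) by (auto simp: q)
  show ?thesis
    unfolding q valid_iff[OF assms(1)[unfolded q]]
  proof (intro allI impI)
    fix e assume e: "wf_asg P (ctx_vars x) e" and "holds \<Sigma> P e \<phi>"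
    then have "holds \<Sigma> (M j) (push (\<pi> j) e) \<phi>" if "j \<in> J" for j
      using jemb_holds_iff[OF \<phi> e] that by blast
    then have "holds \<Sigma> (M j) (push (\<pi> j) e) \<psi>" if "j \<in> J" for j
      using assms(2)[OF that] that wf_push[OF e jemb_hom[OF that]]
      unfolding q valid_iff[OF assms(1)[unfolded q]] by blast
    then show "holds \<Sigma> P e \<psi>" by (rule jemb_holds[OF \<psi> e])
  qed
qed

text \<open>Joint reflection makes an operation defined at the image tuple, and joint injectivity
  identifies its value. Maps into products, and later into the algebra of coherent families, are
  obtained in this way.\<close>

lemma jemb_lift:
  assumes Q: "is_structure \<Sigma> Q" and q: "\<And>j. j \<in> J \<Longrightarrow> q j \<in> homs \<Sigma> Q (M j)"
    and u: "\<And>s x. x \<in> car Q s \<Longrightarrow> u s x \<in> car P s" "\<And>s. u s \<in> extensional (car Q s)"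
    and pu: "\<And>j s x. j \<in> J \<Longrightarrow> x \<in> car Q s \<Longrightarrow> \<pi> j s (u s x) = q j s x"
  shows "u \<in> homs \<Sigma> Q P"
proof (rule homsI)
  have up: "map_tuple t (\<pi> j) (map_tuple t u a) = map_tuple t (q j) a"
    if "j \<in> J" "a \<in> tuples Q t" for j a t
    using that by (auto simp: map_tuple_def fun_eq_iff pu tuples_mem)
  have ut: "map_tuple t u a \<in> tuples P t" if "a \<in> tuples Q t" for a t
    using that u(1) by (rule map_tuple_in)
  fix f a b assume f: "f \<in> funs \<Sigma>" and b: "fint Q f a = Some b"
  note s = structure_fun[OF Q b]
  obtain c where c: "fint P f (map_tuple (fdom \<Sigma> f) u a) = Some c"
  proof -
    have "fint P f (map_tuple (fdom \<Sigma> f) u a) \<noteq> None"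
      by (rule jemb_fun[OF f ut]) (use s hom_fun[OF q f b] in \<open>auto simp: up\<close>)
    then show thesis using that by auto
  qed
  have "c = u (fcod \<Sigma> f) b"
    by (rule jemb_inj[of _ "fcod \<Sigma> f"])
      (use s structure_fun[OF jemb_structure c] u hom_fun[OF jemb_hom f c] hom_fun[OF q f b] in
        \<open>auto simp: up pu\<close>)
  then show "fint P f (map_tuple (fdom \<Sigma> f) u a) = Some (u (fcod \<Sigma> f) b)" using c by simp
next
  fix R a assume R: "R \<in> rels \<Sigma>" and a: "a \<in> rint Q R"
  note s = structure_rel[OF Q a]
  have at: "a \<in> tuples Q (rdom \<Sigma> R)" using s by simp
  show "map_tuple (rdom \<Sigma> R) u a \<in> rint P R"
  proof (rule jemb_rel[OF R])
    show "map_tuple (rdom \<Sigma> R) u a \<in> tuples P (rdom \<Sigma> R)"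
      using at u(1) by (rule map_tuple_in)
    fix j assume j: "j \<in> J"
    have "map_tuple (rdom \<Sigma> R) (\<pi> j) (map_tuple (rdom \<Sigma> R) u a) = map_tuple (rdom \<Sigma> R) (q j) a"
      using at j by (auto simp: map_tuple_def fun_eq_iff pu tuples_mem)
    then show "map_tuple (rdom \<Sigma> R) (\<pi> j) (map_tuple (rdom \<Sigma> R) u a) \<in> rint (M j) R"
      using hom_rel[OF q[OF j] R a] by simp
  qed
qed (use u in auto)

end

section \<open>Substructures of products\<close>

text \<open>Only \<open>Sub\<close> has to be small, not \<open>J\<close>, so this also yields term
  models over families that are not small. Closure is asked only at tuples where the operation is
  defined in every coordinate, and exactly there it becomes defined in \<open>P\<close>.\<close>

lemma (in universe) subproduct:
  fixes M :: "'j \<Rightarrow> ('s, 'f, 'r, 'k::wellorder, 'u) pstructure"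
  assumes sig: "is_signature \<Sigma>"
    and M: "\<And>j. j \<in> J \<Longrightarrow> is_structure \<Sigma> (M j)"
    and sub: "\<And>s. s \<in> sorts \<Sigma> \<Longrightarrow> Sub s \<subseteq> (\<Pi>\<^sub>E j\<in>J. car (M j) s)"
    and sm: "\<And>s. s \<in> sorts \<Sigma> \<Longrightarrow> small TYPE('u) (Sub s)"
    and closed: "\<And>f a b. f \<in> funs \<Sigma> \<Longrightarrow> (\<And>i. i < fst (fdom \<Sigma> f) \<Longrightarrow> a i \<in> Sub (snd (fdom \<Sigma> f) i)) \<Longrightarrow>
      b \<in> extensional J \<Longrightarrow>
      (\<And>j. j \<in> J \<Longrightarrow> fint (M j) f (\<lambda>i\<in>{..<fst (fdom \<Sigma> f)}. a i j) = Some (b j)) \<Longrightarrow>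
      b \<in> Sub (fcod \<Sigma> f)"
  obtains P \<pi> where "jemb \<Sigma> J M P \<pi>"
    "\<And>s. s \<in> sorts \<Sigma> \<Longrightarrow> (\<lambda>x. \<lambda>j\<in>J. \<pi> j s x) ` car P s = Sub s"
proof -
  have "\<exists>f :: ('j \<Rightarrow> 'u) \<Rightarrow> 'u. s \<in> sorts \<Sigma> \<longrightarrow> inj_on f (Sub s)" for s
    using small_code[OF sm[of s]] by blast
  then obtain code :: "'s \<Rightarrow> ('j \<Rightarrow> 'u) \<Rightarrow> 'u" where code: "s \<in> sorts \<Sigma> \<Longrightarrow> inj_on (code s) (Sub s)" for s
    by metis
  define C where "C s = (if s \<in> sorts \<Sigma> then code s ` Sub s else {})" for s
  define \<pi> where "\<pi> j s = (\<lambda>x\<in>C s. inv_into (Sub s) (code s) x j)" for j s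
  have \<pi>c: "\<pi> j s (code s g) = g j" if "s \<in> sorts \<Sigma>" "g \<in> Sub s" for j s g
    using that code[OF that(1)] by (simp add: \<pi>_def C_def)
  have C: "\<exists>g. s \<in> sorts \<Sigma> \<and> g \<in> Sub s \<and> x = code s g" if "x \<in> C s" for x s
    using that by (auto simp: C_def split: if_splits)
  define tup where "tup t = (\<Pi>\<^sub>E i\<in>{..<fst t}. C (snd t i))" for t :: "('s, 'k) arity"
  define P where "P = \<lparr>car = C,
    fint = (\<lambda>f a. if f \<in> funs \<Sigma> \<and> a \<in> tup (fdom \<Sigma> f) \<and>
                (\<forall>j\<in>J. fint (M j) f (map_tuple (fdom \<Sigma> f) (\<pi> j) a) \<noteq> None)
              then Some (code (fcod \<Sigma> f) (\<lambda>j\<in>J. the (fint (M j) f (map_tuple (fdom \<Sigma> f) (\<pi> j) a))))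
              else None),
    rint = (\<lambda>R. {a \<in> tup (rdom \<Sigma> R). R \<in> rels \<Sigma> \<and>
              (\<forall>j\<in>J. map_tuple (rdom \<Sigma> R) (\<pi> j) a \<in> rint (M j) R)})\<rparr>"
  have tup: "tuples P t = tup t" for t by (simp add: tuples_def tup_def P_def)
  have val: "(\<lambda>j\<in>J. the (fint (M j) f (map_tuple (fdom \<Sigma> f) (\<pi> j) a))) \<in> Sub (fcod \<Sigma> f)"
    if f: "f \<in> funs \<Sigma>" and a: "a \<in> tup (fdom \<Sigma> f)"
      and d: "\<forall>j\<in>J. fint (M j) f (map_tuple (fdom \<Sigma> f) (\<pi> j) a) \<noteq> None" for f a
  proof -
    have "\<forall>i. \<exists>g. i < fst (fdom \<Sigma> f) \<longrightarrow> snd (fdom \<Sigma> f) i \<in> sorts \<Sigma> \<and> g \<in> Sub (snd (fdom \<Sigma> f) i) \<and>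
        a i = code (snd (fdom \<Sigma> f) i) g"
      using a C by (auto simp: tup_def PiE_iff)
    then obtain G where G: "i < fst (fdom \<Sigma> f) \<Longrightarrow> snd (fdom \<Sigma> f) i \<in> sorts \<Sigma> \<and>
        G i \<in> Sub (snd (fdom \<Sigma> f) i) \<and> a i = code (snd (fdom \<Sigma> f) i) (G i)" for i
      by metis
    have mt: "map_tuple (fdom \<Sigma> f) (\<pi> j) a = (\<lambda>i\<in>{..<fst (fdom \<Sigma> f)}. G i j)" for j
      using G by (auto simp: map_tuple_def fun_eq_iff \<pi>c)
    show ?thesis
    proof (rule closed[OF f])
      show "G i \<in> Sub (snd (fdom \<Sigma> f) i)" if "i < fst (fdom \<Sigma> f)" for i using G[OF that] by simp
    qed (use d in \<open>auto simp: mt\<close>)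
  qed
  have cod: "f \<in> funs \<Sigma> \<Longrightarrow> fcod \<Sigma> f \<in> sorts \<Sigma>" for f using sig by (simp add: is_signature_def)
  have P: "is_structure \<Sigma> P"
    unfolding is_structure_def
  proof (intro conjI ballI allI impI)
    fix s assume "s \<in> sorts \<Sigma>"
    then show "small TYPE('u) (car P s)" by (simp add: P_def C_def small_image sm)
  next
    fix f a b assume f: "f \<in> funs \<Sigma>" and b: "fint P f a = Some b"
    show "a \<in> tuples P (fdom \<Sigma> f)" unfolding tup using b by (simp add: P_def split: if_splits)
    show "b \<in> car P (fcod \<Sigma> f)"
      using b val[OF f] cod[OF f] by (auto simp: P_def C_def split: if_splits)
  qed (auto simp: tup, auto simp: P_def C_def)
  have hom: "\<pi> j \<in> homs \<Sigma> P (M j)" if j: "j \<in> J" for j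
  proof (rule homsI)
    fix s x assume "x \<in> car P s"
    then obtain g where g: "s \<in> sorts \<Sigma>" "g \<in> Sub s" "x = code s g" using C by (auto simp: P_def)
    then show "\<pi> j s x \<in> car (M j) s" using \<pi>c[OF g(1,2)] sub[OF g(1)] j by auto
  next
    fix f a b assume f: "f \<in> funs \<Sigma>" and "fint P f a = Some b"
    then have a: "a \<in> tup (fdom \<Sigma> f)" and d: "\<forall>j\<in>J. fint (M j) f (map_tuple (fdom \<Sigma> f) (\<pi> j) a) \<noteq> None"
      and b: "b = code (fcod \<Sigma> f) (\<lambda>j\<in>J. the (fint (M j) f (map_tuple (fdom \<Sigma> f) (\<pi> j) a)))"
      by (auto simp: P_def split: if_splits)
    show "fint (M j) f (map_tuple (fdom \<Sigma> f) (\<pi> j) a) = Some (\<pi> j (fcod \<Sigma> f) b)"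
      unfolding b \<pi>c[OF cod[OF f] val[OF f a d]] using j d by auto
  qed (auto simp: \<pi>_def, auto simp: P_def that)
  have "jemb \<Sigma> J M P \<pi>"
    unfolding jemb_def
  proof (intro conjI ballI allI impI P M hom)
    fix s x y assume x: "x \<in> car P s" and y: "y \<in> car P s" and eq: "\<forall>j\<in>J. \<pi> j s x = \<pi> j s y"
    obtain g where g: "s \<in> sorts \<Sigma>" "g \<in> Sub s" "x = code s g" using C x by (auto simp: P_def)
    obtain g' where g': "g' \<in> Sub s" "y = code s g'" using C y by (auto simp: P_def)
    have "g = g'"
    proof (rule PiE_ext)
      show "g \<in> (\<Pi>\<^sub>E j\<in>J. car (M j) s)" "g' \<in> (\<Pi>\<^sub>E j\<in>J. car (M j) s)" using g g' sub by auto
      show "g j = g' j" if "j \<in> J" for j using eq that g g' \<pi>c by auto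
    qed
    then show "x = y" using g g' by simp
  qed (unfold tup, auto simp: P_def)
  moreover have "(\<lambda>x. \<lambda>j\<in>J. \<pi> j s x) ` car P s = Sub s" if s: "s \<in> sorts \<Sigma>" for s
  proof -
    have r: "(\<lambda>j\<in>J. \<pi> j s (code s g)) = g" if "g \<in> Sub s" for g
      using \<pi>c[OF s that] sub[OF s] that by (auto simp: fun_eq_iff PiE_iff extensional_def)
    have "(\<lambda>x. \<lambda>j\<in>J. \<pi> j s x) ` car P s = (\<lambda>g. \<lambda>j\<in>J. \<pi> j s (code s g)) ` Sub s"
      using s by (simp add: P_def C_def image_image)
    then show ?thesis using r by (simp cong: image_cong)
  qed
  ultimately show thesis by (rule that)
qed


section \<open>Term models\<close>

text \<open>Terms are small in number: a raw term is determined, up to the irrelevant entries in its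
  applications, by the set of its labelled paths.\<close>

primrec paths ::
  "('s, 'f, 'r, 'k::wellorder) signature \<Rightarrow> ('s, 'f, 'k) trm \<Rightarrow> ('k list \<times> (('s, 'k) var + 'f)) set" where
  "paths \<Sigma> (Var v) = {([], Inl v)}"
| "paths \<Sigma> (App f \<tau>) =
     insert ([], Inr f) {(i # p, l) | i p l. i < fst (fdom \<Sigma> f) \<and> (p, l) \<in> paths \<Sigma> (\<tau> i)}"

text \<open>Equal path sets do not make the terms equal, since entries beyond the arity are
  arbitrary, but evaluation never reads those entries.\<close>

lemma paths_eval: "paths \<Sigma> \<tau> = paths \<Sigma> \<tau>' \<Longrightarrow> eval \<Sigma> M e \<tau> = eval \<Sigma> M e \<tau>'"
proof (induction \<tau> arbitrary: \<tau>')
  case (Var v)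
  then show ?case by (cases \<tau>') auto
next
  case (App f \<tau>)
  show ?case
  proof (cases \<tau>')
    case (Var v)
    then show ?thesis using App.prems by auto
  next
    case (App g \<sigma>)
    have "([], Inr f) \<in> paths \<Sigma> \<tau>'" unfolding App.prems[symmetric] by simp
    then have [simp]: "g = f" by (simp add: App)
    have "paths \<Sigma> (\<tau> i) = paths \<Sigma> (\<sigma> i)" if i: "i < fst (fdom \<Sigma> f)" for i
    proof -
      \<comment> \<open>The argument at index \<open>i\<close> is recovered by stripping the head
        \<open>i\<close> from the paths of the whole term.\<close>
      have "paths \<Sigma> (\<tau> i) = {(p, l). (i # p, l) \<in> paths \<Sigma> (trm.App f \<tau>)}" using i by auto
      also have "\<dots> = paths \<Sigma> (\<sigma> i)" unfolding App.prems App using i by auto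
      finally show ?thesis .
    qed
    then have *: "eval \<Sigma> M e (\<tau> i) = eval \<Sigma> M e (\<sigma> i)" if "i < fst (fdom \<Sigma> f)" for i
      using App.IH that by blast
    then have "(\<lambda>i\<in>{..<fst (fdom \<Sigma> f)}. the (eval \<Sigma> M e (\<tau> i))) =
        (\<lambda>i\<in>{..<fst (fdom \<Sigma> f)}. the (eval \<Sigma> M e (\<sigma> i)))"
      by (auto simp: fun_eq_iff)
    moreover have "(\<forall>i<fst (fdom \<Sigma> f). eval \<Sigma> M e (\<tau> i) \<noteq> None) \<longleftrightarrow>
        (\<forall>i<fst (fdom \<Sigma> f). eval \<Sigma> M e (\<sigma> i) \<noteq> None)"
      using * by auto
    ultimately show ?thesis unfolding App eval.simps \<open>g = f\<close> by metis
  qed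
qed

lemma paths_subset: "is_term \<Sigma> V \<tau> s \<Longrightarrow> paths \<Sigma> \<tau> \<subseteq> UNIV \<times> (V <+> funs \<Sigma>)"
  by (induction rule: is_term.induct) auto

section \<open>Generated structures and the homomorphisms out of them\<close>

definition generated ::
  "('s, 'f, 'r, 'k::wellorder) signature \<Rightarrow> ('s, 'k) var set \<Rightarrow> ('s, 'f, 'r, 'k, 'u) pstructure \<Rightarrow>
     (('s, 'k) var \<Rightarrow> 'u) \<Rightarrow> bool" where
  "generated \<Sigma> V P g \<longleftrightarrow> wf_asg P V g \<and>
     (\<forall>s. \<forall>x\<in>car P s. \<exists>\<tau>. is_term \<Sigma> V \<tau> s \<and> eval \<Sigma> P g \<tau> = Some x)"

lemma generated_hom_unique:
  assumes "generated \<Sigma> V P g" "h \<in> homs \<Sigma> P M" "h' \<in> homs \<Sigma> P M"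
    and "\<And>v. v \<in> V \<Longrightarrow> h (fst v) (g v) = h' (fst v) (g v)"
  shows "h = h'"
proof (rule hom_eqI[OF assms(2,3)])
  fix s x assume "x \<in> car P s"
  then obtain \<tau> where \<tau>: "is_term \<Sigma> V \<tau> s" "eval \<Sigma> P g \<tau> = Some x"
    using assms(1) by (auto simp: generated_def)
  have "eval \<Sigma> M (push h g) \<tau> = eval \<Sigma> M (push h' g) \<tau>"
    by (rule eval_cong[OF \<tau>(1)]) (simp add: push_def assms(4))
  then show "h s x = h' s x" using eval_hom[OF assms(2) \<tau>] eval_hom[OF assms(3) \<tau>] by simp
qed

text \<open>The method of diagrams: every element of \<open>P\<close> is named by a term, and
  equations, definedness and relations between such names transfer to \<open>B\<close> by
  hypothesis. Sending an element to the value in \<open>B\<close> of a chosen name is therefore a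
  homomorphism.\<close>

lemma generated_hom_exists:
  assumes P: "is_structure \<Sigma> P" and gen: "generated \<Sigma> V P g"
    and B: "is_structure \<Sigma> B" and e: "wf_asg B V e"
    and holds: "\<And>\<psi>. is_formula \<Sigma> V \<psi> \<Longrightarrow> holds \<Sigma> P g \<psi> \<Longrightarrow> holds \<Sigma> B e \<psi>"
  obtains h where "h \<in> homs \<Sigma> P B" "\<And>v. v \<in> V \<Longrightarrow> h (fst v) (g v) = e v"
proof -
  have "\<exists>T. \<forall>s x. x \<in> car P s \<longrightarrow> is_term \<Sigma> V (T s x) s \<and> eval \<Sigma> P g (T s x) = Some x"
    using gen unfolding generated_def by metis
  then obtain T where T: "\<And>s x. x \<in> car P s \<Longrightarrow> is_term \<Sigma> V (T s x) s"
    "\<And>s x. x \<in> car P s \<Longrightarrow> eval \<Sigma> P g (T s x) = Some x"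
    by blast
  define h where "h s = (\<lambda>x\<in>car P s. the (eval \<Sigma> B e (T s x)))" for s
  have wg: "wf_asg P V g" using gen by (simp add: generated_def)
  \<comment> \<open>Independence of the chosen name: the equation between \<open>\<tau>\<close> and
    the chosen term is itself one of the formulas that transfer.\<close>
  have key: "eval \<Sigma> B e \<tau> = Some (h s x)" if "is_term \<Sigma> V \<tau> s" "eval \<Sigma> P g \<tau> = Some x" for \<tau> s x
  proof -
    have x: "x \<in> car P s" by (rule eval_mem[OF P that(1) wg that(2)])
    have "holds \<Sigma> B e (Eq \<tau> (T s x))"
      by (rule holds) (use that T[OF x] in \<open>auto intro: is_formula.intros\<close>)
    then have "eval \<Sigma> B e \<tau> \<noteq> None" "eval \<Sigma> B e \<tau> = eval \<Sigma> B e (T s x)"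
      unfolding holds.simps by blast+
    then show ?thesis using x by (auto simp: h_def)
  qed
  have kT: "eval \<Sigma> B e (T s x) = Some (h s x)" if "x \<in> car P s" for s x
    using key[OF T[OF that]] .
  have "h \<in> homs \<Sigma> P B"
  proof (rule homsI)
    fix s x assume x: "x \<in> car P s"
    show "h s x \<in> car B s" by (rule eval_mem[OF B T(1)[OF x] e kT[OF x]])
  next
    fix f a b assume f: "f \<in> funs \<Sigma>" and b: "fint P f a = Some b"
    define t where "t = fdom \<Sigma> f"
    define \<sigma> where "\<sigma> i = T (snd t i) (a i)" for i
    have a: "a \<in> tuples P t" using structure_fun[OF P b] by (simp add: t_def)
    note ai = tuples_mem[OF a]
    have "(\<lambda>i\<in>{..<fst t}. the (eval \<Sigma> P g (\<sigma> i))) = a"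
      using a ai by (auto simp: \<sigma>_def T tuples_def PiE_iff extensional_def fun_eq_iff)
    then have "eval \<Sigma> P g (App f \<sigma>) = Some b"
      using b ai by (auto simp: \<sigma>_def T t_def)
    moreover have "is_term \<Sigma> V (App f \<sigma>) (fcod \<Sigma> f)"
      using f ai by (auto intro!: is_term.intros T simp: \<sigma>_def t_def)
    ultimately have "eval \<Sigma> B e (App f \<sigma>) = Some (h (fcod \<Sigma> f) b)" by (intro key)
    moreover have "(\<lambda>i\<in>{..<fst t}. the (eval \<Sigma> B e (\<sigma> i))) = map_tuple t h a"
      using ai by (auto simp: \<sigma>_def kT map_tuple_def fun_eq_iff)
    ultimately show "fint B f (map_tuple (fdom \<Sigma> f) h a) = Some (h (fcod \<Sigma> f) b)"
      by (auto simp: t_def split: if_splits)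
  next
    fix R a assume R: "R \<in> rels \<Sigma>" and b: "a \<in> rint P R"
    define t where "t = rdom \<Sigma> R"
    define \<sigma> where "\<sigma> i = T (snd t i) (a i)" for i
    have a: "a \<in> tuples P t" using structure_rel[OF P b] by (simp add: t_def)
    note ai = tuples_mem[OF a]
    have "(\<lambda>i\<in>{..<fst t}. the (eval \<Sigma> P g (\<sigma> i))) = a"
      using a ai by (auto simp: \<sigma>_def T tuples_def PiE_iff extensional_def fun_eq_iff)
    then have "holds \<Sigma> P g (Rel R \<sigma>)"
      using b ai by (auto simp: \<sigma>_def T t_def)
    moreover have "is_formula \<Sigma> V (Rel R \<sigma>)"
      using R ai by (auto intro!: is_formula.intros T simp: \<sigma>_def t_def)
    ultimately have "holds \<Sigma> B e (Rel R \<sigma>)" by (intro holds)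
    moreover have "(\<lambda>i\<in>{..<fst t}. the (eval \<Sigma> B e (\<sigma> i))) = map_tuple t h a"
      using ai by (auto simp: \<sigma>_def kT map_tuple_def fun_eq_iff)
    ultimately show "map_tuple (rdom \<Sigma> R) h a \<in> rint B R"
      by (auto simp: t_def split: if_splits)
  qed (auto simp: h_def)
  moreover have "h (fst v) (g v) = e v" if v: "v \<in> V" for v
  proof -
    have x: "g v \<in> car P (fst v)" using wg v by (auto simp: wf_asg_def)
    then have "fst v \<in> sorts \<Sigma>" using P unfolding is_structure_def by blast
    then have "is_term \<Sigma> V (Var v) (fst v)" using v by (rule is_term.intros(1)[rotated])
    from key[OF this] show ?thesis by simp
  qed
  ultimately show thesis by (rule that)
qed

section \<open>Term models over a small signature\<close>

locale small_sig = universe U + regular_index K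
  for U :: "'u itself" and K :: "'k::wellorder itself" +
  fixes \<Sigma> :: "('s, 'f, 'r, 'k) signature"
  assumes k_small: "small TYPE('u) (UNIV :: 'k set)"
    and sig: "is_signature \<Sigma>" and sig_small: "small_signature TYPE('u) \<Sigma>"
begin

text \<open>A copy of the natural numbers sits inside the infinite small type \<open>'k\<close>;
  this is how uncountability of the universe enters.\<close>

lemma small_nat: "small TYPE('u) (UNIV :: nat set)"
proof -
  obtain f :: "nat \<Rightarrow> 'k" where "inj f" using lam_infinite infinite_countable_subset by blast
  then show ?thesis by (rule small_inj_on[OF k_small]) auto
qed

lemma small_vars:
  assumes "\<And>v. v \<in> V \<Longrightarrow> fst v \<in> sorts \<Sigma>" shows "small TYPE('u) (V :: ('s, 'k) var set)"
proof (rule small_subset)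
  show "small TYPE('u) (sorts \<Sigma> \<times> (UNIV :: 'k set))"
    using sig_small k_small by (intro small_Times) (auto simp: small_signature_def)
qed (use assms in force)

lemma small_tuples:
  fixes M :: "('s, 'f, 'r, 'k, 'u) pstructure"
  assumes "is_structure \<Sigma> M" "\<And>i. i < fst t \<Longrightarrow> snd t i \<in> sorts \<Sigma>"
  shows "small TYPE('u) (tuples M (t :: ('s, 'k) arity))"
  unfolding tuples_def
  by (rule small_PiE) (use assms small_subset[OF k_small] in \<open>auto simp: is_structure_def\<close>)

text \<open>Inside the product over \<open>\<K>\<close>, this is the part generated by the
  assignments taken together. Its elements are the value families of terms defined at every member
  of \<open>\<K>\<close>, and path sets bound their number even when \<open>\<K>\<close> is not
  small.\<close>

lemma term_model:
  fixes \<K> :: "(('s, 'f, 'r, 'k, 'u) pstructure \<times> (('s, 'k) var \<Rightarrow> 'u)) set"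
  assumes V: "\<And>v. v \<in> V \<Longrightarrow> fst v \<in> sorts \<Sigma>"
    and \<K>: "\<And>p. p \<in> \<K> \<Longrightarrow> is_structure \<Sigma> (fst p) \<and> wf_asg (fst p) V (snd p)"
  obtains P \<pi> g where "jemb \<Sigma> \<K> fst P \<pi>" "generated \<Sigma> V P g"
    "\<And>p v. p \<in> \<K> \<Longrightarrow> v \<in> V \<Longrightarrow> push (\<pi> p) g v = snd p v"
proof -
  define ev where "ev \<tau> = (\<lambda>p\<in>\<K>. the (eval \<Sigma> (fst p) (snd p) \<tau>))" for \<tau>
  define def where "def \<tau> \<longleftrightarrow> (\<forall>p\<in>\<K>. eval \<Sigma> (fst p) (snd p) \<tau> \<noteq> None)" for \<tau>
  define Sub where "Sub s = {ev \<tau> | \<tau>. is_term \<Sigma> V \<tau> s \<and> def \<tau>}" for s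
  have small: "small TYPE('u) (Sub s)" for s
  proof (rule small_subset)
    let ?X = "Pow ((UNIV :: 'k list set) \<times> (V <+> funs \<Sigma>))"
    have "small TYPE('u) (UNIV :: 'k list set)"
      using small_lists[OF k_small small_nat] by simp
    then have "small TYPE('u) ?X"
      using small_vars[OF V] sig_small
      by (intro small_Pow small_Times small_Plus) (auto simp: small_signature_def)
    \<comment> \<open>One term is chosen for each path set; by \<open>paths_eval\<close> it has the
      same value family as every other term with these paths.\<close>
    then show "small TYPE('u) ((\<lambda>S. ev (SOME \<tau>. paths \<Sigma> \<tau> = S)) ` ?X)" by (rule small_image)
    show "Sub s \<subseteq> (\<lambda>S. ev (SOME \<tau>. paths \<Sigma> \<tau> = S)) ` ?X"
    proof
      fix y assume "y \<in> Sub s"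
      then obtain \<tau> where \<tau>: "is_term \<Sigma> V \<tau> s" "y = ev \<tau>" by (auto simp: Sub_def)
      have "paths \<Sigma> (SOME \<sigma>. paths \<Sigma> \<sigma> = paths \<Sigma> \<tau>) = paths \<Sigma> \<tau>" by (rule someI) simp
      note same = paths_eval[OF this]
      have "ev (SOME \<sigma>. paths \<Sigma> \<sigma> = paths \<Sigma> \<tau>) = ev \<tau>"
        unfolding ev_def same ..
      then show "y \<in> (\<lambda>S. ev (SOME \<tau>. paths \<Sigma> \<tau> = S)) ` ?X"
        using paths_subset[OF \<tau>(1)] \<tau>(2) by (intro image_eqI[of _ _ "paths \<Sigma> \<tau>"]) auto
    qed
  qed
  have in_car: "the (eval \<Sigma> (fst p) (snd p) \<tau>) \<in> car (fst p) s"
    if "is_term \<Sigma> V \<tau> s" "def \<tau>" "p \<in> \<K>" for \<tau> s p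
    using eval_mem[of \<Sigma> "fst p" V \<tau> s "snd p"] \<K>[OF that(3)] that by (auto simp: def_def)
  obtain P \<pi> where P: "jemb \<Sigma> \<K> fst P \<pi>"
    and im: "\<And>s. s \<in> sorts \<Sigma> \<Longrightarrow> (\<lambda>x. \<lambda>p\<in>\<K>. \<pi> p s x) ` car P s = Sub s"
  proof (rule subproduct[OF sig, of \<K> fst Sub])
    show "Sub s \<subseteq> (\<Pi>\<^sub>E p\<in>\<K>. car (fst p) s)" for s
      using in_car by (fastforce simp: Sub_def ev_def)
    fix f a b
    assume f: "f \<in> funs \<Sigma>" and a: "\<And>i. i < fst (fdom \<Sigma> f) \<Longrightarrow> a i \<in> Sub (snd (fdom \<Sigma> f) i)"
      and bx: "b \<in> extensional \<K>"
      and b: "\<And>p. p \<in> \<K> \<Longrightarrow> fint (fst p) f (\<lambda>i\<in>{..<fst (fdom \<Sigma> f)}. a i p) = Some (b p)"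
    have "\<forall>i. \<exists>\<tau>. i < fst (fdom \<Sigma> f) \<longrightarrow> is_term \<Sigma> V \<tau> (snd (fdom \<Sigma> f) i) \<and> def \<tau> \<and> a i = ev \<tau>"
      using a by (auto simp: Sub_def)
    then obtain \<tau> where \<tau>: "\<And>i. i < fst (fdom \<Sigma> f) \<Longrightarrow>
        is_term \<Sigma> V (\<tau> i) (snd (fdom \<Sigma> f) i) \<and> def (\<tau> i) \<and> a i = ev (\<tau> i)"
      by metis
    have t: "is_term \<Sigma> V (App f \<tau>) (fcod \<Sigma> f)" using f \<tau> by (intro is_term.intros) auto
    have ap: "eval \<Sigma> (fst p) (snd p) (App f \<tau>) = Some (b p)" if p: "p \<in> \<K>" for p
    proof -
      have "(\<lambda>i\<in>{..<fst (fdom \<Sigma> f)}. the (eval \<Sigma> (fst p) (snd p) (\<tau> i))) =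
          (\<lambda>i\<in>{..<fst (fdom \<Sigma> f)}. a i p)"
        using \<tau> p by (intro restrict_ext) (simp add: ev_def)
      then show ?thesis using b[OF p] \<tau> p by (auto simp: def_def)
    qed
    then have "ev (App f \<tau>) = b"
      unfolding ev_def using bx by (intro extensionalityI[of _ \<K>]) (auto simp del: eval.simps)
    moreover have "def (App f \<tau>)" using ap by (auto simp: def_def)
    ultimately show "b \<in> Sub (fcod \<Sigma> f)" using t by (auto simp: Sub_def)
  qed (use \<K> small in auto)
  have "\<forall>v\<in>V. \<exists>x. x \<in> car P (fst v) \<and> (\<forall>p\<in>\<K>. \<pi> p (fst v) x = snd p v)"
  proof
    fix v assume v: "v \<in> V"
    have "ev (Var v) \<in> Sub (fst v)"
      using is_term.intros(1)[of v V \<Sigma>, OF v V[OF v]] unfolding Sub_def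
      by (auto intro!: exI[of _ "Var v"] simp: def_def)
    then have "ev (Var v) \<in> (\<lambda>x. \<lambda>p\<in>\<K>. \<pi> p (fst v) x) ` car P (fst v)" by (simp only: im[OF V[OF v]])
    then obtain x where "x \<in> car P (fst v)" and eq: "(\<lambda>p\<in>\<K>. \<pi> p (fst v) x) = ev (Var v)" by auto
    moreover have "\<pi> p (fst v) x = snd p v" if "p \<in> \<K>" for p
      using fun_cong[OF eq, of p] that by (simp add: ev_def)
    ultimately show "\<exists>x. x \<in> car P (fst v) \<and> (\<forall>p\<in>\<K>. \<pi> p (fst v) x = snd p v)" by blast
  qed
  then obtain g where g: "\<And>v. v \<in> V \<Longrightarrow> g v \<in> car P (fst v)"
    "\<And>v p. v \<in> V \<Longrightarrow> p \<in> \<K> \<Longrightarrow> \<pi> p (fst v) (g v) = snd p v"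
    unfolding bchoice_iff by blast
  then have wg: "wf_asg P V g" by (auto simp: wf_asg_def)
  have pg: "push (\<pi> p) g v = snd p v" if "p \<in> \<K>" "v \<in> V" for p v
    using g that by (simp add: push_def)
  have "generated \<Sigma> V P g"
    unfolding generated_def
  proof (intro conjI wg allI ballI)
    fix s x assume x: "x \<in> car P s"
    then have s: "s \<in> sorts \<Sigma>" using jemb_structure[OF P] unfolding is_structure_def by blast
    then obtain \<tau> where \<tau>: "is_term \<Sigma> V \<tau> s" "def \<tau>" "(\<lambda>p\<in>\<K>. \<pi> p s x) = ev \<tau>"
      using im[OF s] x by (auto simp: Sub_def)
    have ev: "eval \<Sigma> (fst p) (push (\<pi> p) g) \<tau> = Some (\<pi> p s x)" if p: "p \<in> \<K>" for p
    proof -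
      have "eval \<Sigma> (fst p) (push (\<pi> p) g) \<tau> = eval \<Sigma> (fst p) (snd p) \<tau>"
        by (rule eval_cong[OF \<tau>(1)]) (simp add: pg p)
      moreover have "\<pi> p s x = the (eval \<Sigma> (fst p) (snd p) \<tau>)"
        using fun_cong[OF \<tau>(3), of p] p by (simp add: ev_def)
      ultimately show ?thesis using \<tau>(2) p by (auto simp: def_def)
    qed
    obtain y where y: "eval \<Sigma> P g \<tau> = Some y"
      using jemb_eval[OF P \<tau>(1) wg] ev by fastforce
    have "y = x"
    proof (rule jemb_inj[OF P eval_mem[OF jemb_structure[OF P] \<tau>(1) wg y] x])
      fix p assume "p \<in> \<K>"
      then show "\<pi> p s y = \<pi> p s x"
        using eval_hom[OF jemb_hom[OF P] \<tau>(1) y] ev by simp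
    qed
    then show "\<exists>\<tau>. is_term \<Sigma> V \<tau> s \<and> eval \<Sigma> P g \<tau> = Some x" using \<tau>(1) y by auto
  qed
  then show thesis by (rule that[OF P _ pg])
qed

end

text \<open>Each failure in \<open>P\<close>, that is, an unequal pair, an undefined operation or a
  false relation, is detected by a single index. The failures form a small set, so one index for
  each of them gives \<open>W\<close>. This makes closure under small products applicable to
  families indexed by a whole class.\<close>

lemma (in small_sig) jemb_small:
  fixes M :: "'j \<Rightarrow> ('s, 'f, 'r, 'k, 'u) pstructure"
  assumes P: "jemb \<Sigma> J M P \<pi>"
  obtains W where "W \<subseteq> J" "small TYPE('u) W" "jemb \<Sigma> W M P \<pi>"
proof -
  have st: "is_structure \<Sigma> P" by (rule jemb_structure[OF P])
  define X where "X = (SIGMA s:sorts \<Sigma>. {(x, y). x \<in> car P s \<and> y \<in> car P s \<and> x \<noteq> y})"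
  define Y where "Y = (SIGMA f:funs \<Sigma>. {a \<in> tuples P (fdom \<Sigma> f). fint P f a = None})"
  define Z where "Z = (SIGMA R:rels \<Sigma>. tuples P (rdom \<Sigma> R) - rint P R)"
  have "\<forall>p\<in>X. \<exists>j\<in>J. \<pi> j (fst p) (fst (snd p)) \<noteq> \<pi> j (fst p) (snd (snd p))"
    using jemb_inj[OF P] by (fastforce simp: X_def)
  then obtain w1 where w1: "\<And>p. p \<in> X \<Longrightarrow> w1 p \<in> J"
    "\<And>p. p \<in> X \<Longrightarrow> \<pi> (w1 p) (fst p) (fst (snd p)) \<noteq> \<pi> (w1 p) (fst p) (snd (snd p))"
    by metis
  have "\<forall>p\<in>Y. \<exists>j\<in>J. fint (M j) (fst p) (map_tuple (fdom \<Sigma> (fst p)) (\<pi> j) (snd p)) = None"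
    using jemb_fun[OF P] by (fastforce simp: Y_def)
  then obtain w2 where w2: "\<And>p. p \<in> Y \<Longrightarrow> w2 p \<in> J"
    "\<And>p. p \<in> Y \<Longrightarrow> fint (M (w2 p)) (fst p) (map_tuple (fdom \<Sigma> (fst p)) (\<pi> (w2 p)) (snd p)) = None"
    by metis
  have "\<forall>p\<in>Z. \<exists>j\<in>J. map_tuple (rdom \<Sigma> (fst p)) (\<pi> j) (snd p) \<notin> rint (M j) (fst p)"
    using jemb_rel[OF P] by (fastforce simp: Z_def)
  then obtain w3 where w3: "\<And>p. p \<in> Z \<Longrightarrow> w3 p \<in> J"
    "\<And>p. p \<in> Z \<Longrightarrow> map_tuple (rdom \<Sigma> (fst p)) (\<pi> (w3 p)) (snd p) \<notin> rint (M (w3 p)) (fst p)"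
    by metis
  define W where "W = w1 ` X \<union> w2 ` Y \<union> w3 ` Z"
  have WJ: "W \<subseteq> J" using w1 w2 w3 by (auto simp: W_def)
  have tup: "f \<in> funs \<Sigma> \<Longrightarrow> small TYPE('u) (tuples P (fdom \<Sigma> f))"
    "R \<in> rels \<Sigma> \<Longrightarrow> small TYPE('u) (tuples P (rdom \<Sigma> R))" for f R
    using sig by (auto intro!: small_tuples[OF st] simp: is_signature_def)
  have car: "s \<in> sorts \<Sigma> \<Longrightarrow> small TYPE('u) (car P s)" for s
    using st by (simp add: is_structure_def)
  have "small TYPE('u) X"
    unfolding X_def
  proof (rule small_Sigma)
    fix s assume "s \<in> sorts \<Sigma>"
    then have "small TYPE('u) (car P s \<times> car P s)" by (intro small_Times car)
    then show "small TYPE('u) {(x, y). x \<in> car P s \<and> y \<in> car P s \<and> x \<noteq> y}"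
      by (rule small_subset) auto
  qed (use sig_small in \<open>simp add: small_signature_def\<close>)
  moreover have "small TYPE('u) Y" unfolding Y_def
    by (rule small_Sigma) (use sig_small in \<open>auto simp: small_signature_def intro: small_subset[OF tup(1)]\<close>)
  moreover have "small TYPE('u) Z" unfolding Z_def
    by (rule small_Sigma) (use sig_small in \<open>auto simp: small_signature_def intro: small_subset[OF tup(2)]\<close>)
  ultimately have "small TYPE('u) W" unfolding W_def by (intro small_Un small_image)
  moreover have "jemb \<Sigma> W M P \<pi>"
    unfolding jemb_def
  proof (intro conjI ballI allI impI st)
    fix j assume "j \<in> W"
    then show "is_structure \<Sigma> (M j)" "\<pi> j \<in> homs \<Sigma> P (M j)"
      using WJ jemb_structures[OF P] jemb_hom[OF P] by auto
  next
    fix s x y assume x: "x \<in> car P s" and y: "y \<in> car P s" and eq: "\<forall>j\<in>W. \<pi> j s x = \<pi> j s y"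
    show "x = y"
    proof (rule ccontr)
      assume ne: "x \<noteq> y"
      have "s \<in> sorts \<Sigma>" using x st unfolding is_structure_def by blast
      then have "(s, x, y) \<in> X" using x y ne by (simp add: X_def)
      then show False using w1(2) eq by (force simp: W_def)
    qed
  next
    fix f a assume "f \<in> funs \<Sigma>" "a \<in> tuples P (fdom \<Sigma> f)"
      "\<forall>j\<in>W. fint (M j) f (map_tuple (fdom \<Sigma> f) (\<pi> j) a) \<noteq> None"
    then show "fint P f a \<noteq> None"
      using w2(2)[of "(f, a)"] by (force simp: W_def Y_def)
  next
    fix R a assume "R \<in> rels \<Sigma>" "a \<in> tuples P (rdom \<Sigma> R)"
      "\<forall>j\<in>W. map_tuple (rdom \<Sigma> R) (\<pi> j) a \<in> rint (M j) R"
    then show "a \<in> rint P R"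
      using w3(2)[of "(R, a)"] by (force simp: W_def Z_def)
  qed
  ultimately show thesis using WJ by (intro that)
qed


section \<open>Algebras and their reducts\<close>

lemma sig_plus_simps [simp]:
  "sorts (sig_plus \<Sigma> \<Omega>) = sorts \<Sigma>" "rels (sig_plus \<Sigma> \<Omega>) = rels \<Sigma>" "rdom (sig_plus \<Sigma> \<Omega>) = rdom \<Sigma>"
  "fdom (sig_plus \<Sigma> \<Omega>) (Inl f) = fdom \<Sigma> f" "fcod (sig_plus \<Sigma> \<Omega>) (Inl f) = fcod \<Sigma> f"
  "fdom (sig_plus \<Sigma> \<Omega>) (Inr \<omega>) = ctx_arity (fst (ar \<Omega> \<omega>))"
  "fcod (sig_plus \<Sigma> \<Omega>) (Inr \<omega>) = opsort \<Omega> \<omega>"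
  "Inl f \<in> funs (sig_plus \<Sigma> \<Omega>) \<longleftrightarrow> f \<in> funs \<Sigma>"
  "Inr \<omega> \<in> funs (sig_plus \<Sigma> \<Omega>) \<longleftrightarrow> \<omega> \<in> ops \<Omega>"
  by (auto simp: sig_plus_def)

lemma reduct_simps [simp]:
  "car (reduct A) = car A" "rint (reduct A) = rint A" "fint (reduct A) f = fint A (Inl f)"
  "tuples (reduct A) = tuples A"
  by (auto simp: reduct_def tuples_def fun_eq_iff)

lemma wf_asg_reduct [simp]: "wf_asg (reduct A) V e \<longleftrightarrow> wf_asg A V e"
  by (simp add: wf_asg_def)

lemma structure_reduct: "is_structure (sig_plus \<Sigma> \<Omega>) A \<Longrightarrow> is_structure \<Sigma> (reduct A)"
  unfolding is_structure_def
  by (auto simp: reduct_simps) (metis sig_plus_simps(4,5,8))+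

lemma map_trm_Inl:
  "map_trm id Inl (Var v) = Var v"
  "map_trm id Inl (App f \<tau>) = App (Inl f) (\<lambda>i. map_trm id Inl (\<tau> i))"
  by (simp_all add: comp_def id_def map_prod_def)

lemma map_fm_Inl:
  "map_fm id Inl id (Rel R \<tau>) = Rel R (\<lambda>i. map_trm id Inl (\<tau> i))"
  "map_fm id Inl id (Eq \<sigma> \<sigma>') = Eq (map_trm id Inl \<sigma>) (map_trm id Inl \<sigma>')"
  "map_fm id Inl id Top = Top"
  "map_fm id Inl id (Conj \<alpha> \<phi>) = Conj \<alpha> (\<lambda>i. map_fm id Inl id (\<phi> i))"
  by (simp_all add: comp_def id_def)

lemma eval_reduct: "eval (sig_plus \<Sigma> \<Omega>) A e (map_trm id Inl \<tau>) = eval \<Sigma> (reduct A) e \<tau>"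
  by (induction \<tau>) (simp_all only: map_trm_Inl eval.simps sig_plus_simps reduct_simps rangeI)

lemma holds_reduct: "holds (sig_plus \<Sigma> \<Omega>) A e (map_fm id Inl id \<phi>) \<longleftrightarrow> holds \<Sigma> (reduct A) e \<phi>"
  by (induction \<phi>)
    (simp_all only: map_fm_Inl holds.simps eval_reduct sig_plus_simps reduct_simps rangeI)

lemma is_term_plus: "is_term \<Sigma> V \<tau> s \<Longrightarrow> is_term (sig_plus \<Sigma> \<Omega>) V (map_trm id Inl \<tau>) s"
proof (induction rule: is_term.induct)
  case (1 v)
  then show ?case using is_term.intros(1)[of v V "sig_plus \<Sigma> \<Omega>"] by (simp only: map_trm_Inl sig_plus_simps)
next
  case (2 f \<tau>)
  then show ?case using is_term.intros(2)[of "Inl f" "sig_plus \<Sigma> \<Omega>" V "\<lambda>i. map_trm id Inl (\<tau> i)"]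
    by (simp only: map_trm_Inl sig_plus_simps)
qed

lemma is_formula_plus:
  "is_formula \<Sigma> V \<phi> \<Longrightarrow> is_formula (sig_plus \<Sigma> \<Omega>) V (map_fm id Inl id \<phi>)"
proof (induction rule: is_formula.induct)
  case (1 R \<tau>)
  then show ?case
    using is_formula.intros(1)[of R "sig_plus \<Sigma> \<Omega>" V "\<lambda>i. map_trm id Inl (\<tau> i)"]
    by (simp only: map_fm_Inl sig_plus_simps is_term_plus)
next
  case (2 \<tau> s \<tau>')
  then show ?case using is_formula.intros(2)[OF is_term_plus is_term_plus] by (simp only: map_fm_Inl)
next
  case 3
  show ?case by (simp only: map_fm_Inl is_formula.intros(3))
next
  case (4 \<alpha> \<phi>)
  then show ?case using is_formula.intros(4)[of \<alpha> "sig_plus \<Sigma> \<Omega>" V "\<lambda>i. map_fm id Inl id (\<phi> i)"]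
    by (simp only: map_fm_Inl)
qed

lemma is_ctx_plus [simp]: "is_ctx (sig_plus \<Sigma> \<Omega>) x \<longleftrightarrow> is_ctx \<Sigma> x"
  by (simp add: is_ctx_def)

lemma jemb_reduct:
  assumes "jemb (sig_plus \<Sigma> \<Omega>) J M P \<pi>"
  shows "jemb \<Sigma> J (\<lambda>j. reduct (M j)) (reduct P) \<pi>"
  unfolding jemb_def
proof (intro conjI ballI allI impI)
  show "is_structure \<Sigma> (reduct P)" by (rule structure_reduct[OF jemb_structure[OF assms]])
  fix j assume j: "j \<in> J"
  show "is_structure \<Sigma> (reduct (M j))" by (rule structure_reduct[OF jemb_structures[OF assms j]])
  show "\<pi> j \<in> homs \<Sigma> (reduct P) (reduct (M j))" by (rule homs_reduct[OF jemb_hom[OF assms j]])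
qed (use jemb_inj[OF assms] jemb_fun[OF assms, of "Inl _"] jemb_rel[OF assms] in simp_all)

lemma Ob_Alg_iff:
  "A \<in> Ob (Alg \<Sigma> \<S> \<Omega> E) \<longleftrightarrow> is_algebra \<Sigma> \<S> \<Omega> A \<and> (\<forall>q\<in>E. valid (sig_plus \<Sigma> \<Omega>) A q)"
  by (simp add: Alg_def structure_category_def)

lemma Alg_simps [simp]:
  "Hom (Alg \<Sigma> \<S> \<Omega> E) = homs (sig_plus \<Sigma> \<Omega>)" "Comp (Alg \<Sigma> \<S> \<Omega> E) M g f = comp_hom M g f"
  by (simp_all add: Alg_def structure_category_def)

lemma PMod_simps [simp]:
  "Hom (PMod \<Sigma> \<S>) = homs \<Sigma>" "Comp (PMod \<Sigma> \<S>) M g f = comp_hom M g f"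
  "Ob (PMod \<Sigma> \<S>) = {M. is_model \<Sigma> \<S> M}" "Id (PMod \<Sigma> \<S>) M = (\<lambda>s. \<lambda>a\<in>car M s. a)"
  by (simp_all add: PMod_def structure_category_def)

section \<open>Models of the Horn theory and algebras over them\<close>

locale horn_setting = small_sig U K \<Sigma>
  for U :: "'u itself" and K :: "'k::wellorder itself" and \<Sigma> :: "('s, 'f, 'r, 'k) signature" +
  fixes \<S> :: "('s, 'f, 'r, 'k) sequent set"
  assumes horn: "horn_theory \<Sigma> \<S>"
begin

lemma jemb_model:
  assumes P: "jemb \<Sigma> J M P \<pi>" and "\<And>j. j \<in> J \<Longrightarrow> is_model \<Sigma> \<S> (M j)"
  shows "is_model \<Sigma> \<S> P"
  using assms jemb_valid[OF P] jemb_structure[OF P] horn by (auto simp: is_model_def horn_theory_def)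

end

locale alg_setting = horn_setting U K \<Sigma> \<S>
  for U :: "'u itself" and K :: "'k::wellorder itself" and \<Sigma> :: "('s, 'f, 'r, 'k) signature"
    and \<S> :: "('s, 'f, 'r, 'k) sequent set" +
  fixes \<Omega> :: "('s, 'f, 'r, 'k, 'w) rel_signature"
  assumes rel_sig: "is_rel_signature \<Sigma> \<Omega>"
    and ops_small: "small TYPE('u) (ops \<Omega>)"
begin

abbreviation "\<Theta> \<equiv> sig_plus \<Sigma> \<Omega>"

sublocale plus: small_sig U K "sig_plus \<Sigma> \<Omega>"
proof
  show "is_signature \<Theta>"
    unfolding is_signature_def
  proof (intro conjI ballI)
    fix f assume f: "f \<in> funs \<Theta>"
    have "fcod \<Theta> f \<in> sorts \<Sigma> \<and> (\<forall>i<fst (fdom \<Theta> f). snd (fdom \<Theta> f) i \<in> sorts \<Sigma>)"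
    proof (cases f)
      case (Inl g)
      then show ?thesis using sig f by (simp add: is_signature_def)
    next
      case (Inr \<omega>)
      then have \<omega>: "\<omega> \<in> ops \<Omega>" using f by simp
      obtain x \<phi> where ar: "ar \<Omega> \<omega> = (x, \<phi>)" by (cases "ar \<Omega> \<omega>")
      have "is_ctx \<Sigma> x" "opsort \<Omega> \<omega> \<in> sorts \<Sigma>"
        using rel_sig \<omega> ar by (fastforce simp: is_rel_signature_def)+
      then show ?thesis by (simp add: Inr ar ctx_arity_def is_ctx_def)
    qed
    then show "fcod \<Theta> f \<in> sorts \<Theta>" "\<forall>i<fst (fdom \<Theta> f). snd (fdom \<Theta> f) i \<in> sorts \<Theta>"
      by auto
  qed (use sig in \<open>simp add: is_signature_def\<close>)
  show "small_signature TYPE('u) \<Theta>"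
    using sig_small ops_small by (auto simp: small_signature_def sig_plus_def intro: small_Plus)
qed (rule k_small)

lemma algebra_structure: "is_algebra \<Sigma> \<S> \<Omega> A \<Longrightarrow> is_structure \<Theta> A"
  by (simp add: is_algebra_def)

lemma algebra_op:
  "is_algebra \<Sigma> \<S> \<Omega> A \<Longrightarrow> \<omega> \<in> ops \<Omega> \<Longrightarrow> fint A (Inr \<omega>) a \<noteq> None \<longleftrightarrow> a \<in> interp \<Sigma> (reduct A) (ar \<Omega> \<omega>)"
  by (auto simp: is_algebra_def dom_def)

text \<open>Horn formulas are preserved by each \<open>\<pi> j\<close> and jointly reflected by the
  family. Applied to arities, this says that the domains of the operations in
  \<open>\<Omega>\<close> are determined coordinatewise.\<close>

lemma interp_jemb:
  assumes P: "jemb \<Sigma> J M P \<pi>" and \<phi>: "is_hformula \<Sigma> (x, \<phi>)" and a: "a \<in> tuples P (ctx_arity x)"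
  shows "a \<in> interp \<Sigma> P (x, \<phi>) \<longleftrightarrow> (\<forall>j\<in>J. map_tuple (ctx_arity x) (\<pi> j) a \<in> interp \<Sigma> (M j) (x, \<phi>))"
proof -
  have ctx: "is_ctx \<Sigma> x" and f: "is_formula \<Sigma> (ctx_vars x) \<phi>" using \<phi> by auto
  have "holds \<Sigma> (M j) (assign x (map_tuple (ctx_arity x) (\<pi> j) a)) \<phi> \<longleftrightarrow>
      holds \<Sigma> (M j) (push (\<pi> j) (assign x a)) \<phi>" for j
    by (rule holds_cong[OF f]) (rule assign_map_tuple[OF ctx])
  then show ?thesis
    using jemb_holds_iff[OF P f wf_assign[OF ctx a]] a map_tuple_mem[OF jemb_hom[OF P] a] by auto
qed

lemma jemb_algebra:
  assumes P: "jemb \<Theta> J M P \<pi>" and M: "\<And>j. j \<in> J \<Longrightarrow> is_algebra \<Sigma> \<S> \<Omega> (M j)"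
  shows "is_algebra \<Sigma> \<S> \<Omega> P"
  unfolding is_algebra_def
proof (intro conjI ballI)
  note P' = jemb_reduct[OF P]
  show "is_structure \<Theta> P" by (rule jemb_structure[OF P])
  show "is_model \<Sigma> \<S> (reduct P)"
    by (rule jemb_model[OF P']) (use M in \<open>auto simp: is_algebra_def\<close>)
  fix \<omega> assume \<omega>: "\<omega> \<in> ops \<Omega>"
  obtain x \<phi> where ar: "ar \<Omega> \<omega> = (x, \<phi>)" by (cases "ar \<Omega> \<omega>")
  have hf: "is_hformula \<Sigma> (x, \<phi>)" using rel_sig \<omega> unfolding is_rel_signature_def ar[symmetric] by auto
  have it: "interp \<Sigma> (reduct P) (x, \<phi>) \<subseteq> tuples P (ctx_arity x)" by auto
  have "fint P (Inr \<omega>) a \<noteq> None \<longleftrightarrow> a \<in> interp \<Sigma> (reduct P) (x, \<phi>)" for a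
  proof
    assume "fint P (Inr \<omega>) a \<noteq> None"
    then obtain b where b: "fint P (Inr \<omega>) a = Some b" by auto
    have a: "a \<in> tuples P (ctx_arity x)" using structure_fun[OF jemb_structure[OF P] b] by (simp add: ar)
    have "map_tuple (ctx_arity x) (\<pi> j) a \<in> interp \<Sigma> (reduct (M j)) (x, \<phi>)" if j: "j \<in> J" for j
      using hom_fun[OF jemb_hom[OF P j] _ b] \<omega> algebra_op[OF M[OF j] \<omega>] by (auto simp: ar)
    then show "a \<in> interp \<Sigma> (reduct P) (x, \<phi>)"
      using interp_jemb[OF P' hf] a by simp
  next
    assume i: "a \<in> interp \<Sigma> (reduct P) (x, \<phi>)"
    have a: "a \<in> tuples P (ctx_arity x)" using i it by blast
    show "fint P (Inr \<omega>) a \<noteq> None"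
    proof (rule jemb_fun[OF P])
      fix j assume j: "j \<in> J"
      show "fint (M j) (Inr \<omega>) (map_tuple (fdom \<Theta> (Inr \<omega>)) (\<pi> j) a) \<noteq> None"
        using interp_jemb[OF P' hf] a i j unfolding algebra_op[OF M[OF j] \<omega>]
        by (simp add: ar del: interp.simps)
    qed (use a \<omega> in \<open>auto simp: ar\<close>)
  qed
  then show "dom (fint P (Inr \<omega>)) = interp \<Sigma> (reduct P) (ar \<Omega> \<omega>)"
    unfolding ar dom_def by blast
qed

lemma jemb_Alg:
  assumes P: "jemb \<Theta> J M P \<pi>" and M: "\<And>j. j \<in> J \<Longrightarrow> M j \<in> Ob (Alg \<Sigma> \<S> \<Omega> E)"
    and E: "\<And>q. q \<in> E \<Longrightarrow> is_judgment \<Sigma> \<Omega> q"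
  shows "P \<in> Ob (Alg \<Sigma> \<S> \<Omega> E)"
  unfolding Ob_Alg_iff
proof (intro conjI ballI)
  show "is_algebra \<Sigma> \<S> \<Omega> P" by (rule jemb_algebra[OF P]) (use M in \<open>auto simp: Ob_Alg_iff\<close>)
  fix q assume q: "q \<in> E"
  have "is_sequent \<Theta> q" using E[OF q] by (cases q) simp
  then show "valid \<Theta> P q" by (rule jemb_valid[OF P]) (use M q in \<open>auto simp: Ob_Alg_iff\<close>)
qed

text \<open>Closedness for the operations in \<open>\<Omega>\<close> is automatic, their domains being defined by Horn
  formulas over \<open>\<Sigma>\<close>.\<close>

lemma jemb_plusI:
  assumes P: "jemb \<Sigma> J (\<lambda>j. reduct (M j)) (reduct A) \<pi>"
    and A: "is_algebra \<Sigma> \<S> \<Omega> A" and M: "\<And>j. j \<in> J \<Longrightarrow> is_algebra \<Sigma> \<S> \<Omega> (M j)"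
    and \<pi>: "\<And>j. j \<in> J \<Longrightarrow> \<pi> j \<in> homs \<Theta> A (M j)"
  shows "jemb \<Theta> J M A \<pi>"
  unfolding jemb_def
proof (intro conjI ballI allI impI)
  fix f a
  assume f: "f \<in> funs \<Theta>" and a: "a \<in> tuples A (fdom \<Theta> f)"
    and d: "\<forall>j\<in>J. fint (M j) f (map_tuple (fdom \<Theta> f) (\<pi> j) a) \<noteq> None"
  show "fint A f a \<noteq> None"
  proof (cases f)
    case (Inl g)
    then show ?thesis using jemb_fun[OF P, of g a] f a d by simp
  next
    case (Inr \<omega>)
    have \<omega>: "\<omega> \<in> ops \<Omega>" using f Inr by simp
    obtain x \<phi> where ar: "ar \<Omega> \<omega> = (x, \<phi>)" by (cases "ar \<Omega> \<omega>")
    have hf: "is_hformula \<Sigma> (x, \<phi>)" using rel_sig \<omega> unfolding is_rel_signature_def ar[symmetric] by auto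
    have "map_tuple (ctx_arity x) (\<pi> j) a \<in> interp \<Sigma> (reduct (M j)) (x, \<phi>)" if j: "j \<in> J" for j
      using d j Inr algebra_op[OF M[OF j] \<omega>] by (auto simp: ar)
    then have "a \<in> interp \<Sigma> (reduct A) (x, \<phi>)"
      using interp_jemb[OF P hf, of a] a Inr by (simp add: ar)
    then show ?thesis unfolding Inr algebra_op[OF A \<omega>] ar .
  qed
qed (use A M[THEN algebra_structure] \<pi> algebra_structure jemb_inj[OF P] jemb_rel[OF P] in simp_all)

text \<open>The kernel pair of \<open>h\<close> is a subproduct of two copies of \<open>A\<close>,
  hence an algebra of the same theory. Its two projections agree after \<open>h\<close>, so they are
  equal, and the pair of \<open>x\<close> and \<open>y\<close> is one of its elements.\<close>

lemma mono_inj: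
  fixes A :: "('s, 'f + 'w, 'r, 'k, 'u) pstructure"
  assumes A: "A \<in> Ob (Alg \<Sigma> \<S> \<Omega> E)" and E: "\<And>q. q \<in> E \<Longrightarrow> is_judgment \<Sigma> \<Omega> q"
    and mono: "mono_in (Alg \<Sigma> \<S> \<Omega> E) A B h"
    and x: "x \<in> car A s" and y: "y \<in> car A s" and eq: "h s x = h s y"
  shows "x = y"
proof -
  have h: "h \<in> homs \<Theta> A B" using mono by (simp add: mono_in_def)
  have st: "is_structure \<Theta> A" using A by (simp add: Ob_Alg_iff algebra_structure)
  have s: "s \<in> sorts \<Sigma>" using st x unfolding is_structure_def by auto
  define Sub where "Sub t = {g :: bool \<Rightarrow> 'u. g False \<in> car A t \<and> g True \<in> car A t \<and>
      h t (g False) = h t (g True)}" for t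
  have sub: "Sub t \<subseteq> (\<Pi>\<^sub>E j\<in>UNIV. car A t)" for t
    by (auto simp: Sub_def) (metis (full_types))
  obtain P \<pi> where P: "jemb \<Theta> UNIV (\<lambda>_ :: bool. A) P \<pi>"
    and im: "\<And>t. t \<in> sorts \<Theta> \<Longrightarrow> (\<lambda>x. \<lambda>j\<in>UNIV. \<pi> j t x) ` car P t = Sub t"
  proof (rule subproduct[OF plus.sig, of UNIV "\<lambda>_ :: bool. A" Sub])
    show "small TYPE('u) (Sub t)" if "t \<in> sorts \<Theta>" for t
      by (rule small_subset[OF small_PiE sub]) (use st that in \<open>auto simp: small_finite is_structure_def\<close>)
    fix f a and b :: "bool \<Rightarrow> 'u"
    assume f: "f \<in> funs \<Theta>" and a: "\<And>i. i < fst (fdom \<Theta> f) \<Longrightarrow> a i \<in> Sub (snd (fdom \<Theta> f) i)"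
      and b: "\<And>j. j \<in> UNIV \<Longrightarrow> fint A f (\<lambda>i\<in>{..<fst (fdom \<Theta> f)}. a i j) = Some (b j)"
    let ?a = "\<lambda>j. \<lambda>i\<in>{..<fst (fdom \<Theta> f)}. a i j"
    \<comment> \<open>The kernel pair is closed under operations because \<open>h\<close> sends both
      argument tuples to the same tuple, hence both results to the same value.\<close>
    have "map_tuple (fdom \<Theta> f) h (?a False) = map_tuple (fdom \<Theta> f) h (?a True)"
      using a by (auto simp: map_tuple_def fun_eq_iff Sub_def)
    then have "h (fcod \<Theta> f) (b False) = h (fcod \<Theta> f) (b True)"
      using hom_fun[OF h f b[of False]] hom_fun[OF h f b[of True]] by simp
    then show "b \<in> Sub (fcod \<Theta> f)"
      using structure_fun[OF st b] by (simp add: Sub_def)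
  qed (use st sub in auto)
  have "P \<in> Ob (Alg \<Sigma> \<S> \<Omega> E)" by (rule jemb_Alg[OF P A E])
  moreover have "comp_hom P h (\<pi> False) = comp_hom P h (\<pi> True)"
  proof
    fix t
    have "h t (\<pi> False t z) = h t (\<pi> True t z)" if z: "z \<in> car P t" for z
    proof -
      have "t \<in> sorts \<Theta>" using jemb_structure[OF P] z unfolding is_structure_def by blast
      then have "(\<lambda>j\<in>UNIV. \<pi> j t z) \<in> Sub t" using im z by blast
      then show ?thesis by (simp add: Sub_def)
    qed
    then show "comp_hom P h (\<pi> False) t = comp_hom P h (\<pi> True) t"
      by (auto simp: compose_def)
  qed
  ultimately have \<pi>: "\<pi> False = \<pi> True"
    using mono jemb_hom[OF P] by (auto simp: mono_in_def)
  have "(\<lambda>j. if j then y else x) \<in> Sub s" using x y eq by (simp add: Sub_def)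
  then obtain z where z: "(\<lambda>j. if j then y else x) = (\<lambda>j\<in>UNIV. \<pi> j s z)"
    using im[of s] s by auto
  have "(if j then y else x) = \<pi> j s z" for j using fun_cong[OF z, of j] by simp
  from this[of True] this[of False] show ?thesis using \<pi> by simp
qed

section \<open>Products of algebras, concrete and abstract\<close>

lemma product_exists:
  fixes M :: "'j \<Rightarrow> ('s, 'f + 'w, 'r, 'k, 'u) pstructure"
  assumes J: "small TYPE('u) J" and M: "\<And>j. j \<in> J \<Longrightarrow> M j \<in> Ob (Alg \<Sigma> \<S> \<Omega> E)"
    and E: "\<And>q. q \<in> E \<Longrightarrow> is_judgment \<Sigma> \<Omega> q"
  obtains P \<pi> where "jemb \<Theta> J M P \<pi>" "P \<in> Ob (Alg \<Sigma> \<S> \<Omega> E)"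
    "\<And>s. s \<in> sorts \<Sigma> \<Longrightarrow> (\<lambda>x. \<lambda>j\<in>J. \<pi> j s x) ` car P s = (\<Pi>\<^sub>E j\<in>J. car (M j) s)"
proof -
  have st: "is_structure \<Theta> (M j)" if "j \<in> J" for j
    using M[OF that] by (simp add: Ob_Alg_iff algebra_structure)
  obtain P \<pi> where P: "jemb \<Theta> J M P \<pi>" and im: "\<And>s. s \<in> sorts \<Theta> \<Longrightarrow>
      (\<lambda>x. \<lambda>j\<in>J. \<pi> j s x) ` car P s = (\<Pi>\<^sub>E j\<in>J. car (M j) s)"
  proof (rule subproduct[OF plus.sig, of J M "\<lambda>s. \<Pi>\<^sub>E j\<in>J. car (M j) s"])
    show "small TYPE('u) (\<Pi>\<^sub>E j\<in>J. car (M j) s)" if "s \<in> sorts \<Theta>" for s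
      by (rule small_PiE[OF J]) (use st that in \<open>auto simp: is_structure_def\<close>)
    fix f a b
    assume "b \<in> extensional J"
      and b: "\<And>j. j \<in> J \<Longrightarrow> fint (M j) f (\<lambda>i\<in>{..<fst (fdom \<Theta> f)}. a i j) = Some (b j)"
    then show "b \<in> (\<Pi>\<^sub>E j\<in>J. car (M j) (fcod \<Theta> f))"
      using structure_fun[OF st b] by (auto simp: PiE_def)
  qed (use st in auto)
  show thesis by (rule that[OF P jemb_Alg[OF P M E]]) (use im in auto)
qed

lemma product_lift:
  fixes M :: "'j \<Rightarrow> ('s, 'f + 'w, 'r, 'k, 'u) pstructure"
  assumes P: "jemb \<Theta> J M P \<pi>"
    and im: "\<And>s. s \<in> sorts \<Sigma> \<Longrightarrow> (\<lambda>x. \<lambda>j\<in>J. \<pi> j s x) ` car P s = (\<Pi>\<^sub>E j\<in>J. car (M j) s)"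
    and Q: "is_structure \<Theta> Q" and q: "\<And>j. j \<in> J \<Longrightarrow> q j \<in> homs \<Theta> Q (M j)"
  obtains u where "u \<in> homs \<Theta> Q P" "\<And>j. j \<in> J \<Longrightarrow> comp_hom Q (\<pi> j) u = q j"
proof -
  define v where "v s x = (SOME y. y \<in> car P s \<and> (\<forall>j\<in>J. \<pi> j s y = q j s x))" for s x
  have vx: "v s x \<in> car P s \<and> (\<forall>j\<in>J. \<pi> j s (v s x) = q j s x)" if x: "x \<in> car Q s" for s x
    unfolding v_def
  proof (rule someI_ex)
    have s: "s \<in> sorts \<Sigma>" using x Q unfolding is_structure_def by auto
    have "(\<lambda>j\<in>J. q j s x) \<in> (\<Pi>\<^sub>E j\<in>J. car (M j) s)" using x q by (auto intro: hom_mem)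
    then obtain y where y: "y \<in> car P s" "(\<lambda>j\<in>J. q j s x) = (\<lambda>j\<in>J. \<pi> j s y)"
      unfolding im[OF s, symmetric] by auto
    have "\<pi> j s y = q j s x" if "j \<in> J" for j using fun_cong[OF y(2), of j] that by simp
    then show "\<exists>y. y \<in> car P s \<and> (\<forall>j\<in>J. \<pi> j s y = q j s x)" using y(1) by blast
  qed
  then have v: "\<And>s x. x \<in> car Q s \<Longrightarrow> v s x \<in> car P s"
    "\<And>s x j. x \<in> car Q s \<Longrightarrow> j \<in> J \<Longrightarrow> \<pi> j s (v s x) = q j s x"
    by blast+
  define u where "u s = restrict (v s) (car Q s)" for s
  have u: "u \<in> homs \<Theta> Q P"
    by (rule jemb_lift[OF P Q q]) (auto simp: u_def v)
  moreover have "comp_hom Q (\<pi> j) u = q j" if "j \<in> J" for j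
    by (rule hom_eqI[OF comp_hom_mem[OF Q u jemb_hom[OF P that]] q[OF that]])
      (auto simp: u_def v that compose_eq)
  ultimately show thesis by (rule that)
qed

lemma product_is_product:
  fixes M :: "'j \<Rightarrow> ('s, 'f + 'w, 'r, 'k, 'u) pstructure"
  assumes M: "\<And>j. j \<in> J \<Longrightarrow> M j \<in> Ob (Alg \<Sigma> \<S> \<Omega> E)"
    and P: "jemb \<Theta> J M P \<pi>" "P \<in> Ob (Alg \<Sigma> \<S> \<Omega> E)"
    "\<And>s. s \<in> sorts \<Sigma> \<Longrightarrow> (\<lambda>x. \<lambda>j\<in>J. \<pi> j s x) ` car P s = (\<Pi>\<^sub>E j\<in>J. car (M j) s)"
  shows "is_product (Alg \<Sigma> \<S> \<Omega> E) J M P \<pi>"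
  unfolding is_product_def
proof (intro conjI ballI allI impI P M)
  fix j assume j: "j \<in> J"
  then show "\<pi> j \<in> Hom (Alg \<Sigma> \<S> \<Omega> E) P (M j)" using jemb_hom[OF P(1)] by simp
next
  fix Q q assume Q: "Q \<in> Ob (Alg \<Sigma> \<S> \<Omega> E)" and "\<forall>j\<in>J. q j \<in> Hom (Alg \<Sigma> \<S> \<Omega> E) Q (M j)"
  then have st: "is_structure \<Theta> Q" and q: "\<And>j. j \<in> J \<Longrightarrow> q j \<in> homs \<Theta> Q (M j)"
    by (auto simp: Ob_Alg_iff algebra_structure)
  obtain u where u: "u \<in> homs \<Theta> Q P" "\<And>j. j \<in> J \<Longrightarrow> comp_hom Q (\<pi> j) u = q j"
    using product_lift[OF P(1,3) st q] by blast
  have "u' = u" if u': "u' \<in> homs \<Theta> Q P" "\<And>j. j \<in> J \<Longrightarrow> comp_hom Q (\<pi> j) u' = q j" for u'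
  proof (rule hom_eqI[OF u'(1) u(1)])
    fix s x assume x: "x \<in> car Q s"
    show "u' s x = u s x"
    proof (rule jemb_inj[OF P(1) hom_mem[OF u'(1) x] hom_mem[OF u(1) x]])
      fix j assume "j \<in> J"
      then show "\<pi> j s (u' s x) = \<pi> j s (u s x)"
        using comp_homD[OF u(2) x] comp_homD[OF u'(2) x] by simp
    qed
  qed
  then show "\<exists>!u. u \<in> Hom (Alg \<Sigma> \<S> \<Omega> E) Q P \<and> (\<forall>j\<in>J. Comp (Alg \<Sigma> \<S> \<Omega> E) Q (\<pi> j) u = q j)"
    unfolding Alg_simps using u by (intro ex1I[of _ u]) blast+
qed

text \<open>The product \<open>P\<close> is known only through its universal property. Comparison
  with the concrete product \<open>Q\<close> gives \<open>v\<close> into \<open>Q\<close> and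
  \<open>u\<close> back with \<open>u\<close> after \<open>v\<close> the identity, so whatever
  \<open>Q\<close> reflects at images under \<open>v\<close> returns to \<open>P\<close> along
  \<open>u\<close>.\<close>

lemma abstract_product_jemb:
  fixes M :: "'j \<Rightarrow> ('s, 'f + 'w, 'r, 'k, 'u) pstructure"
  assumes J: "small TYPE('u) J" and E: "\<And>q. q \<in> E \<Longrightarrow> is_judgment \<Sigma> \<Omega> q"
    and prod: "is_product (Alg \<Sigma> \<S> \<Omega> E) J M P p"
  shows "jemb \<Theta> J M P p"
proof -
  have M: "M j \<in> Ob (Alg \<Sigma> \<S> \<Omega> E)" and p: "p j \<in> homs \<Theta> P (M j)" if "j \<in> J" for j
    using prod that by (auto simp: is_product_def)
  have PO: "P \<in> Ob (Alg \<Sigma> \<S> \<Omega> E)" using prod by (simp add: is_product_def)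
  have st: "is_structure \<Theta> P" using PO by (simp add: Ob_Alg_iff algebra_structure)
  obtain Q \<pi> where Q: "jemb \<Theta> J M Q \<pi>" "Q \<in> Ob (Alg \<Sigma> \<S> \<Omega> E)"
    "\<And>s. s \<in> sorts \<Sigma> \<Longrightarrow> (\<lambda>x. \<lambda>j\<in>J. \<pi> j s x) ` car Q s = (\<Pi>\<^sub>E j\<in>J. car (M j) s)"
    using product_exists[of J M E, OF J M E] by blast
  note stQ = jemb_structure[OF Q(1)]
  obtain v where v: "v \<in> homs \<Theta> P Q" "\<And>j. j \<in> J \<Longrightarrow> comp_hom P (\<pi> j) v = p j"
    using product_lift[OF Q(1,3) st p] by blast
  obtain u where u: "u \<in> homs \<Theta> Q P" "\<And>j. j \<in> J \<Longrightarrow> comp_hom Q (p j) u = \<pi> j"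
    using prod Q(2) jemb_hom[OF Q(1)] unfolding is_product_def Alg_simps by blast
  have pv: "\<pi> j s (v s x) = p j s x" if "j \<in> J" "x \<in> car P s" for j s x
    by (rule comp_homD[OF v(2)[OF that(1)] that(2)])
  have pu: "p j s (u s x) = \<pi> j s x" if "j \<in> J" "x \<in> car Q s" for j s x
    by (rule comp_homD[OF u(2)[OF that(1)] that(2)])
  define i where "i s = (\<lambda>a\<in>car P s. a)" for s
  have i: "i \<in> homs \<Theta> P P" unfolding i_def[abs_def] by (rule id_hom[OF st])
  have uv: "comp_hom P u v = i"
  proof -
    have w: "comp_hom P u v \<in> homs \<Theta> P P" by (rule comp_hom_mem[OF st v(1) u(1)])
    have 1: "comp_hom P (p j) (comp_hom P u v) = p j" if j: "j \<in> J" for j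
      by (rule hom_eqI[OF comp_hom_mem[OF st w p[OF j]] p[OF j]])
        (use j in \<open>auto simp: compose_eq pu pv hom_mem[OF v(1)]\<close>)
    have 2: "comp_hom P (p j) i = p j" if j: "j \<in> J" for j
      by (rule hom_eqI[OF comp_hom_mem[OF st i p[OF j]] p[OF j]])
        (use j in \<open>auto simp: compose_eq i_def\<close>)
    \<comment> \<open>Both \<open>comp_hom P u v\<close> and the identity commute with all
      projections, so uniqueness identifies them.\<close>
    have "\<exists>!u. u \<in> homs \<Theta> P P \<and> (\<forall>j\<in>J. comp_hom P (p j) u = p j)"
      using prod PO p unfolding is_product_def Alg_simps by blast
    then show ?thesis using w i 1 2 by blast
  qed
  have uvx: "u s (v s x) = x" if "x \<in> car P s" for s x
    using comp_homD[OF uv that] that by (simp add: i_def)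
  have mp: "map_tuple t (\<pi> j) (map_tuple t v a) = map_tuple t (p j) a" if "j \<in> J" "a \<in> tuples P t" for j t a
    using that by (auto simp: map_tuple_def fun_eq_iff pv tuples_mem)
  have mu: "map_tuple t u (map_tuple t v a) = a" if "a \<in> tuples P t" for t a
    by (rule tuples_eqI[OF map_tuple_mem[OF u(1) map_tuple_mem[OF v(1) that]] that])
      (use that in \<open>auto simp: map_tuple_def uvx tuples_mem\<close>)
  show ?thesis
    unfolding jemb_def
  proof (intro conjI ballI allI impI st p)
    show "is_structure \<Theta> (M j)" if "j \<in> J" for j by (rule jemb_structures[OF Q(1) that])
    fix s x y assume x: "x \<in> car P s" and y: "y \<in> car P s" and eq: "\<forall>j\<in>J. p j s x = p j s y"
    have "v s x = v s y"
      by (rule jemb_inj[OF Q(1) hom_mem[OF v(1) x] hom_mem[OF v(1) y]]) (use eq x y in \<open>simp add: pv\<close>)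
    then have "u s (v s x) = u s (v s y)" by (rule arg_cong)
    then show "x = y" unfolding uvx[OF x] uvx[OF y] .
  next
    fix f a assume f: "f \<in> funs \<Theta>" and a: "a \<in> tuples P (fdom \<Theta> f)"
      and d: "\<forall>j\<in>J. fint (M j) f (map_tuple (fdom \<Theta> f) (p j) a) \<noteq> None"
    have "fint Q f (map_tuple (fdom \<Theta> f) v a) \<noteq> None"
      by (rule jemb_fun[OF Q(1) f map_tuple_mem[OF v(1) a]]) (use d a in \<open>simp add: mp\<close>)
    then obtain b where "fint Q f (map_tuple (fdom \<Theta> f) v a) = Some b" by auto
    from hom_fun[OF u(1) f this] show "fint P f a \<noteq> None" by (simp add: mu[OF a])
  next
    fix R a assume R: "R \<in> rels \<Theta>" and a: "a \<in> tuples P (rdom \<Theta> R)"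
      and d: "\<forall>j\<in>J. map_tuple (rdom \<Theta> R) (p j) a \<in> rint (M j) R"
    have "map_tuple (rdom \<Theta> R) v a \<in> rint Q R"
      by (rule jemb_rel[OF Q(1) R map_tuple_mem[OF v(1) a]]) (use d in \<open>simp only: mp[OF _ a]\<close>)
    from hom_rel[OF u(1) R this] show "a \<in> rint P R" using mu[OF a] by simp
  qed
qed

text \<open>Subobjects are treated as joint embeddings with a single member: \<open>mono_inj\<close>
  supplies injectivity, and reflection for the operations of \<open>\<Omega>\<close> comes from
  \<open>jemb_plusI\<close>.\<close>

lemma sigma_closed_jemb:
  fixes A :: "('s, 'f + 'w, 'r, 'k, 'u) pstructure"
  assumes A: "A \<in> Ob (Alg \<Sigma> \<S> \<Omega> E)" and B: "B \<in> Ob (Alg \<Sigma> \<S> \<Omega> E)"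
    and E: "\<And>q. q \<in> E \<Longrightarrow> is_judgment \<Sigma> \<Omega> q"
    and mono: "mono_in (Alg \<Sigma> \<S> \<Omega> E) A B h" and closed: "sigma_closed \<Sigma> A B h"
  shows "jemb \<Theta> {()} (\<lambda>_. B) A (\<lambda>_. h)"
proof (rule jemb_plusI)
  have h: "h \<in> homs \<Theta> A B" using mono by (simp add: mono_in_def)
  then show "h \<in> homs \<Theta> A B" .
  show alg: "is_algebra \<Sigma> \<S> \<Omega> A" "is_algebra \<Sigma> \<S> \<Omega> B" using A B by (auto simp: Ob_Alg_iff)
  show "jemb \<Sigma> {()} (\<lambda>_. reduct B) (reduct A) (\<lambda>_. h)"
    using homs_reduct[OF h] alg mono_inj[OF A E mono] closed
    unfolding jemb_def sigma_closed_def
    by (auto intro: structure_reduct algebra_structure)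
qed

text \<open>A joint embedding over a small index set induces a \<open>\<Sigma>\<close>-closed
  monomorphism into the product, so the two closure conditions together give membership.\<close>

lemma closed_subproduct:
  fixes M :: "'j \<Rightarrow> ('s, 'f + 'w, 'r, 'k, 'u) pstructure"
  assumes E: "\<And>q. q \<in> E \<Longrightarrow> is_judgment \<Sigma> \<Omega> q" and \<E>: "\<E> \<subseteq> Ob (Alg \<Sigma> \<S> \<Omega> E)"
    and prods: "closed_under_products TYPE('u) (Alg \<Sigma> \<S> \<Omega> E) \<E>"
    and subs: "closed_under_sigma_closed_subobjects \<Sigma> (Alg \<Sigma> \<S> \<Omega> E) \<E>"
    and J: "small TYPE('u) J" and P: "jemb \<Theta> J M P \<pi>" and M: "\<And>j. j \<in> J \<Longrightarrow> M j \<in> \<E>"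
  shows "P \<in> \<E>"
proof -
  obtain c :: "'j \<Rightarrow> 'u" where c: "inj_on c J" using small_code[OF J] .
  \<comment> \<open>Products in the closure condition are indexed by subsets of \<open>'u\<close>,
    so the family is transported along \<open>c\<close>.\<close>
  define I where "I = c ` J"
  define N where "N i = M (inv_into J c i)" for i
  have N: "N i \<in> \<E>" if "i \<in> I" for i
    using that c by (auto simp: I_def N_def intro: M)
  have Nc: "N (c j) = M j" if "j \<in> J" for j using that c by (simp add: N_def)
  have NO: "N i \<in> Ob (Alg \<Sigma> \<S> \<Omega> E)" if "i \<in> I" for i using N[OF that] \<E> by blast
  have I: "small TYPE('u) I" unfolding I_def by (rule small_image[OF J])
  obtain Q \<kappa> where Q: "jemb \<Theta> I N Q \<kappa>" "Q \<in> Ob (Alg \<Sigma> \<S> \<Omega> E)"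
    "\<And>s. s \<in> sorts \<Sigma> \<Longrightarrow> (\<lambda>x. \<lambda>j\<in>I. \<kappa> j s x) ` car Q s = (\<Pi>\<^sub>E j\<in>I. car (N j) s)"
    using product_exists[of I N E, OF I NO E] by blast
  have QE: "Q \<in> \<E>"
    using prods I N product_is_product[OF NO Q] unfolding closed_under_products_def by blast
  have PO: "P \<in> Ob (Alg \<Sigma> \<S> \<Omega> E)" by (rule jemb_Alg[OF P _ E]) (use M \<E> in auto)
  note st = jemb_structure[OF P]
  have q: "\<pi> (inv_into J c i) \<in> homs \<Theta> P (N i)" if "i \<in> I" for i
    using that c jemb_hom[OF P] by (auto simp: I_def N_def)
  obtain u where u: "u \<in> homs \<Theta> P Q"
    "\<And>i. i \<in> I \<Longrightarrow> comp_hom P (\<kappa> i) u = \<pi> (inv_into J c i)"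
    using product_lift[OF Q(1,3) st q] by blast
  have ku: "\<kappa> (c j) s (u s x) = \<pi> j s x" if "j \<in> J" "x \<in> car P s" for j s x
  proof -
    have "comp_hom P (\<kappa> (c j)) u = \<pi> j" using u(2)[of "c j"] that(1) c by (simp add: I_def)
    then show ?thesis using that(2) by (rule comp_homD)
  qed
  have mt: "map_tuple t (\<kappa> (c j)) (map_tuple t u a) = map_tuple t (\<pi> j) a"
    if "j \<in> J" "a \<in> tuples P t" for j t a
    using that by (auto simp: map_tuple_def fun_eq_iff ku tuples_mem)
  have inj: "x = y" if "x \<in> car P s" "y \<in> car P s" "u s x = u s y" for x y s
    by (rule jemb_inj[OF P that(1,2)]) (use ku that in metis)
  have "mono_in (Alg \<Sigma> \<S> \<Omega> E) P Q u"
    unfolding mono_in_def Alg_simps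
  proof (intro conjI ballI allI impI u(1))
    fix Z f g assume f: "f \<in> homs \<Theta> Z P" and g: "g \<in> homs \<Theta> Z P"
      and eq: "comp_hom Z u f = comp_hom Z u g"
    show "f = g"
    proof (rule hom_eqI[OF f g])
      fix s x assume x: "x \<in> car Z s"
      have "u s (f s x) = u s (g s x)" using comp_homD[OF eq x] x by (simp add: compose_eq)
      then show "f s x = g s x" by (rule inj[OF hom_mem[OF f x] hom_mem[OF g x]])
    qed
  qed
  moreover have "sigma_closed \<Sigma> P Q u"
    unfolding sigma_closed_def
  proof (intro conjI ballI impI)
    fix f a assume f: "f \<in> funs \<Sigma>" and a: "a \<in> tuples P (fdom \<Sigma> f)"
      and "fint Q (Inl f) (map_tuple (fdom \<Sigma> f) u a) \<noteq> None"
    then obtain b where b: "fint Q (Inl f) (map_tuple (fdom \<Sigma> f) u a) = Some b" by auto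
    show "fint P (Inl f) a \<noteq> None"
    proof (rule jemb_fun[OF P])
      fix j assume j: "j \<in> J"
      then have cj: "c j \<in> I" by (simp add: I_def)
      show "fint (M j) (Inl f) (map_tuple (fdom \<Theta> (Inl f)) (\<pi> j) a) \<noteq> None"
        using hom_fun[OF jemb_hom[OF Q(1) cj] _ b] f mt[OF j a] Nc[OF j] by simp
    qed (use f a in auto)
  next
    fix R a assume R: "R \<in> rels \<Sigma>" and a: "a \<in> tuples P (rdom \<Sigma> R)"
      and r: "map_tuple (rdom \<Sigma> R) u a \<in> rint Q R"
    show "a \<in> rint P R"
    proof (rule jemb_rel[OF P])
      fix j assume j: "j \<in> J"
      then have cj: "c j \<in> I" by (simp add: I_def)
      show "map_tuple (rdom \<Theta> R) (\<pi> j) a \<in> rint (M j) R"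
        using hom_rel[OF jemb_hom[OF Q(1) cj] _ r] R mt[OF j a] Nc[OF j] by simp
    qed (use R a in auto)
  qed
  ultimately show ?thesis
    using subs PO QE unfolding closed_under_sigma_closed_subobjects_def by blast
qed

end

section \<open>Directed colimits of partial models\<close>

lemma colimit_cocone: "is_colimit C I le D d L c \<Longrightarrow> is_cocone C I le D d L c"
  by (simp add: is_colimit_def)

lemma colimit_unique_map:
  "is_colimit C I le D d L c \<Longrightarrow> is_cocone C I le D d L' c' \<Longrightarrow>
     \<exists>!u. u \<in> Hom C L L' \<and> (\<forall>i\<in>I. Comp C (D i) u (c i) = c' i)"
  by (simp add: is_colimit_def)

locale directed_diagram = horn_setting U K \<Sigma> \<S>
  for U :: "'u itself" and K :: "'k::wellorder itself" and \<Sigma> :: "('s, 'f, 'r, 'k) signature"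
    and \<S> :: "('s, 'f, 'r, 'k) sequent set" +
  fixes I :: "'i set" and le :: "'i rel" and D :: "'i \<Rightarrow> ('s, 'f, 'r, 'k, 'u) pstructure"
    and d :: "'i \<Rightarrow> 'i \<Rightarrow> ('s, 'u) hom"
  assumes I_small: "small TYPE('u) I" and dir: "directed_poset (lam :: 'k rel) I le"
    and diag: "is_diagram (PMod \<Sigma> \<S>) I le D d"
begin

lemma le_mem: "(i, j) \<in> le \<Longrightarrow> i \<in> I \<and> j \<in> I"
  using dir unfolding directed_poset_def partial_order_on_def preorder_on_def by auto

lemma le_refl: "i \<in> I \<Longrightarrow> (i, i) \<in> le"
  using dir unfolding directed_poset_def partial_order_on_def preorder_on_def refl_on_def by auto

lemma le_trans: "(i, j) \<in> le \<Longrightarrow> (j, k) \<in> le \<Longrightarrow> (i, k) \<in> le"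
  using dir unfolding directed_poset_def partial_order_on_def preorder_on_def trans_def by blast

lemma ub: "J \<subseteq> I \<Longrightarrow> |J| <o (lam :: 'k rel) \<Longrightarrow> \<exists>u\<in>I. \<forall>j\<in>J. (j, u) \<in> le"
  using dir unfolding directed_poset_def by blast

text \<open>The stage \<open>i\<close> is included so that the bound lies above it even when there
  are no indices below \<open>\<alpha>\<close>.\<close>

lemma ub_fun:
  assumes "\<And>n. n < (\<alpha> :: 'k) \<Longrightarrow> j n \<in> I" "i \<in> I"
  obtains u where "u \<in> I" "(i, u) \<in> le" "\<And>n. n < \<alpha> \<Longrightarrow> (j n, u) \<in> le"
proof -
  have "|insert i (j ` {..<\<alpha>})| <o (lam :: 'k rel)"
    using lam_Un[OF lam_finite[of "{i}"] lam_image[OF lam_initial[of \<alpha>], of j]] by simp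
  from ub[OF _ this] show thesis using assms that by fastforce
qed

lemma ub2:
  assumes "i \<in> I" "j \<in> I" obtains u where "u \<in> I" "(i, u) \<in> le" "(j, u) \<in> le"
  using ub[of "{i, j}"] assms lam_finite[of "{i, j}"] by auto

lemma D_model: "i \<in> I \<Longrightarrow> is_model \<Sigma> \<S> (D i)"
  using diag by (auto simp: is_diagram_def)

lemma D_structure: "i \<in> I \<Longrightarrow> is_structure \<Sigma> (D i)"
  using D_model by (auto simp: is_model_def)

lemma d_hom: "(i, j) \<in> le \<Longrightarrow> d i j \<in> homs \<Sigma> (D i) (D j)"
  using diag by (auto simp: is_diagram_def)

lemma d_refl: "i \<in> I \<Longrightarrow> x \<in> car (D i) s \<Longrightarrow> d i i s x = x"
  using diag by (auto simp: is_diagram_def)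

lemma d_comp: "(i, j) \<in> le \<Longrightarrow> (j, k) \<in> le \<Longrightarrow> x \<in> car (D i) s \<Longrightarrow> d j k s (d i j s x) = d i k s x"
proof -
  assume ij: "(i, j) \<in> le" and jk: "(j, k) \<in> le" and x: "x \<in> car (D i) s"
  have "comp_hom (D i) (d j k) (d i j) = d i k"
    using diag ij jk unfolding is_diagram_def PMod_simps by blast
  then show ?thesis using x by (rule comp_homD)
qed

lemma d_tuple_comp:
  "(i, j) \<in> le \<Longrightarrow> (j, k) \<in> le \<Longrightarrow> a \<in> tuples (D i) t \<Longrightarrow>
     map_tuple t (d j k) (map_tuple t (d i j) a) = map_tuple t (d i k) a"
  by (auto simp: map_tuple_def fun_eq_iff d_comp tuples_mem)

lemma d_mem: "(i, j) \<in> le \<Longrightarrow> x \<in> car (D i) s \<Longrightarrow> d i j s x \<in> car (D j) s"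
  using d_hom hom_mem by metis

text \<open>The usual description of a directed colimit on underlying sets: elements come from
  stages, and each equality, definedness or relation is witnessed at a later stage. It is a property
  of a cocone and not a construction, so that it also applies to the arbitrary colimits occurring in
  \<open>presentable\<close>.\<close>

definition concrete_cocone ::
  "('s, 'f, 'r, 'k, 'u) pstructure \<Rightarrow> ('i \<Rightarrow> ('s, 'u) hom) \<Rightarrow> bool" where
  "concrete_cocone L c \<longleftrightarrow> is_structure \<Sigma> L \<and> (\<forall>i\<in>I. c i \<in> homs \<Sigma> (D i) L) \<and>
     (\<forall>i j s x. (i, j) \<in> le \<and> x \<in> car (D i) s \<longrightarrow> c j s (d i j s x) = c i s x) \<and>
     (\<forall>s. \<forall>y\<in>car L s. \<exists>i\<in>I. \<exists>x\<in>car (D i) s. c i s x = y) \<and>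
     (\<forall>s. \<forall>i\<in>I. \<forall>x\<in>car (D i) s. \<forall>y\<in>car (D i) s. c i s x = c i s y \<longrightarrow>
        (\<exists>j. (i, j) \<in> le \<and> d i j s x = d i j s y)) \<and>
     (\<forall>f\<in>funs \<Sigma>. \<forall>i\<in>I. \<forall>a\<in>tuples (D i) (fdom \<Sigma> f). fint L f (map_tuple (fdom \<Sigma> f) (c i) a) \<noteq> None \<longrightarrow>
        (\<exists>j. (i, j) \<in> le \<and> fint (D j) f (map_tuple (fdom \<Sigma> f) (d i j) a) \<noteq> None)) \<and>
     (\<forall>R\<in>rels \<Sigma>. \<forall>i\<in>I. \<forall>a\<in>tuples (D i) (rdom \<Sigma> R). map_tuple (rdom \<Sigma> R) (c i) a \<in> rint L R \<longrightarrow>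
        (\<exists>j. (i, j) \<in> le \<and> map_tuple (rdom \<Sigma> R) (d i j) a \<in> rint (D j) R))"

text \<open>Each coordinate is identified at its own stage, and fewer than \<open>lam\<close> stages
  have an upper bound. The map \<open>ci\<close> is left arbitrary because the lemma is already
  needed while the colimit is being constructed.\<close>

lemma tuple_eq:
  fixes ci :: "('s, 'u) hom"
  assumes eq: "\<And>s x y. x \<in> car (D i) s \<Longrightarrow> y \<in> car (D i) s \<Longrightarrow> ci s x = ci s y \<Longrightarrow>
        \<exists>j. (i, j) \<in> le \<and> d i j s x = d i j s y"
    and i: "i \<in> I" and a: "a \<in> tuples (D i) t" and b: "b \<in> tuples (D i) t"
    and ab: "map_tuple t ci a = map_tuple t ci b"
  shows "\<exists>j. (i, j) \<in> le \<and> map_tuple t (d i j) a = map_tuple t (d i j) b"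
proof -
  have "\<exists>j. (i, j) \<in> le \<and> d i j (snd t n) (a n) = d i j (snd t n) (b n)" if "n < fst t" for n
    using ab that by (intro eq tuples_mem[OF a] tuples_mem[OF b]) (auto simp: map_tuple_eq_iff)
  then obtain j where j: "\<And>n. n < fst t \<Longrightarrow> (i, j n) \<in> le"
    "\<And>n. n < fst t \<Longrightarrow> d i (j n) (snd t n) (a n) = d i (j n) (snd t n) (b n)"
    by metis
  obtain u where u: "u \<in> I" "(i, u) \<in> le" "\<And>n. n < fst t \<Longrightarrow> (j n, u) \<in> le"
    using ub_fun[of "fst t" j i] j(1) le_mem i by blast
  have "d i u (snd t n) (a n) = d i u (snd t n) (b n)" if n: "n < fst t" for n
    using j(2)[OF n] d_comp[OF j(1)[OF n] u(3)[OF n] tuples_mem[OF a n]]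
      d_comp[OF j(1)[OF n] u(3)[OF n] tuples_mem[OF b n]] by simp
  then show ?thesis using u(2) by (auto simp: map_tuple_eq_iff)
qed

section \<open>Evaluation and truth in a concrete colimit\<close>

context
  fixes L :: "('s, 'f, 'r, 'k, 'u) pstructure" and c :: "'i \<Rightarrow> ('s, 'u) hom"
  assumes conc: "concrete_cocone L c"
begin

lemma conc_structure: "is_structure \<Sigma> L"
  and conc_hom: "i \<in> I \<Longrightarrow> c i \<in> homs \<Sigma> (D i) L"
  and conc_compat: "(i, j) \<in> le \<Longrightarrow> x \<in> car (D i) s \<Longrightarrow> c j s (d i j s x) = c i s x"
  and conc_surj: "y \<in> car L s \<Longrightarrow> \<exists>i\<in>I. \<exists>x\<in>car (D i) s. c i s x = y"
  and conc_eq: "i \<in> I \<Longrightarrow> x \<in> car (D i) s \<Longrightarrow> y \<in> car (D i) s \<Longrightarrow> c i s x = c i s y \<Longrightarrow>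
        \<exists>j. (i, j) \<in> le \<and> d i j s x = d i j s y"
  and conc_fun: "f \<in> funs \<Sigma> \<Longrightarrow> i \<in> I \<Longrightarrow> a \<in> tuples (D i) (fdom \<Sigma> f) \<Longrightarrow>
        fint L f (map_tuple (fdom \<Sigma> f) (c i) a) \<noteq> None \<Longrightarrow>
        \<exists>j. (i, j) \<in> le \<and> fint (D j) f (map_tuple (fdom \<Sigma> f) (d i j) a) \<noteq> None"
  and conc_rel: "R \<in> rels \<Sigma> \<Longrightarrow> i \<in> I \<Longrightarrow> a \<in> tuples (D i) (rdom \<Sigma> R) \<Longrightarrow>
        map_tuple (rdom \<Sigma> R) (c i) a \<in> rint L R \<Longrightarrow>
        \<exists>j. (i, j) \<in> le \<and> map_tuple (rdom \<Sigma> R) (d i j) a \<in> rint (D j) R"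
  using conc unfolding concrete_cocone_def by blast+

lemma conc_tuple_compat:
  "(i, j) \<in> le \<Longrightarrow> a \<in> tuples (D i) t \<Longrightarrow> map_tuple t (c j) (map_tuple t (d i j) a) = map_tuple t (c i) a"
  by (auto simp: map_tuple_def fun_eq_iff conc_compat tuples_mem)

lemma conc_tuple_surj:
  assumes m: "m \<in> tuples L t"
  obtains i a where "i \<in> I" "a \<in> tuples (D i) t" "map_tuple t (c i) a = m"
proof -
  have "\<forall>n\<in>{..<fst t}. \<exists>p. fst p \<in> I \<and> snd p \<in> car (D (fst p)) (snd t n) \<and>
      c (fst p) (snd t n) (snd p) = m n"
  proof
    fix n assume "n \<in> {..<fst t}"
    then have "m n \<in> car L (snd t n)" using tuples_mem[OF m] by simp
    from conc_surj[OF this] obtain i y where "i \<in> I" "y \<in> car (D i) (snd t n)" "c i (snd t n) y = m n"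
      by blast
    then show "\<exists>p. fst p \<in> I \<and> snd p \<in> car (D (fst p)) (snd t n) \<and> c (fst p) (snd t n) (snd p) = m n"
      by (intro exI[of _ "(i, y)"]) simp
  qed
  from bchoice[OF this] obtain p where p: "\<forall>n\<in>{..<fst t}. fst (p n) \<in> I \<and>
      snd (p n) \<in> car (D (fst (p n))) (snd t n) \<and> c (fst (p n)) (snd t n) (snd (p n)) = m n" ..
  define j x where "j n = fst (p n)" and "x n = snd (p n)" for n
  have jx: "j n \<in> I" "x n \<in> car (D (j n)) (snd t n)" "c (j n) (snd t n) (x n) = m n" if "n < fst t" for n
    using p that by (auto simp: j_def x_def)
  \<comment> \<open>Directedness for the empty set gives a stage even when the tuple is
    empty.\<close>
  obtain i0 where i0: "i0 \<in> I" using ub[of "{}"] lam_finite[of "{}"] by auto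
  obtain u where u: "u \<in> I" and "(i0, u) \<in> le" and u2: "\<And>n. n < fst t \<Longrightarrow> (j n, u) \<in> le"
    using ub_fun[of "fst t" j i0, OF jx(1) i0] by blast
  define a where "a = (\<lambda>n\<in>{..<fst t}. d (j n) u (snd t n) (x n))"
  have a: "a \<in> tuples (D u) t"
    by (rule tuplesI) (use d_mem[OF u2 jx(2)] in \<open>auto simp: a_def\<close>)
  have "map_tuple t (c u) a = m"
    by (rule tuples_eqI[OF map_tuple_mem[OF conc_hom[OF u] a] m])
      (use conc_compat[OF u2 jx(2)] jx(3) in \<open>simp add: map_tuple_def a_def\<close>)
  then show thesis using that u a by blast
qed

lemma push_compat:
  assumes "(i, j) \<in> le" "wf_asg (D i) V e" "v \<in> V"
  shows "push (c j) (push (d i j) e) v = push (c i) e v"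
  using assms by (simp add: push_def conc_compat wf_asg_def)

lemma push_d_comp:
  assumes "(i, j) \<in> le" "(j, k) \<in> le" "wf_asg (D i) V e" "v \<in> V"
  shows "push (d j k) (push (d i j) e) v = push (d i k) e v"
  using assms by (simp add: push_def d_comp wf_asg_def)

lemma eval_persist:
  assumes "(i, j) \<in> le" "(j, k) \<in> le" "is_term \<Sigma> V \<tau> s" "wf_asg (D i) V e"
    "eval \<Sigma> (D j) (push (d i j) e) \<tau> = Some x"
  shows "eval \<Sigma> (D k) (push (d i k) e) \<tau> = Some (d j k s x)"
  using eval_hom[OF d_hom[OF assms(2)] assms(3,5)]
    eval_cong[where M = "D k", OF assms(3) push_d_comp[OF assms(1,2,4)]] by simp

lemma holds_persist:
  assumes "(i, j) \<in> le" "(j, k) \<in> le" "is_formula \<Sigma> V \<phi>" "wf_asg (D i) V e"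
    "holds \<Sigma> (D j) (push (d i j) e) \<phi>"
  shows "holds \<Sigma> (D k) (push (d i k) e) \<phi>"
  using holds_hom[OF d_hom[OF assms(2)] assms(3,5)]
    holds_cong[where M = "D k", OF assms(3) push_d_comp[OF assms(1,2,4)]] by simp

lemma eval_stage:
  assumes "(i, j) \<in> le" "is_term \<Sigma> V \<tau> s" "wf_asg (D i) V e"
    "eval \<Sigma> (D j) (push (d i j) e) \<tau> = Some x"
  shows "eval \<Sigma> L (push (c i) e) \<tau> = Some (c j s x)"
  using eval_hom[OF conc_hom assms(2,4)] le_mem[OF assms(1)]
    eval_cong[where M = L, OF assms(2) push_compat[OF assms(1,3)]] by simp

text \<open>Merges the stages at which the single terms become defined into one stage
  \<open>u\<close>; it serves function symbols and relation symbols alike.\<close>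

lemma tuple_reflect:
  assumes i: "i \<in> I" and e: "wf_asg (D i) V e"
    and t: "\<And>n. n < fst t \<Longrightarrow> is_term \<Sigma> V (\<tau> n) (snd t n)"
    and j: "\<And>n. n < fst t \<Longrightarrow> \<exists>j x. (i, j) \<in> le \<and> eval \<Sigma> (D j) (push (d i j) e) (\<tau> n) = Some x"
  obtains u a where "(i, u) \<in> le" "a \<in> tuples (D u) t"
    "\<And>n. n < fst t \<Longrightarrow> eval \<Sigma> (D u) (push (d i u) e) (\<tau> n) = Some (a n)"
    "(\<lambda>n\<in>{..<fst t}. the (eval \<Sigma> L (push (c i) e) (\<tau> n))) = map_tuple t (c u) a"
proof -
  obtain j x where jx: "\<And>n. n < fst t \<Longrightarrow> (i, j n) \<in> le"
    "\<And>n. n < fst t \<Longrightarrow> eval \<Sigma> (D (j n)) (push (d i (j n)) e) (\<tau> n) = Some (x n)"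
    using j by metis
  obtain u where u: "u \<in> I" "(i, u) \<in> le" "\<And>n. n < fst t \<Longrightarrow> (j n, u) \<in> le"
    using ub_fun[of "fst t" j i] jx(1) le_mem i by blast
  define a where "a = (\<lambda>n\<in>{..<fst t}. d (j n) u (snd t n) (x n))"
  have ev: "eval \<Sigma> (D u) (push (d i u) e) (\<tau> n) = Some (a n)" if n: "n < fst t" for n
    using eval_persist[OF jx(1)[OF n] u(3)[OF n] t[OF n] e jx(2)[OF n]] n by (simp add: a_def)
  have a: "a \<in> tuples (D u) t"
  proof (rule tuplesI)
    show "a n \<in> car (D u) (snd t n)" if n: "n < fst t" for n
      by (rule eval_mem[OF D_structure[OF u(1)] t[OF n] wf_push[OF e d_hom[OF u(2)]] ev[OF n]])
  qed (simp add: a_def)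
  have "(\<lambda>n\<in>{..<fst t}. the (eval \<Sigma> L (push (c i) e) (\<tau> n))) = map_tuple t (c u) a"
    using eval_stage[OF u(2) t e ev] by (auto simp: map_tuple_def fun_eq_iff)
  then show thesis using that u(2) a ev by blast
qed

lemma eval_reflect:
  assumes i: "i \<in> I" and e: "wf_asg (D i) V e"
    and \<tau>: "is_term \<Sigma> V \<tau> s" and d: "eval \<Sigma> L (push (c i) e) \<tau> \<noteq> None"
  shows "\<exists>j x. (i, j) \<in> le \<and> eval \<Sigma> (D j) (push (d i j) e) \<tau> = Some x"
  using \<tau> d
proof induction
  case (1 v)
  then show ?case using le_refl[OF i] by auto
next
  case (2 f \<tau>)
  have "\<exists>j x. (i, j) \<in> le \<and> eval \<Sigma> (D j) (push (d i j) e) (\<tau> n) = Some x"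
    if "n < fst (fdom \<Sigma> f)" for n
    using 2(3)[OF that] 2(4) that by (auto split: if_splits)
  from tuple_reflect[OF i e 2(2) this]
  obtain u a where u: "(i, u) \<in> le" "a \<in> tuples (D u) (fdom \<Sigma> f)"
    "\<And>n. n < fst (fdom \<Sigma> f) \<Longrightarrow> eval \<Sigma> (D u) (push (d i u) e) (\<tau> n) = Some (a n)"
    "(\<lambda>n\<in>{..<fst (fdom \<Sigma> f)}. the (eval \<Sigma> L (push (c i) e) (\<tau> n))) = map_tuple (fdom \<Sigma> f) (c u) a"
    by blast
  have "fint L f (map_tuple (fdom \<Sigma> f) (c u) a) \<noteq> None"
    using 2(4) unfolding u(4)[symmetric] by (auto split: if_splits)
  then obtain k where k: "(u, k) \<in> le" "fint (D k) f (map_tuple (fdom \<Sigma> f) (d u k) a) \<noteq> None"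
    using conc_fun[OF 2(1) _ u(2)] le_mem[OF u(1)] by blast
  have ev: "eval \<Sigma> (D k) (push (d i k) e) (\<tau> n) = Some (d u k (snd (fdom \<Sigma> f) n) (a n))"
    if "n < fst (fdom \<Sigma> f)" for n
    by (rule eval_persist[OF u(1) k(1) 2(2)[OF that] e u(3)[OF that]])
  have "(\<lambda>n\<in>{..<fst (fdom \<Sigma> f)}. the (eval \<Sigma> (D k) (push (d i k) e) (\<tau> n))) =
      map_tuple (fdom \<Sigma> f) (d u k) a"
    using ev by (auto simp: map_tuple_def fun_eq_iff)
  then have "eval \<Sigma> (D k) (push (d i k) e) (App f \<tau>) \<noteq> None" using ev k(2) by auto
  then show ?case using le_trans[OF u(1) k(1)] by blast
qed

text \<open>Arities and conjunctions have length below \<open>lam\<close>, so the stages that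
  witness the parts of a formula always have a common upper bound, and truth persists up to
  it.\<close>

lemma holds_reflect:
  assumes i: "i \<in> I" and e: "wf_asg (D i) V e"
    and \<phi>: "is_formula \<Sigma> V \<phi>" and h: "holds \<Sigma> L (push (c i) e) \<phi>"
  shows "\<exists>j. (i, j) \<in> le \<and> holds \<Sigma> (D j) (push (d i j) e) \<phi>"
  using \<phi> h
proof induction
  case (1 R \<tau>)
  have "\<exists>j x. (i, j) \<in> le \<and> eval \<Sigma> (D j) (push (d i j) e) (\<tau> n) = Some x"
    if "n < fst (rdom \<Sigma> R)" for n
    by (rule eval_reflect[OF i e 1(2)[OF that]]) (use 1(3) that in auto)
  from tuple_reflect[OF i e 1(2) this]
  obtain u a where u: "(i, u) \<in> le" "a \<in> tuples (D u) (rdom \<Sigma> R)"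
    "\<And>n. n < fst (rdom \<Sigma> R) \<Longrightarrow> eval \<Sigma> (D u) (push (d i u) e) (\<tau> n) = Some (a n)"
    "(\<lambda>n\<in>{..<fst (rdom \<Sigma> R)}. the (eval \<Sigma> L (push (c i) e) (\<tau> n))) = map_tuple (rdom \<Sigma> R) (c u) a"
    by blast
  have "map_tuple (rdom \<Sigma> R) (c u) a \<in> rint L R"
    using 1(3) unfolding u(4)[symmetric] by simp
  then obtain k where k: "(u, k) \<in> le" "map_tuple (rdom \<Sigma> R) (d u k) a \<in> rint (D k) R"
    using conc_rel[OF 1(1) _ u(2)] le_mem[OF u(1)] by blast
  have ev: "eval \<Sigma> (D k) (push (d i k) e) (\<tau> n) = Some (d u k (snd (rdom \<Sigma> R) n) (a n))"
    if "n < fst (rdom \<Sigma> R)" for n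
    by (rule eval_persist[OF u(1) k(1) 1(2)[OF that] e u(3)[OF that]])
  have "(\<lambda>n\<in>{..<fst (rdom \<Sigma> R)}. the (eval \<Sigma> (D k) (push (d i k) e) (\<tau> n))) =
      map_tuple (rdom \<Sigma> R) (d u k) a"
    using ev by (auto simp: map_tuple_def fun_eq_iff)
  then have "holds \<Sigma> (D k) (push (d i k) e) (Rel R \<tau>)" using ev k(2) by auto
  then show ?case using le_trans[OF u(1) k(1)] by blast
next
  case (2 \<tau> s \<tau>')
  have n: "eval \<Sigma> L (push (c i) e) \<tau> \<noteq> None" "eval \<Sigma> L (push (c i) e) \<tau>' \<noteq> None"
    using 2(3) unfolding holds.simps by metis+
  obtain j x where j: "(i, j) \<in> le" "eval \<Sigma> (D j) (push (d i j) e) \<tau> = Some x"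
    using eval_reflect[OF i e 2(1) n(1)] by blast
  obtain j' x' where j': "(i, j') \<in> le" "eval \<Sigma> (D j') (push (d i j') e) \<tau>' = Some x'"
    using eval_reflect[OF i e 2(2) n(2)] by blast
  obtain u where u: "u \<in> I" "(j, u) \<in> le" "(j', u) \<in> le"
    using ub2 le_mem j(1) j'(1) by blast
  have iu: "(i, u) \<in> le" by (rule le_trans[OF j(1) u(2)])
  note x = eval_persist[OF j(1) u(2) 2(1) e j(2)]
  note x' = eval_persist[OF j'(1) u(3) 2(2) e j'(2)]
  have "c u s (d j u s x) = c u s (d j' u s x')"
    using eval_stage[OF iu 2(1) e x] eval_stage[OF iu 2(2) e x'] 2(3) by simp
  then obtain k where k: "(u, k) \<in> le" "d u k s (d j u s x) = d u k s (d j' u s x')"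
    using conc_eq[OF u(1) eval_mem[OF D_structure[OF u(1)] 2(1) wf_push[OF e d_hom[OF iu]] x]
        eval_mem[OF D_structure[OF u(1)] 2(2) wf_push[OF e d_hom[OF iu]] x']] by blast
  have "holds \<Sigma> (D k) (push (d i k) e) (Eq \<tau> \<tau>')"
    using eval_persist[OF iu k(1) 2(1) e x] eval_persist[OF iu k(1) 2(2) e x'] k(2) by simp
  then show ?case using le_trans[OF iu k(1)] by blast
next
  case 3
  then show ?case using le_refl[OF i] by auto
next
  case (4 \<alpha> \<phi>)
  have "\<exists>j. (i, j) \<in> le \<and> holds \<Sigma> (D j) (push (d i j) e) (\<phi> n)" if "n < \<alpha>" for n
    using 4(2)[OF that] 4(3) that by simp
  then obtain j where j: "\<And>n. n < \<alpha> \<Longrightarrow> (i, j n) \<in> le"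
    "\<And>n. n < \<alpha> \<Longrightarrow> holds \<Sigma> (D (j n)) (push (d i (j n)) e) (\<phi> n)"
    by metis
  obtain u where u: "u \<in> I" "(i, u) \<in> le" "\<And>n. n < \<alpha> \<Longrightarrow> (j n, u) \<in> le"
    using ub_fun[of \<alpha> j i] j(1) le_mem i by blast
  have "holds \<Sigma> (D u) (push (d i u) e) (\<phi> n)" if n: "n < \<alpha>" for n
    by (rule holds_persist[OF j(1)[OF n] u(3)[OF n] 4(1)[OF n] e j(2)[OF n]])
  then show ?case using u(2) by auto
qed

lemma interp_reflect:
  assumes \<phi>: "is_hformula \<Sigma> (x, \<phi>)" and m: "m \<in> interp \<Sigma> L (x, \<phi>)"
  obtains i a where "i \<in> I" "a \<in> interp \<Sigma> (D i) (x, \<phi>)" "map_tuple (ctx_arity x) (c i) a = m"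
proof -
  have ctx: "is_ctx \<Sigma> x" and f: "is_formula \<Sigma> (ctx_vars x) \<phi>" using \<phi> by auto
  have mt: "m \<in> tuples L (ctx_arity x)" and mh: "holds \<Sigma> L (assign x m) \<phi>" using m by auto
  obtain i a where i: "i \<in> I" and a: "a \<in> tuples (D i) (ctx_arity x)"
    and am: "map_tuple (ctx_arity x) (c i) a = m"
    using conc_tuple_surj[OF mt] by blast
  have "holds \<Sigma> L (push (c i) (assign x a)) \<phi>"
    using mh holds_cong[where M = L, OF f assign_map_tuple[OF ctx, of _ "c i" a]] unfolding am by simp
  then obtain j where j: "(i, j) \<in> le" "holds \<Sigma> (D j) (push (d i j) (assign x a)) \<phi>"
    using holds_reflect[OF i wf_assign[OF ctx a] f] by blast
  let ?b = "map_tuple (ctx_arity x) (d i j) a"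
  have "?b \<in> interp \<Sigma> (D j) (x, \<phi>)"
    using j(2) holds_cong[where M = "D j", OF f assign_map_tuple[OF ctx, of _ "d i j" a]]
      map_tuple_mem[OF d_hom[OF j(1)] a] by simp
  moreover have "map_tuple (ctx_arity x) (c j) ?b = m" using conc_tuple_compat[OF j(1) a] am by simp
  ultimately show thesis using that le_mem[OF j(1)] by blast
qed

text \<open>A tuple satisfying a premise in \<open>L\<close> comes from a tuple satisfying it at
  some stage, where the sequent is valid; the conclusion then passes along
  \<open>c i\<close>.\<close>

lemma conc_model: "is_model \<Sigma> \<S> L"
  unfolding is_model_def
proof (intro conjI conc_structure ballI)
  fix q assume q: "q \<in> \<S>"
  obtain x \<phi> \<psi> where [simp]: "q = (x, \<phi>, \<psi>)" by (cases q) auto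
  have h: "is_hformula \<Sigma> (x, \<phi>)" "is_hformula \<Sigma> (x, \<psi>)"
    using horn q by (auto simp: horn_theory_def)
  then have ctx: "is_ctx \<Sigma> x" and f: "is_formula \<Sigma> (ctx_vars x) \<psi>" by auto
  have "m \<in> interp \<Sigma> L (x, \<psi>)" if mi: "m \<in> interp \<Sigma> L (x, \<phi>)" for m
  proof -
    obtain i a where i: "i \<in> I" and "a \<in> interp \<Sigma> (D i) (x, \<phi>)"
      and m: "map_tuple (ctx_arity x) (c i) a = m"
      using interp_reflect[OF h(1) mi] by blast
    moreover have "valid \<Sigma> (D i) q" using D_model[OF i] q by (simp add: is_model_def del: valid.simps)
    ultimately have "a \<in> interp \<Sigma> (D i) (x, \<psi>)" by (simp del: interp.simps) blast
    then have a: "a \<in> tuples (D i) (ctx_arity x)" "holds \<Sigma> (D i) (assign x a) \<psi>" by auto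
    have "holds \<Sigma> L (assign x m) \<psi>"
      using holds_hom[OF conc_hom[OF i] f a(2)]
        holds_cong[where M = L, OF f assign_map_tuple[OF ctx, of _ "c i" a]] m by simp
    then show ?thesis using map_tuple_mem[OF conc_hom[OF i] a(1)] m by simp
  qed
  then show "valid \<Sigma> L q" by (simp del: interp.simps add: subset_iff)
qed

lemma conc_is_cocone: "is_cocone (PMod \<Sigma> \<S>) I le D d L c"
  unfolding is_cocone_def PMod_simps
proof (intro conjI ballI)
  show "L \<in> {M. is_model \<Sigma> \<S> M}" using conc_model by simp
  show "c i \<in> homs \<Sigma> (D i) L" if "i \<in> I" for i using conc_hom[OF that] .
  show "case p of (i, j) \<Rightarrow> comp_hom (D i) (c j) (d i j) = c i" if "p \<in> le" for p
  proof -
    obtain i j where p: "p = (i, j)" by (cases p)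
    have ij: "(i, j) \<in> le" using that p by simp
    note m = le_mem[OF ij]
    have "comp_hom (D i) (c j) (d i j) = c i"
      by (rule hom_eqI[OF comp_hom_mem[OF D_structure d_hom[OF ij] conc_hom] conc_hom])
        (use m in \<open>auto simp: compose_eq conc_compat[OF ij]\<close>)
    then show ?thesis using p by simp
  qed
qed

text \<open>The mediating map can only send \<open>c i s x\<close> to \<open>c' i s x\<close>.
  Witnesses at later stages make this independent of the representative, and allow every operation
  or relation of \<open>L\<close> to be computed at a stage.\<close>

lemma conc_is_colimit: "is_colimit (PMod \<Sigma> \<S>) I le D d L c"
  unfolding is_colimit_def
proof (intro conjI conc_is_cocone allI impI)
  fix L' c' assume cc: "is_cocone (PMod \<Sigma> \<S>) I le D d L' c'"
  have L': "is_model \<Sigma> \<S> L'" and c': "\<And>i. i \<in> I \<Longrightarrow> c' i \<in> homs \<Sigma> (D i) L'"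
    using cc by (auto simp: is_cocone_def)
  have c'd: "c' j s (d i j s x) = c' i s x" if "(i, j) \<in> le" "x \<in> car (D i) s" for i j s x
  proof -
    have "comp_hom (D i) (c' j) (d i j) = c' i"
      using cc that(1) unfolding is_cocone_def PMod_simps by blast
    then show ?thesis using that(2) by (rule comp_homD)
  qed
  have wd: "c' i s x = c' j s y"
    if xy: "i \<in> I" "j \<in> I" "x \<in> car (D i) s" "y \<in> car (D j) s" "c i s x = c j s y" for i j s x y
  proof -
    obtain u where u: "u \<in> I" "(i, u) \<in> le" "(j, u) \<in> le" using ub2[OF xy(1,2)] .
    have "c u s (d i u s x) = c u s (d j u s y)"
      using xy conc_compat[OF u(2)] conc_compat[OF u(3)] by simp
    then obtain k where k: "(u, k) \<in> le" "d u k s (d i u s x) = d u k s (d j u s y)"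
      using conc_eq[OF u(1) d_mem[OF u(2) xy(3)] d_mem[OF u(3) xy(4)]] by blast
    then have "d i k s x = d j k s y"
      unfolding d_comp[OF u(2) k(1) xy(3)] d_comp[OF u(3) k(1) xy(4)] by simp
    then show ?thesis
      using c'd[OF le_trans[OF u(2) k(1)] xy(3)] c'd[OF le_trans[OF u(3) k(1)] xy(4)] by simp
  qed
  define u where "u s = (\<lambda>y\<in>car L s. SOME z. \<exists>i\<in>I. \<exists>x\<in>car (D i) s. c i s x = y \<and> z = c' i s x)" for s
  have uc: "u s (c i s x) = c' i s x" if i: "i \<in> I" and x: "x \<in> car (D i) s" for i s x
  proof -
    have "c i s x \<in> car L s" by (rule hom_mem[OF conc_hom[OF i] x])
    moreover have "(SOME z. \<exists>j\<in>I. \<exists>y\<in>car (D j) s. c j s y = c i s x \<and> z = c' j s y) = c' i s x"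
      by (rule some_equality) (use i x wd in blast)+
    ultimately show ?thesis by (simp add: u_def)
  qed
  have uct: "map_tuple t u (map_tuple t (c i) a) = map_tuple t (c' i) a"
    if "i \<in> I" "a \<in> tuples (D i) t" for t i a
    using that by (auto simp: map_tuple_def fun_eq_iff uc tuples_mem)
  have u: "u \<in> homs \<Sigma> L L'"
  proof (rule homsI)
    fix s y assume "y \<in> car L s"
    then obtain i x where "i \<in> I" "x \<in> car (D i) s" "c i s x = y" using conc_surj by blast
    then show "u s y \<in> car L' s" using uc hom_mem[OF c'] by auto
  next
    fix f t b assume f: "f \<in> funs \<Sigma>" and b: "fint L f t = Some b"
    have "t \<in> tuples L (fdom \<Sigma> f)" using structure_fun[OF conc_structure b] by simp
    then obtain i a where i: "i \<in> I" and a: "a \<in> tuples (D i) (fdom \<Sigma> f)"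
      and t: "map_tuple (fdom \<Sigma> f) (c i) a = t"
      using conc_tuple_surj by blast
    obtain j where j: "(i, j) \<in> le" "fint (D j) f (map_tuple (fdom \<Sigma> f) (d i j) a) \<noteq> None"
      using conc_fun[OF f i a] b t by auto
    then obtain b' where b': "fint (D j) f (map_tuple (fdom \<Sigma> f) (d i j) a) = Some b'" by auto
    have jI: "j \<in> I" using le_mem[OF j(1)] by simp
    note s = structure_fun[OF D_structure[OF jI] b']
    have "b = c j (fcod \<Sigma> f) b'"
      using hom_fun[OF conc_hom[OF jI] f b'] conc_tuple_compat[OF j(1) a] t b by simp
    moreover have "map_tuple (fdom \<Sigma> f) (c j) (map_tuple (fdom \<Sigma> f) (d i j) a) = t"
      using conc_tuple_compat[OF j(1) a] t by simp
    ultimately show "fint L' f (map_tuple (fdom \<Sigma> f) u t) = Some (u (fcod \<Sigma> f) b)"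
      using hom_fun[OF c'[OF jI] f b'] s uct[OF jI] uc[OF jI] by metis
  next
    fix R t assume R: "R \<in> rels \<Sigma>" and b: "t \<in> rint L R"
    have "t \<in> tuples L (rdom \<Sigma> R)" using structure_rel[OF conc_structure b] by simp
    then obtain i a where i: "i \<in> I" and a: "a \<in> tuples (D i) (rdom \<Sigma> R)"
      and t: "map_tuple (rdom \<Sigma> R) (c i) a = t"
      using conc_tuple_surj by blast
    obtain j where j: "(i, j) \<in> le" "map_tuple (rdom \<Sigma> R) (d i j) a \<in> rint (D j) R"
      using conc_rel[OF R i a] b t by auto
    have jI: "j \<in> I" using le_mem[OF j(1)] by simp
    have "map_tuple (rdom \<Sigma> R) (c j) (map_tuple (rdom \<Sigma> R) (d i j) a) = t"
      using conc_tuple_compat[OF j(1) a] t by simp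
    then show "map_tuple (rdom \<Sigma> R) u t \<in> rint L' R"
      using hom_rel[OF c'[OF jI] R j(2)] structure_rel[OF D_structure[OF jI] j(2)] uct[OF jI] by metis
  qed (auto simp: u_def)
  have "u' = u" if u': "u' \<in> homs \<Sigma> L L'" "\<And>i. i \<in> I \<Longrightarrow> comp_hom (D i) u' (c i) = c' i" for u'
  proof (rule hom_eqI[OF u'(1) u])
    fix s y assume "y \<in> car L s"
    then obtain i x where i: "i \<in> I" "x \<in> car (D i) s" "c i s x = y" using conc_surj by blast
    then show "u' s y = u s y" using comp_homD[OF u'(2)[OF i(1)] i(2)] uc[OF i(1,2)] i(3) by simp
  qed
  moreover have "comp_hom (D i) u (c i) = c' i" if i: "i \<in> I" for i
    by (rule hom_eqI[OF comp_hom_mem[OF D_structure[OF i] conc_hom[OF i] u] c'[OF i]])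
      (simp add: compose_eq uc i)
  ultimately show "\<exists>!u. u \<in> Hom (PMod \<Sigma> \<S>) L L' \<and> (\<forall>i\<in>I. Comp (PMod \<Sigma> \<S>) (D i) u (c i) = c' i)"
    unfolding PMod_simps using u by blast
qed

end

text \<open>The quotient of the disjoint union of the stages by eventual equality. Since carriers
  lie in \<open>'u\<close>, a class is replaced by the code of a chosen representative.\<close>

lemma concrete_cocone_exists: "\<exists>L c. concrete_cocone L c"
proof -
  let ?E = "\<lambda>s. SIGMA i:I. car (D i) s"
  have "\<exists>f :: 'i \<times> 'u \<Rightarrow> 'u. inj_on f (?E s)" for s
  proof -
    have "small TYPE('u) (?E s)"
    proof (rule small_Sigma[OF I_small])
      fix i assume "i \<in> I"
      then show "small TYPE('u) (car (D i) s)"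
        using D_structure[of i] small_finite[of "{}"]
        by (cases "s \<in> sorts \<Sigma>") (auto simp: is_structure_def)
    qed
    then show ?thesis using small_code by blast
  qed
  then obtain code :: "'s \<Rightarrow> 'i \<times> 'u \<Rightarrow> 'u" where code: "\<And>s. inj_on (code s) (?E s)" by metis
  define rl where "rl s p q \<longleftrightarrow> (\<exists>k. (fst p, k) \<in> le \<and> (fst q, k) \<in> le \<and>
      d (fst p) k s (snd p) = d (fst q) k s (snd q))" for s p q
  have rl_refl: "rl s p p" if "p \<in> ?E s" for s p
    using that le_refl[of "fst p"] by (auto simp: rl_def)
  have rl_sym: "rl s p q \<Longrightarrow> rl s q p" for s p q by (auto simp: rl_def)
  have rl_trans: "rl s p r" if pq: "rl s p q" and qr: "rl s q r"
    and p: "p \<in> ?E s" and q: "q \<in> ?E s" and r: "r \<in> ?E s" for s p q r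
  proof -
    obtain k where k: "(fst p, k) \<in> le" "(fst q, k) \<in> le"
      "d (fst p) k s (snd p) = d (fst q) k s (snd q)" using pq by (auto simp: rl_def)
    obtain l where l: "(fst q, l) \<in> le" "(fst r, l) \<in> le"
      "d (fst q) l s (snd q) = d (fst r) l s (snd r)" using qr by (auto simp: rl_def)
    obtain u where u: "(k, u) \<in> le" "(l, u) \<in> le" using ub2[of k l] le_mem k l by blast
    have "d (fst p) u s (snd p) = d k u s (d (fst p) k s (snd p))"
      by (rule d_comp[symmetric, OF k(1) u(1)]) (use p in auto)
    also have "\<dots> = d (fst q) u s (snd q)"
      unfolding k(3) by (rule d_comp[OF k(2) u(1)]) (use q in auto)
    also have "\<dots> = d l u s (d (fst q) l s (snd q))"
      by (rule d_comp[symmetric, OF l(1) u(2)]) (use q in auto)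
    also have "\<dots> = d (fst r) u s (snd r)"
      unfolding l(3) by (rule d_comp[OF l(2) u(2)]) (use r in auto)
    finally show ?thesis
      using le_trans[OF k(1) u(1)] le_trans[OF l(2) u(2)] by (auto simp: rl_def)
  qed
  define rep where "rep s p = (SOME q. q \<in> ?E s \<and> rl s p q)" for s p
  have rep: "rep s p \<in> ?E s" "rl s p (rep s p)" if "p \<in> ?E s" for s p
    using someI[of "\<lambda>q. q \<in> ?E s \<and> rl s p q" p] that rl_refl[OF that] by (auto simp: rep_def)
  have rep_eq: "rep s p = rep s q \<longleftrightarrow> rl s p q" if p: "p \<in> ?E s" and q: "q \<in> ?E s" for s p q
  proof
    assume "rep s p = rep s q"
    then show "rl s p q" using rep[OF p] rep[OF q] rl_sym rl_trans p q by metis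
  next
    assume pq: "rl s p q"
    \<comment> \<open>The two predicates passed to \<open>SOME\<close> coincide, so equivalent pairs
      get the same representative and not merely equivalent ones.\<close>
    have "(r \<in> ?E s \<and> rl s p r) = (r \<in> ?E s \<and> rl s q r)" for r
      using rl_trans[OF pq _ p q] rl_trans[OF rl_sym[OF pq] _ q p] by blast
    then show "rep s p = rep s q" unfolding rep_def by simp
  qed
  define c where "c i s = (\<lambda>x\<in>car (D i) s. code s (rep s (i, x)))" for i s
  have c_eq: "c i s x = c j s y \<longleftrightarrow> rl s (i, x) (j, y)"
    if "i \<in> I" "j \<in> I" "x \<in> car (D i) s" "y \<in> car (D j) s" for i j s x y
  proof -
    have E: "(i, x) \<in> ?E s" "(j, y) \<in> ?E s" using that by auto
    have "c i s x = c j s y \<longleftrightarrow> rep s (i, x) = rep s (j, y)"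
      using inj_on_eq_iff[OF code rep(1)[OF E(1)] rep(1)[OF E(2)]] that by (simp add: c_def)
    then show ?thesis using rep_eq[OF E] by simp
  qed
  have c_compat: "c j s (d i j s x) = c i s x" if ij: "(i, j) \<in> le" and x: "x \<in> car (D i) s" for i j s x
  proof -
    have m: "i \<in> I" "j \<in> I" using le_mem[OF ij] by auto
    show ?thesis
      unfolding c_eq[OF m(2,1) d_mem[OF ij x] x] rl_def
      using ij le_refl[OF m(2)] d_refl[OF m(2) d_mem[OF ij x]] by auto
  qed
  have c_same: "\<exists>j. (i, j) \<in> le \<and> d i j s x = d i j s y"
    if "i \<in> I" "x \<in> car (D i) s" "y \<in> car (D i) s" "c i s x = c i s y" for i s x y
    using that(4) unfolding c_eq[OF that(1,1,2,3)] by (auto simp: rl_def)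
  have c_tuple: "map_tuple t (c j) (map_tuple t (d i j) a) = map_tuple t (c i) a"
    if "(i, j) \<in> le" "a \<in> tuples (D i) t" for i j t a
    using that by (auto simp: map_tuple_def fun_eq_iff c_compat tuples_mem)
  define C where "C s = {c i s x | i x. i \<in> I \<and> x \<in> car (D i) s}" for s
  \<comment> \<open>The graph of the operation on the quotient. Two computations of a value can be
    moved to a common stage, which makes it single-valued.\<close>
  define gr where "gr f t y \<longleftrightarrow> (\<exists>i\<in>I. \<exists>a b. fint (D i) f a = Some b \<and>
      t = map_tuple (fdom \<Sigma> f) (c i) a \<and> y = c i (fcod \<Sigma> f) b)" for f t y
  have meet: "\<exists>k. (i, k) \<in> le \<and> (j, k) \<in> le \<and> map_tuple t (d i k) a = map_tuple t (d j k) a'"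
    if i: "i \<in> I" and j: "j \<in> I" and a: "a \<in> tuples (D i) t" and a': "a' \<in> tuples (D j) t"
      and eq: "map_tuple t (c i) a = map_tuple t (c j) a'" for i j t a a'
  proof -
    obtain u where u: "u \<in> I" "(i, u) \<in> le" "(j, u) \<in> le" using ub2[OF i j] .
    have "map_tuple t (c u) (map_tuple t (d i u) a) = map_tuple t (c u) (map_tuple t (d j u) a')"
      using eq c_tuple[OF u(2) a] c_tuple[OF u(3) a'] by simp
    from tuple_eq[OF c_same[OF u(1)] u(1) map_tuple_mem[OF d_hom[OF u(2)] a]
        map_tuple_mem[OF d_hom[OF u(3)] a'] this]
    obtain k where k: "(u, k) \<in> le" "map_tuple t (d u k) (map_tuple t (d i u) a) =
        map_tuple t (d u k) (map_tuple t (d j u) a')" by blast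
    then have "map_tuple t (d i k) a = map_tuple t (d j k) a'"
      unfolding d_tuple_comp[OF u(2) k(1) a] d_tuple_comp[OF u(3) k(1) a'] by simp
    then show ?thesis using le_trans[OF u(2) k(1)] le_trans[OF u(3) k(1)] by blast
  qed
  have funs: "f \<in> funs \<Sigma>" "a \<in> tuples (D i) (fdom \<Sigma> f)" "b \<in> car (D i) (fcod \<Sigma> f)"
    if "i \<in> I" "fint (D i) f a = Some b" for i f a b
    using structure_fun[OF D_structure[OF that(1)] that(2)] by auto
  have gr_unique: "y = y'" if y: "gr f t y" and y': "gr f t y'" for f t y y'
  proof -
    obtain i a b where i: "i \<in> I" and b: "fint (D i) f a = Some b"
      and t: "t = map_tuple (fdom \<Sigma> f) (c i) a" and yb: "y = c i (fcod \<Sigma> f) b"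
      using y by (auto simp: gr_def)
    obtain j a' b' where j: "j \<in> I" and b': "fint (D j) f a' = Some b'"
      and t': "t = map_tuple (fdom \<Sigma> f) (c j) a'" and yb': "y' = c j (fcod \<Sigma> f) b'"
      using y' by (auto simp: gr_def)
    note F = funs[OF i b] and F' = funs[OF j b']
    obtain k where k: "(i, k) \<in> le" "(j, k) \<in> le"
      "map_tuple (fdom \<Sigma> f) (d i k) a = map_tuple (fdom \<Sigma> f) (d j k) a'"
      using meet[OF i j F(2) F'(2)] t t' by blast
    have "d i k (fcod \<Sigma> f) b = d j k (fcod \<Sigma> f) b'"
      using hom_fun[OF d_hom[OF k(1)] F(1) b] hom_fun[OF d_hom[OF k(2)] F(1) b'] k(3) by simp
    then show ?thesis unfolding yb yb' using c_compat[OF k(1) F(3)] c_compat[OF k(2) F'(3)] by simp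
  qed
  define L where "L = \<lparr>car = C, fint = (\<lambda>f t. if \<exists>y. gr f t y then Some (THE y. gr f t y) else None),
    rint = (\<lambda>R. {map_tuple (rdom \<Sigma> R) (c i) a | i a. i \<in> I \<and> a \<in> rint (D i) R})\<rparr>"
  have fL: "fint L f t = Some y \<longleftrightarrow> gr f t y" for f t y
    using gr_unique theI'[of "gr f t"] unfolding L_def by (auto intro: the_equality)
  have cC: "c i s x \<in> car L s" if "i \<in> I" "x \<in> car (D i) s" for i s x
    using that by (auto simp: L_def C_def)
  have cT: "map_tuple t (c i) a \<in> tuples L t" if "i \<in> I" "a \<in> tuples (D i) t" for t i a
    using that(2) cC[OF that(1)] by (rule map_tuple_in)
  have "is_structure \<Sigma> L"
    unfolding is_structure_def
  proof (intro conjI ballI allI impI)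
    fix s assume s: "s \<in> sorts \<Sigma>"
    have "C s = (\<lambda>(i, x). c i s x) ` ?E s" by (auto simp: C_def)
    moreover have "small TYPE('u) (?E s)"
      using D_structure s by (intro small_Sigma[OF I_small]) (auto simp: is_structure_def)
    ultimately show "small TYPE('u) (car L s)" by (simp add: L_def small_image)
  next
    fix f a b assume "f \<in> funs \<Sigma>" "fint L f a = Some b"
    then show "a \<in> tuples L (fdom \<Sigma> f)" "b \<in> car L (fcod \<Sigma> f)"
      unfolding fL gr_def using funs cT cC by blast+
  next
    fix R assume "R \<in> rels \<Sigma>"
    show "rint L R \<subseteq> tuples L (rdom \<Sigma> R)"
    proof
      fix t assume "t \<in> rint L R"
      then obtain i a where ia: "i \<in> I" "a \<in> rint (D i) R" "t = map_tuple (rdom \<Sigma> R) (c i) a"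
        by (auto simp: L_def)
      show "t \<in> tuples L (rdom \<Sigma> R)"
        unfolding ia(3) using structure_rel[OF D_structure[OF ia(1)] ia(2)] by (intro cT[OF ia(1)]) simp
    qed
  next
    fix s assume "s \<notin> sorts \<Sigma>"
    then show "car L s = {}" using D_structure unfolding L_def C_def is_structure_def by fastforce
  next
    fix f assume "f \<notin> funs \<Sigma>"
    then have "\<not> gr f t y" for t y using funs(1) by (auto simp: gr_def)
    then show "fint L f = (\<lambda>_. None)" unfolding L_def by auto
  next
    fix R assume "R \<notin> rels \<Sigma>"
    then show "rint L R = {}" using structure_rel[OF D_structure] by (auto simp: L_def)
  qed
  moreover have "c i \<in> homs \<Sigma> (D i) L" if i: "i \<in> I" for i
  proof (rule homsI)
    fix f a b assume "f \<in> funs \<Sigma>" "fint (D i) f a = Some b"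
    then show "fint L f (map_tuple (fdom \<Sigma> f) (c i) a) = Some (c i (fcod \<Sigma> f) b)"
      unfolding fL gr_def using i by blast
  next
    fix R a assume "R \<in> rels \<Sigma>" "a \<in> rint (D i) R"
    then show "map_tuple (rdom \<Sigma> R) (c i) a \<in> rint L R" using i by (auto simp: L_def)
  qed (use i cC in \<open>auto simp: c_def\<close>)
  moreover have "\<exists>i\<in>I. \<exists>x\<in>car (D i) s. c i s x = y" if "y \<in> car L s" for s y
    using that by (auto simp: L_def C_def)
  moreover have "\<exists>j. (i, j) \<in> le \<and> fint (D j) f (map_tuple (fdom \<Sigma> f) (d i j) a) \<noteq> None"
    if f: "f \<in> funs \<Sigma>" and i: "i \<in> I" and a: "a \<in> tuples (D i) (fdom \<Sigma> f)"
      and n: "fint L f (map_tuple (fdom \<Sigma> f) (c i) a) \<noteq> None" for f i a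
  proof -
    obtain y where "gr f (map_tuple (fdom \<Sigma> f) (c i) a) y" using n fL by auto
    then obtain j a' b' where j: "j \<in> I" and b': "fint (D j) f a' = Some b'"
      and t: "map_tuple (fdom \<Sigma> f) (c i) a = map_tuple (fdom \<Sigma> f) (c j) a'"
      by (auto simp: gr_def)
    obtain k where k: "(i, k) \<in> le" "(j, k) \<in> le"
      "map_tuple (fdom \<Sigma> f) (d i k) a = map_tuple (fdom \<Sigma> f) (d j k) a'"
      using meet[OF i j a funs(2)[OF j b'] t] by blast
    show ?thesis using hom_fun[OF d_hom[OF k(2)] f b'] k by auto
  qed
  moreover have "\<exists>j. (i, j) \<in> le \<and> map_tuple (rdom \<Sigma> R) (d i j) a \<in> rint (D j) R"
    if R: "R \<in> rels \<Sigma>" and i: "i \<in> I" and a: "a \<in> tuples (D i) (rdom \<Sigma> R)"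
      and n: "map_tuple (rdom \<Sigma> R) (c i) a \<in> rint L R" for R i a
  proof -
    obtain j a' where j: "j \<in> I" and b': "a' \<in> rint (D j) R"
      and t: "map_tuple (rdom \<Sigma> R) (c i) a = map_tuple (rdom \<Sigma> R) (c j) a'"
      using n by (auto simp: L_def)
    have a': "a' \<in> tuples (D j) (rdom \<Sigma> R)" using structure_rel[OF D_structure[OF j] b'] by simp
    obtain k where k: "(i, k) \<in> le" "(j, k) \<in> le"
      "map_tuple (rdom \<Sigma> R) (d i k) a = map_tuple (rdom \<Sigma> R) (d j k) a'"
      using meet[OF i j a a' t] by blast
    show ?thesis using hom_rel[OF d_hom[OF k(2)] R b'] k by auto
  qed
  ultimately have "concrete_cocone L c"
    unfolding concrete_cocone_def using c_compat c_same by blast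
  then show ?thesis by blast
qed

text \<open>\<open>presentable\<close> quantifies over all colimits, so the description is carried
  over from the constructed colimit \<open>C\<close> along the canonical maps between
  \<open>C\<close> and \<open>L\<close>.\<close>

lemma colimit_concrete:
  assumes L: "is_colimit (PMod \<Sigma> \<S>) I le D d L c"
  shows "concrete_cocone L c"
proof -
  obtain C k where C: "concrete_cocone C k" using concrete_cocone_exists by blast
  note Ccol = conc_is_colimit[OF C]
  have Lm: "is_model \<Sigma> \<S> L" and c: "\<And>i. i \<in> I \<Longrightarrow> c i \<in> homs \<Sigma> (D i) L"
    using L by (auto simp: is_colimit_def is_cocone_def)
  have Ls: "is_structure \<Sigma> L" using Lm by (simp add: is_model_def)
  have cd: "c j s (d i j s x) = c i s x" if "(i, j) \<in> le" "x \<in> car (D i) s" for i j s x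
  proof -
    have "comp_hom (D i) (c j) (d i j) = c i"
      using colimit_cocone[OF L] that(1) unfolding is_cocone_def PMod_simps by blast
    then show ?thesis using that(2) by (rule comp_homD)
  qed
  obtain u where u: "u \<in> homs \<Sigma> C L" "\<And>i. i \<in> I \<Longrightarrow> comp_hom (D i) u (k i) = c i"
    using colimit_unique_map[OF Ccol colimit_cocone[OF L]] unfolding PMod_simps by blast
  obtain v where v: "v \<in> homs \<Sigma> L C" "\<And>i. i \<in> I \<Longrightarrow> comp_hom (D i) v (c i) = k i"
    using colimit_unique_map[OF L colimit_cocone[OF Ccol]] unfolding PMod_simps by blast
  have ux: "u s (k i s x) = c i s x" if "i \<in> I" "x \<in> car (D i) s" for i s x
    by (rule comp_homD[OF u(2)[OF that(1)] that(2)])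
  have vx: "v s (c i s x) = k i s x" if "i \<in> I" "x \<in> car (D i) s" for i s x
    by (rule comp_homD[OF v(2)[OF that(1)] that(2)])
  have vt: "map_tuple t v (map_tuple t (c i) a) = map_tuple t (k i) a"
    if "i \<in> I" "a \<in> tuples (D i) t" for i t a
    using that by (auto simp: map_tuple_def fun_eq_iff vx tuples_mem)
  define id where "id s = (\<lambda>a\<in>car L s. a)" for s
  have id: "id \<in> homs \<Sigma> L L" unfolding id_def[abs_def] by (rule id_hom[OF Ls])
  have uv: "comp_hom L u v \<in> homs \<Sigma> L L" by (rule comp_hom_mem[OF Ls v(1) u(1)])
  have "comp_hom (D i) (comp_hom L u v) (c i) = c i" if i: "i \<in> I" for i
    by (rule hom_eqI[OF comp_hom_mem[OF D_structure[OF i] c[OF i] uv] c[OF i]])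
      (use i in \<open>simp add: compose_eq hom_mem[OF c[OF i]] vx ux\<close>)
  moreover have "comp_hom (D i) id (c i) = c i" if i: "i \<in> I" for i
    by (rule hom_eqI[OF comp_hom_mem[OF D_structure[OF i] c[OF i] id] c[OF i]])
      (use i in \<open>simp add: compose_eq hom_mem[OF c[OF i]] id_def\<close>)
  ultimately have eq: "comp_hom L u v = id"
    using colimit_unique_map[OF L colimit_cocone[OF L]] uv id unfolding PMod_simps by blast
  have uvx: "u s (v s y) = y" if "y \<in> car L s" for s y
    using comp_homD[OF eq that] that by (simp add: id_def)
  show ?thesis
    unfolding concrete_cocone_def
  proof (intro conjI allI ballI impI Ls c)
    fix i j s x assume "(i, j) \<in> le \<and> x \<in> car (D i) s"
    then show "c j s (d i j s x) = c i s x" using cd by blast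
  next
    fix s y assume y: "y \<in> car L s"
    obtain i x where i: "i \<in> I" "x \<in> car (D i) s" "k i s x = v s y"
      using conc_surj[OF C hom_mem[OF v(1) y]] by blast
    then have "c i s x = y" using ux[OF i(1,2)] uvx[OF y] by simp
    then show "\<exists>i\<in>I. \<exists>x\<in>car (D i) s. c i s x = y" using i by blast
  next
    fix s i x y assume i: "i \<in> I" and x: "x \<in> car (D i) s" and y: "y \<in> car (D i) s" and "c i s x = c i s y"
    then have "k i s x = k i s y" using vx[OF i x] vx[OF i y] by simp
    then show "\<exists>j. (i, j) \<in> le \<and> d i j s x = d i j s y" by (rule conc_eq[OF C i x y])
  next
    fix f i a assume f: "f \<in> funs \<Sigma>" and i: "i \<in> I" and a: "a \<in> tuples (D i) (fdom \<Sigma> f)"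
      and "fint L f (map_tuple (fdom \<Sigma> f) (c i) a) \<noteq> None"
    then obtain b where b: "fint L f (map_tuple (fdom \<Sigma> f) (c i) a) = Some b" by auto
    show "\<exists>j. (i, j) \<in> le \<and> fint (D j) f (map_tuple (fdom \<Sigma> f) (d i j) a) \<noteq> None"
      by (rule conc_fun[OF C f i a]) (use hom_fun[OF v(1) f b] vt[OF i a] in simp)
  next
    fix R i a assume R: "R \<in> rels \<Sigma>" and i: "i \<in> I" and a: "a \<in> tuples (D i) (rdom \<Sigma> R)"
      and b: "map_tuple (rdom \<Sigma> R) (c i) a \<in> rint L R"
    show "\<exists>j. (i, j) \<in> le \<and> map_tuple (rdom \<Sigma> R) (d i j) a \<in> rint (D j) R"
      by (rule conc_rel[OF C R i a]) (use hom_rel[OF v(1) R b] vt[OF i a] in simp)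
  qed
qed

text \<open>\<open>presentable\<close> speaks only of diagrams indexed by subsets of
  \<open>'u\<close>. The index set is therefore transported along an injection, and cocones and the
  colimit are reindexed with it.\<close>

lemma presentable_factor:
  assumes \<Gamma>: "presentable TYPE('u) (lam :: 'k rel) (PMod \<Sigma> \<S>) \<Gamma>"
    and L: "is_colimit (PMod \<Sigma> \<S>) I le D d L c" and f: "f \<in> homs \<Sigma> \<Gamma> L"
  obtains i g where "i \<in> I" "g \<in> homs \<Sigma> \<Gamma> (D i)" "comp_hom \<Gamma> (c i) g = f"
proof -
  obtain e :: "'i \<Rightarrow> 'u" where e: "inj_on e I" using small_code[OF I_small] .
  define J where "J = e ` I"
  define v where "v = inv_into I e"
  have ve: "v (e i) = i" if "i \<in> I" for i using that e by (simp add: v_def)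
  have vJ: "v j \<in> I" "e (v j) = j" if "j \<in> J" for j
    using that by (auto simp: J_def ve)
  have eJ: "e i \<in> J" if "i \<in> I" for i using that by (simp add: J_def)
  define le' where "le' = {(j, k). j \<in> J \<and> k \<in> J \<and> (v j, v k) \<in> le}"
  have "small TYPE('u) J" unfolding J_def by (rule small_image[OF I_small])
  moreover have "directed_poset (lam :: 'k rel) J le'"
    unfolding directed_poset_def partial_order_on_def preorder_on_def
  proof (intro conjI allI impI)
    show "refl_on J le'" "le' \<subseteq> J \<times> J"
      using vJ le_refl by (auto simp: le'_def refl_on_def)
    show "trans le'" using le_trans by (auto simp: le'_def trans_def)
    have "antisym le" using dir by (auto simp: directed_poset_def partial_order_on_def)
    then show "antisym le'" using vJ unfolding antisym_def le'_def by (metis (no_types, lifting) case_prodD mem_Collect_eq)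
    fix K assume K: "K \<subseteq> J" "|K| <o (lam :: 'k rel)"
    have "v ` K \<subseteq> I" using K(1) vJ by auto
    then obtain u where u: "u \<in> I" "\<forall>j\<in>v ` K. (j, u) \<in> le" using ub[OF _ lam_image[OF K(2)]] by blast
    then show "\<exists>u\<in>J. \<forall>j\<in>K. (j, u) \<in> le'"
      using K(1) by (intro bexI[of _ "e u"]) (auto simp: le'_def ve eJ)
  qed
  moreover have "is_diagram (PMod \<Sigma> \<S>) J le' (\<lambda>j. D (v j)) (\<lambda>j k. d (v j) (v k))"
    using diag vJ(1) unfolding is_diagram_def le'_def by blast
  moreover have cocone: "is_cocone (PMod \<Sigma> \<S>) J le' (\<lambda>j. D (v j)) (\<lambda>j k. d (v j) (v k)) L' (\<lambda>j. c' (v j))"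
    if "is_cocone (PMod \<Sigma> \<S>) I le D d L' c'" for L' c'
    using that vJ(1) unfolding is_cocone_def le'_def by blast
  moreover have "is_colimit (PMod \<Sigma> \<S>) J le' (\<lambda>j. D (v j)) (\<lambda>j k. d (v j) (v k)) L (\<lambda>j. c (v j))"
    unfolding is_colimit_def
  proof (intro conjI allI impI)
    show "is_cocone (PMod \<Sigma> \<S>) J le' (\<lambda>j. D (v j)) (\<lambda>j k. d (v j) (v k)) L (\<lambda>j. c (v j))"
      by (rule cocone[OF colimit_cocone[OF L]])
    fix L' c' assume cc: "is_cocone (PMod \<Sigma> \<S>) J le' (\<lambda>j. D (v j)) (\<lambda>j k. d (v j) (v k)) L' c'"
    have "is_cocone (PMod \<Sigma> \<S>) I le D d L' (\<lambda>i. c' (e i))"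
      unfolding is_cocone_def
    proof (intro conjI ballI)
      show "L' \<in> Ob (PMod \<Sigma> \<S>)" using cc by (simp add: is_cocone_def)
      show "c' (e i) \<in> Hom (PMod \<Sigma> \<S>) (D i) L'" if "i \<in> I" for i
        using cc eJ[OF that] unfolding is_cocone_def by (metis ve[OF that])
      fix p assume p: "p \<in> le"
      obtain i j where ij: "p = (i, j)" by (cases p)
      have m: "i \<in> I" "j \<in> I" using le_mem p ij by auto
      have "(e i, e j) \<in> le'" using m p ij by (simp add: le'_def eJ ve)
      then have "Comp (PMod \<Sigma> \<S>) (D (v (e i))) (c' (e j)) (d (v (e i)) (v (e j))) = c' (e i)"
        using cc unfolding is_cocone_def by blast
      then show "case p of (i, j) \<Rightarrow> Comp (PMod \<Sigma> \<S>) (D i) (c' (e j)) (d i j) = c' (e i)"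
        unfolding ij ve[OF m(1)] ve[OF m(2)] by simp
    qed
    note un = colimit_unique_map[OF L this]
    have "(\<forall>i\<in>I. Comp (PMod \<Sigma> \<S>) (D i) u (c i) = c' (e i)) \<longleftrightarrow>
        (\<forall>j\<in>J. Comp (PMod \<Sigma> \<S>) (D (v j)) u (c (v j)) = c' j)" for u
      unfolding J_def by (simp add: ve del: PMod_simps)
    with un show "\<exists>!u. u \<in> Hom (PMod \<Sigma> \<S>) L L' \<and> (\<forall>j\<in>J. Comp (PMod \<Sigma> \<S>) (D (v j)) u (c (v j)) = c' j)"
      by (simp only:)
  qed
  ultimately have "\<exists>j\<in>J. \<exists>g\<in>Hom (PMod \<Sigma> \<S>) \<Gamma> (D (v j)). Comp (PMod \<Sigma> \<S>) \<Gamma> (c (v j)) g = f"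
    using \<Gamma> f unfolding presentable_def PMod_simps(1) by blast
  then show thesis using that vJ(1) unfolding PMod_simps by blast
qed

end


section \<open>Presented models\<close>

context horn_setting
begin

text \<open>Terms in the context, evaluated at once in all models at all tuples satisfying the
  formula, form the generic model. Its projections are the required homomorphisms, and they are
  unique because the tuple \<open>\<gamma>\<close> generates it.\<close>

lemma presented_model:
  assumes \<phi>: "is_hformula \<Sigma> (x, \<phi>)"
  obtains \<Gamma> \<gamma> where "is_model \<Sigma> \<S> (\<Gamma> :: ('s, 'f, 'r, 'k, 'u) pstructure)" "\<gamma> \<in> interp \<Sigma> \<Gamma> (x, \<phi>)"
    "\<And>M m. is_model \<Sigma> \<S> M \<Longrightarrow> m \<in> interp \<Sigma> M (x, \<phi>) \<Longrightarrow>
       \<exists>h\<in>homs \<Sigma> \<Gamma> M. map_tuple (ctx_arity x) h \<gamma> = m"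
    "\<And>M h h'. h \<in> homs \<Sigma> \<Gamma> M \<Longrightarrow> h' \<in> homs \<Sigma> \<Gamma> M \<Longrightarrow>
       map_tuple (ctx_arity x) h \<gamma> = map_tuple (ctx_arity x) h' \<gamma> \<Longrightarrow> h = h'"
proof -
  have ctx: "is_ctx \<Sigma> x" and f: "is_formula \<Sigma> (ctx_vars x) \<phi>" using \<phi> by auto
  define \<K> :: "(('s, 'f, 'r, 'k, 'u) pstructure \<times> (('s, 'k) var \<Rightarrow> 'u)) set"
    where "\<K> = {(M, assign x m) | M m. is_model \<Sigma> \<S> M \<and> m \<in> interp \<Sigma> M (x, \<phi>)}"
  have V: "fst v \<in> sorts \<Sigma>" if "v \<in> ctx_vars x" for v
    using that ctx by (auto simp: ctx_vars_def is_ctx_def)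
  have \<K>: "is_structure \<Sigma> (fst p) \<and> wf_asg (fst p) (ctx_vars x) (snd p)" if "p \<in> \<K>" for p
    using that by (auto simp: \<K>_def is_model_def intro: wf_assign[OF ctx])
  obtain P \<pi> g where P: "jemb \<Sigma> \<K> fst P \<pi>" and gen: "generated \<Sigma> (ctx_vars x) P g"
    and \<pi>: "\<And>p v. p \<in> \<K> \<Longrightarrow> v \<in> ctx_vars x \<Longrightarrow> push (\<pi> p) g v = snd p v"
    using term_model[OF V \<K>] by blast
  have wg: "wf_asg P (ctx_vars x) g" using gen by (simp add: generated_def)
  define \<gamma> where "\<gamma> = unassign x g"
  have \<gamma>: "\<gamma> \<in> tuples P (ctx_arity x)" unfolding \<gamma>_def by (rule unassign_mem[OF wg])
  have \<gamma>i: "map_tuple (ctx_arity x) h \<gamma> i = h (fst (snd x i)) (g (snd x i))" if "i < fst x" for h i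
    using that by (simp add: map_tuple_def ctx_arity_def \<gamma>_def unassign_def)
  show thesis
  proof (rule that)
    show "is_model \<Sigma> \<S> P" by (rule jemb_model[OF P]) (auto simp: \<K>_def)
    have "holds \<Sigma> P g \<phi>"
    proof (rule jemb_holds[OF P f wg])
      fix p assume p: "p \<in> \<K>"
      then have "holds \<Sigma> (fst p) (snd p) \<phi>" by (auto simp: \<K>_def)
      then show "holds \<Sigma> (fst p) (push (\<pi> p) g) \<phi>"
        using holds_cong[where M = "fst p", OF f \<pi>[OF p]] by simp
    qed
    then show "\<gamma> \<in> interp \<Sigma> P (x, \<phi>)" unfolding \<gamma>_def using interp_iff[OF \<phi> wg] by simp
  next
    fix M :: "('s, 'f, 'r, 'k, 'u) pstructure" and m assume M: "is_model \<Sigma> \<S> M" and m: "m \<in> interp \<Sigma> M (x, \<phi>)"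
    then have p: "(M, assign x m) \<in> \<K>" by (auto simp: \<K>_def)
    have h: "\<pi> (M, assign x m) \<in> homs \<Sigma> P M" using jemb_hom[OF P p] by simp
    have mt: "m \<in> tuples M (ctx_arity x)" using m by simp
    have "map_tuple (ctx_arity x) (\<pi> (M, assign x m)) \<gamma> = m"
    proof (rule tuples_eqI[OF map_tuple_mem[OF h \<gamma>] mt])
      fix i assume "i < fst (ctx_arity x)"
      then have i: "i < fst x" by (simp add: ctx_arity_def)
      then have "snd x i \<in> ctx_vars x" by (simp add: ctx_vars_def)
      then show "map_tuple (ctx_arity x) (\<pi> (M, assign x m)) \<gamma> i = m i"
        using \<pi>[OF p, of "snd x i"] \<gamma>i[OF i] assign_var[OF ctx i] by (simp add: push_def)
    qed
    then show "\<exists>h\<in>homs \<Sigma> P M. map_tuple (ctx_arity x) h \<gamma> = m" using h by blast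
  next
    fix M :: "('s, 'f, 'r, 'k, 'u) pstructure" and h h'
    assume h: "h \<in> homs \<Sigma> P M" "h' \<in> homs \<Sigma> P M"
      and eq: "map_tuple (ctx_arity x) h \<gamma> = map_tuple (ctx_arity x) h' \<gamma>"
    show "h = h'"
    proof (rule generated_hom_unique[OF gen h])
      fix v assume "v \<in> ctx_vars x"
      then obtain i where i: "i < fst x" "v = snd x i" by (rule ctx_vars_cases)
      then show "h (fst v) (g v) = h' (fst v) (g v)"
        using fun_cong[OF eq, of i] \<gamma>i[OF i(1)] by simp
    qed
  qed
qed

text \<open>By \<open>ex\<close> and \<open>un\<close>, homomorphisms out of \<open>\<Gamma>\<close>
  correspond to tuples satisfying the formula. Preservation of directed colimits thus reduces to
  \<open>interp_reflect\<close> for surjectivity and to \<open>tuple_eq\<close> for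
  injectivity.\<close>

lemma presented_presentable:
  fixes \<Gamma> :: "('s, 'f, 'r, 'k, 'u) pstructure"
  assumes \<phi>: "is_hformula \<Sigma> (x, \<phi>)"
    and \<Gamma>: "is_model \<Sigma> \<S> \<Gamma>" "\<gamma> \<in> interp \<Sigma> \<Gamma> (x, \<phi>)"
    and ex: "\<And>M m. is_model \<Sigma> \<S> M \<Longrightarrow> m \<in> interp \<Sigma> M (x, \<phi>) \<Longrightarrow>
       \<exists>h\<in>homs \<Sigma> \<Gamma> M. map_tuple (ctx_arity x) h \<gamma> = m"
    and un: "\<And>M h h'. h \<in> homs \<Sigma> \<Gamma> M \<Longrightarrow> h' \<in> homs \<Sigma> \<Gamma> M \<Longrightarrow>
       map_tuple (ctx_arity x) h \<gamma> = map_tuple (ctx_arity x) h' \<gamma> \<Longrightarrow> h = h'"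
  shows "presentable TYPE('u) (lam :: 'k rel) (PMod \<Sigma> \<S>) \<Gamma>"
  unfolding presentable_def PMod_simps
proof (intro conjI allI impI)
  show "\<Gamma> \<in> {M. is_model \<Sigma> \<S> M}" using \<Gamma> by simp
  have \<Gamma>s: "is_structure \<Sigma> \<Gamma>" using \<Gamma>(1) by (simp add: is_model_def)
  have ctx: "is_ctx \<Sigma> x" and f: "is_formula \<Sigma> (ctx_vars x) \<phi>" using \<phi> by auto
  have \<gamma>t: "\<gamma> \<in> tuples \<Gamma> (ctx_arity x)" using \<Gamma>(2) by simp
  fix I :: "'u set" and le d L c and D :: "'u \<Rightarrow> ('s, 'f, 'r, 'k, 'u) pstructure"
  assume A: "small TYPE('u) I \<and> directed_poset (lam :: 'k rel) I le \<and> is_diagram (PMod \<Sigma> \<S>) I le D d \<and>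
    is_colimit (PMod \<Sigma> \<S>) I le D d L c"
  then interpret directed_diagram U K \<Sigma> \<S> I le D d by unfold_locales auto
  have conc: "concrete_cocone L c" using A colimit_concrete by blast
  note c = conc_hom[OF conc]
  have ct: "map_tuple (ctx_arity x) (comp_hom \<Gamma> k g) \<gamma> = map_tuple (ctx_arity x) k (map_tuple (ctx_arity x) g \<gamma>)"
    for k g by (rule map_tuple_compose[OF \<gamma>t])
  show "\<forall>f\<in>homs \<Sigma> \<Gamma> L. \<exists>i\<in>I. \<exists>g\<in>homs \<Sigma> \<Gamma> (D i). comp_hom \<Gamma> (c i) g = f"
  proof
    fix h assume h: "h \<in> homs \<Sigma> \<Gamma> L"
    have "holds \<Sigma> L (push h (assign x \<gamma>)) \<phi>" by (rule holds_hom[OF h f]) (use \<Gamma>(2) in simp)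
    then have hg: "map_tuple (ctx_arity x) h \<gamma> \<in> interp \<Sigma> L (x, \<phi>)"
      using holds_cong[where M = L, OF f assign_map_tuple[OF ctx, of _ h \<gamma>]] map_tuple_mem[OF h \<gamma>t] by simp
    obtain i a where i: "i \<in> I" "a \<in> interp \<Sigma> (D i) (x, \<phi>)"
      "map_tuple (ctx_arity x) (c i) a = map_tuple (ctx_arity x) h \<gamma>"
      by (rule interp_reflect[OF conc \<phi> hg])
    obtain g where g: "g \<in> homs \<Sigma> \<Gamma> (D i)" "map_tuple (ctx_arity x) g \<gamma> = a"
      using ex[OF D_model[OF i(1)] i(2)] by blast
    have "comp_hom \<Gamma> (c i) g = h"
      by (rule un[OF comp_hom_mem[OF \<Gamma>s g(1) c[OF i(1)]] h]) (simp add: ct g i)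
    then show "\<exists>i\<in>I. \<exists>g\<in>homs \<Sigma> \<Gamma> (D i). comp_hom \<Gamma> (c i) g = h" using i(1) g(1) by blast
  qed
  show "\<forall>i\<in>I. \<forall>g\<in>homs \<Sigma> \<Gamma> (D i). \<forall>g'\<in>homs \<Sigma> \<Gamma> (D i).
      comp_hom \<Gamma> (c i) g = comp_hom \<Gamma> (c i) g' \<longrightarrow>
      (\<exists>j. (i, j) \<in> le \<and> comp_hom \<Gamma> (d i j) g = comp_hom \<Gamma> (d i j) g')"
  proof (intro ballI impI)
    fix i g g' assume i: "i \<in> I" and g: "g \<in> homs \<Sigma> \<Gamma> (D i)" and g': "g' \<in> homs \<Sigma> \<Gamma> (D i)"
      and eq: "comp_hom \<Gamma> (c i) g = comp_hom \<Gamma> (c i) g'"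
    have "map_tuple (ctx_arity x) (c i) (map_tuple (ctx_arity x) g \<gamma>) =
        map_tuple (ctx_arity x) (c i) (map_tuple (ctx_arity x) g' \<gamma>)"
      unfolding ct[symmetric] eq ..
    from tuple_eq[OF conc_eq[OF conc i] i map_tuple_mem[OF g \<gamma>t] map_tuple_mem[OF g' \<gamma>t] this]
    obtain j where j: "(i, j) \<in> le" "map_tuple (ctx_arity x) (d i j) (map_tuple (ctx_arity x) g \<gamma>) =
        map_tuple (ctx_arity x) (d i j) (map_tuple (ctx_arity x) g' \<gamma>)" by blast
    have "comp_hom \<Gamma> (d i j) g = comp_hom \<Gamma> (d i j) g'"
      by (rule un[OF comp_hom_mem[OF \<Gamma>s g d_hom[OF j(1)]] comp_hom_mem[OF \<Gamma>s g' d_hom[OF j(1)]]])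
        (simp add: ct j(2))
    then show "\<exists>j. (i, j) \<in> le \<and> comp_hom \<Gamma> (d i j) g = comp_hom \<Gamma> (d i j) g'" using j(1) by blast
  qed
qed

end

section \<open>Free algebras on small sets of facts\<close>

text \<open>\<open>El\<close> records an element by itself, so that elements touched by no operation
  or relation still occur in some set of facts.\<close>

datatype ('s, 'f, 'r, 'k, 'u) fact =
    El 's 'u
  | Fun 'f "'k \<Rightarrow> 'u" 'u
  | Holds 'r "'k \<Rightarrow> 'u"

primrec elems ::
  "('s, 'f, 'r, 'k::wellorder) signature \<Rightarrow> ('s, 'f, 'r, 'k, 'u) fact \<Rightarrow> ('s \<times> 'u) set" where
  "elems \<Sigma> (El s a) = {(s, a)}"
| "elems \<Sigma> (Fun f a b) =
     insert (fcod \<Sigma> f, b) ((\<lambda>i. (snd (fdom \<Sigma> f) i, a i)) ` {..<fst (fdom \<Sigma> f)})"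
| "elems \<Sigma> (Holds R a) = (\<lambda>i. (snd (rdom \<Sigma> R) i, a i)) ` {..<fst (rdom \<Sigma> R)}"

text \<open>For \<open>El\<close> there is nothing to satisfy here; that the mentioned elements land
  in the carrier is the second clause of \<open>realizes\<close>.\<close>

primrec sat ::
  "('s, 'f, 'r, 'k::wellorder) signature \<Rightarrow> ('s, 'f, 'r, 'k, 'u) pstructure \<Rightarrow> ('s, 'u) hom \<Rightarrow>
     ('s, 'f, 'r, 'k, 'u) fact \<Rightarrow> bool" where
  "sat \<Sigma> M h (El s a) \<longleftrightarrow> True"
| "sat \<Sigma> M h (Fun f a b) \<longleftrightarrow> fint M f (map_tuple (fdom \<Sigma> f) h a) = Some (h (fcod \<Sigma> f) b)"
| "sat \<Sigma> M h (Holds R a) \<longleftrightarrow> map_tuple (rdom \<Sigma> R) h a \<in> rint M R"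

text \<open>The formula expressing a fact, with the element \<open>a\<close> of sort \<open>s\<close> named by the variable
  \<open>(s, n (s, a))\<close>.\<close>

primrec fact_fm ::
  "('s, 'f, 'r, 'k::wellorder) signature \<Rightarrow> ('s \<times> 'u \<Rightarrow> 'k) \<Rightarrow> ('s, 'f, 'r, 'k, 'u) fact \<Rightarrow>
     ('s, 'f, 'r, 'k) fm" where
  "fact_fm \<Sigma> n (El s a) = Top"
| "fact_fm \<Sigma> n (Fun f a b) =
     Eq (App f (\<lambda>i. Var (snd (fdom \<Sigma> f) i, n (snd (fdom \<Sigma> f) i, a i)))) (Var (fcod \<Sigma> f, n (fcod \<Sigma> f, b)))"
| "fact_fm \<Sigma> n (Holds R a) = Rel R (\<lambda>i. Var (snd (rdom \<Sigma> R) i, n (snd (rdom \<Sigma> R) i, a i)))"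

lemma holds_fact_fm:
  assumes "\<And>s a. (s, a) \<in> elems \<Sigma> F \<Longrightarrow> e (s, n (s, a)) = h s a"
  shows "holds \<Sigma> M e (fact_fm \<Sigma> n F) \<longleftrightarrow> sat \<Sigma> M h F"
proof (cases F)
  case (Fun f a b)
  have "(\<lambda>i\<in>{..<fst (fdom \<Sigma> f)}. e (snd (fdom \<Sigma> f) i, n (snd (fdom \<Sigma> f) i, a i))) =
      map_tuple (fdom \<Sigma> f) h a"
    using assms by (auto simp: Fun map_tuple_def fun_eq_iff)
  then show ?thesis using assms by (auto simp: Fun)
next
  case (Holds R a)
  have "(\<lambda>i\<in>{..<fst (rdom \<Sigma> R)}. e (snd (rdom \<Sigma> R) i, n (snd (rdom \<Sigma> R) i, a i))) =
      map_tuple (rdom \<Sigma> R) h a"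
    using assms by (auto simp: Holds map_tuple_def fun_eq_iff)
  then show ?thesis by (simp add: Holds)
qed simp

definition facts ::
  "('s, 'f, 'r, 'k::wellorder, 'u) pstructure \<Rightarrow> ('s, 'f, 'r, 'k, 'u) fact set" where
  "facts M = {El s a | s a. a \<in> car M s} \<union> {Fun f a b | f a b. fint M f a = Some b} \<union>
     {Holds R a | R a. a \<in> rint M R}"

definition elemset ::
  "('s, 'f, 'r, 'k::wellorder) signature \<Rightarrow> ('s, 'f, 'r, 'k, 'u) fact set \<Rightarrow> ('s \<times> 'u) set" where
  "elemset \<Sigma> X = (\<Union>F\<in>X. elems \<Sigma> F)"

text \<open>A homomorphism restricted to what \<open>X\<close> mentions: the values of
  \<open>h\<close> elsewhere are arbitrary, which lets plain functions such as the identity serve as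
  \<open>h\<close>.\<close>

definition realizes ::
  "('s, 'f, 'r, 'k::wellorder) signature \<Rightarrow> ('s, 'f, 'r, 'k, 'u) pstructure \<Rightarrow> ('s, 'u) hom \<Rightarrow>
     ('s, 'f, 'r, 'k, 'u) fact set \<Rightarrow> bool" where
  "realizes \<Sigma> M h X \<longleftrightarrow> (\<forall>F\<in>X. sat \<Sigma> M h F) \<and> (\<forall>(s, a)\<in>elemset \<Sigma> X. h s a \<in> car M s)"

lemma realizes_mono: "realizes \<Sigma> M h Y \<Longrightarrow> X \<subseteq> Y \<Longrightarrow> realizes \<Sigma> M h X"
  by (auto simp: realizes_def elemset_def)

lemma elemset_mono: "X \<subseteq> Y \<Longrightarrow> elemset \<Sigma> X \<subseteq> elemset \<Sigma> Y"
  by (auto simp: elemset_def)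

lemma elems_facts:
  assumes "is_structure \<Sigma> M" "F \<in> facts M" "(s, a) \<in> elems \<Sigma> F"
  shows "a \<in> car M s" "s \<in> sorts \<Sigma>"
proof -
  show "a \<in> car M s"
    using assms(2,3) structure_fun[OF assms(1)] structure_rel[OF assms(1)]
    by (fastforce simp: facts_def dest: tuples_mem)
  then show "s \<in> sorts \<Sigma>" using assms(1) unfolding is_structure_def by blast
qed

lemma map_tuple_refl: "a \<in> tuples M t \<Longrightarrow> map_tuple t (\<lambda>s a. a) a = a"
  by (rule tuples_eqI[OF map_tuple_in]) (auto simp: map_tuple_def)

lemma sat_facts:
  assumes "is_structure \<Sigma> M" "F \<in> facts M" shows "sat \<Sigma> M (\<lambda>s a. a) F"
proof (cases F)
  case (Fun f a b)
  then have "fint M f a = Some b" using assms(2) by (auto simp: facts_def)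
  with structure_fun[OF assms(1) this] show ?thesis by (simp add: Fun map_tuple_refl[of a M])
next
  case (Holds R a)
  then have "a \<in> rint M R" using assms(2) by (auto simp: facts_def)
  with structure_rel[OF assms(1) this] show ?thesis by (simp add: Holds map_tuple_refl[of a M])
qed simp

lemma realizes_facts:
  "is_structure \<Sigma> M \<Longrightarrow> X \<subseteq> facts M \<Longrightarrow> realizes \<Sigma> M (\<lambda>s a. a) X"
  unfolding realizes_def elemset_def by (auto intro: sat_facts elems_facts)

lemma (in small_sig) small_facts:
  fixes M :: "('s, 'f, 'r, 'k, 'u) pstructure"
  assumes M: "is_structure \<Sigma> M"
  shows "small TYPE('u) (facts M)"
proof -
  have car: "s \<in> sorts \<Sigma> \<Longrightarrow> small TYPE('u) (car M s)" for s using M by (simp add: is_structure_def)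
  have tup: "f \<in> funs \<Sigma> \<Longrightarrow> small TYPE('u) (tuples M (fdom \<Sigma> f))"
    "R \<in> rels \<Sigma> \<Longrightarrow> small TYPE('u) (tuples M (rdom \<Sigma> R))" for f R
    using sig by (auto intro!: small_tuples[OF M] simp: is_signature_def)
  have cod: "f \<in> funs \<Sigma> \<Longrightarrow> fcod \<Sigma> f \<in> sorts \<Sigma>" for f using sig by (simp add: is_signature_def)
  have ss: "small TYPE('u) (sorts \<Sigma>)" "small TYPE('u) (funs \<Sigma>)" "small TYPE('u) (rels \<Sigma>)"
    using sig_small by (auto simp: small_signature_def)
  have "facts M \<subseteq> (\<lambda>(s, a). El s a) ` (SIGMA s:sorts \<Sigma>. car M s) \<union>
      (\<lambda>(f, a, b). Fun f a b) ` (SIGMA f:funs \<Sigma>. tuples M (fdom \<Sigma> f) \<times> car M (fcod \<Sigma> f)) \<union>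
      (\<lambda>(R, a). Holds R a) ` (SIGMA R:rels \<Sigma>. tuples M (rdom \<Sigma> R))" (is "_ \<subseteq> ?A \<union> ?B \<union> ?C")
  proof
    fix F assume F: "F \<in> facts M"
    show "F \<in> ?A \<union> ?B \<union> ?C"
    proof (cases F)
      case (El s a)
      then have "a \<in> car M s" using F by (auto simp: facts_def)
      moreover from this have "s \<in> sorts \<Sigma>" using M unfolding is_structure_def by blast
      ultimately show ?thesis using El by force
    next
      case (Fun f a b)
      then have "fint M f a = Some b" using F by (auto simp: facts_def)
      from structure_fun[OF M this] show ?thesis using Fun by force
    next
      case (Holds R a)
      then have "a \<in> rint M R" using F by (auto simp: facts_def)
      from structure_rel[OF M this] show ?thesis using Holds by force
    qed
  qed
  moreover have "small TYPE('u) (?A \<union> ?B \<union> ?C)"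
    by (intro small_Un small_image small_Sigma small_Times ss car tup cod)
  ultimately show ?thesis by (rule small_subset[rotated])
qed

text \<open>By regularity of \<open>lam\<close>, the elements mentioned by fewer than
  \<open>lam\<close> facts still fit into one context.\<close>

lemma (in regular_index) lam_elemset:
  fixes \<Sigma> :: "('s, 'f, 'r, 'k) signature"
  assumes "|X| <o (lam :: 'k rel)" shows "|elemset \<Sigma> X| <o (lam :: 'k rel)"
  unfolding elemset_def
proof (rule lam_UN[OF assms])
  fix F :: "('s, 'f, 'r, 'k, 'u) fact"
  have ins: "|insert y (g ` {..<\<alpha>})| <o (lam :: 'k rel)" for y :: "'s \<times> 'u" and g and \<alpha> :: 'k
    using lam_Un[OF lam_finite[of "{y}"] lam_image[OF lam_initial[of \<alpha>], of g]] by simp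
  show "|elems \<Sigma> F| <o (lam :: 'k rel)"
    by (cases F) (auto intro: ins lam_image lam_initial lam_finite)
qed

section \<open>Judgments and free algebras of a class closed under products and closed
  subobjects\<close>

locale closed_class = alg_setting U K \<Sigma> \<S> \<Omega>
  for U :: "'u itself" and K :: "'k::wellorder itself" and \<Sigma> :: "('s, 'f, 'r, 'k) signature"
    and \<S> :: "('s, 'f, 'r, 'k) sequent set" and \<Omega> :: "('s, 'f, 'r, 'k, 'w) rel_signature" +
  fixes E :: "('s, 'f + 'w, 'r, 'k) sequent set"
    and \<E> :: "('s, 'f + 'w, 'r, 'k, 'u) pstructure set"
  assumes E: "q \<in> E \<Longrightarrow> is_judgment \<Sigma> \<Omega> q" and \<E>: "\<E> \<subseteq> Ob (Alg \<Sigma> \<S> \<Omega> E)"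
    and prods: "closed_under_products TYPE('u) (Alg \<Sigma> \<S> \<Omega> E) \<E>"
    and subs: "closed_under_sigma_closed_subobjects \<Sigma> (Alg \<Sigma> \<S> \<Omega> E) \<E>"
begin

text \<open>The largest candidate for \<open>E'\<close> in the theorem: any set of judgments that
  together with \<open>E\<close> defines \<open>\<E>\<close> is contained in it.\<close>

definition valid_judgments :: "('s, 'f + 'w, 'r, 'k) sequent set" where
  "valid_judgments = {q. is_judgment \<Sigma> \<Omega> q \<and> (\<forall>B\<in>\<E>. valid \<Theta> B q)}"

lemma \<E>_structure: "B \<in> \<E> \<Longrightarrow> is_structure \<Theta> B"
  using \<E> by (auto simp: Ob_Alg_iff algebra_structure)

lemma \<E>_valid: "B \<in> \<E> \<Longrightarrow> B \<in> Ob (Alg \<Sigma> \<S> \<Omega> (E \<union> valid_judgments))"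
  using \<E> by (auto simp: Ob_Alg_iff valid_judgments_def simp del: valid.simps)

text \<open>The asymmetry is the point: \<open>R\<close> lies in the class, yet it maps to every
  algebra that merely satisfies \<open>E\<close> and the judgments of the class. The uniqueness
  clause is the form in which generation by \<open>g\<close> is used.\<close>

definition is_free ::
  "('s, 'f, 'r, 'k, 'u) fact set \<Rightarrow> ('s, 'f + 'w, 'r, 'k, 'u) pstructure \<Rightarrow> ('s, 'u) hom \<Rightarrow> bool" where
  "is_free X R g \<longleftrightarrow> R \<in> \<E> \<and> realizes \<Sigma> (reduct R) g X \<and>
    (\<forall>B h. B \<in> Ob (Alg \<Sigma> \<S> \<Omega> (E \<union> valid_judgments)) \<and> realizes \<Sigma> (reduct B) h X \<longrightarrow>
      (\<exists>k\<in>homs \<Theta> R B. \<forall>(s, a)\<in>elemset \<Sigma> X. k s (g s a) = h s a)) \<and>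
    (\<forall>B. \<forall>k\<in>homs \<Theta> R B. \<forall>k'\<in>homs \<Theta> R (B :: ('s, 'f + 'w, 'r, 'k, 'u) pstructure).
      (\<forall>(s, a)\<in>elemset \<Sigma> X. k s (g s a) = k' s (g s a)) \<longrightarrow> k = k')"

text \<open>The facts in \<open>X\<close> become one Horn formula over \<open>\<Sigma>\<close> in a
  context of length below \<open>lam\<close>. If \<open>\<psi>\<close> holds at the generators of
  \<open>R\<close>, it holds at every interpretation of that formula in the class, so the
  corresponding judgment is in \<open>valid_judgments\<close>. The method of diagrams then maps
  \<open>R\<close> to any algebra satisfying these judgments.\<close>

lemma free_algebra:
  fixes M :: "('s, 'f, 'r, 'k, 'u) pstructure"
  assumes M: "is_structure \<Sigma> M" and X: "X \<subseteq> facts M" and card: "|X| <o (lam :: 'k rel)"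
  shows "\<exists>R g. is_free X R g"
proof -
  define N where "N = elemset \<Sigma> X"
  obtain \<alpha> :: 'k and \<nu> where \<nu>: "bij_betw \<nu> {..<\<alpha>} N"
    unfolding N_def by (rule lam_enum[OF lam_elemset[OF card]])
  obtain \<beta> :: 'k and \<xi> where \<xi>: "bij_betw \<xi> {..<\<beta>} X" using lam_enum[OF card] .
  define n where "n = inv_into {..<\<alpha>} \<nu>"
  have n: "n p < \<alpha>" "\<nu> (n p) = p" if "p \<in> N" for p
    using bij_betwE[OF bij_betw_inv_into[OF \<nu>]] bij_betw_inv_into_right[OF \<nu>] that
    by (auto simp: n_def)
  have \<nu>N: "\<nu> i \<in> N" "n (\<nu> i) = i" if "i < \<alpha>" for i
    using bij_betwE[OF \<nu>] bij_betw_inv_into_left[OF \<nu>] that by (auto simp: n_def)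
  have Nsort: "s \<in> sorts \<Sigma>" if "(s, a) \<in> N" for s a
    using that X elems_facts(2)[OF M] by (auto simp: N_def elemset_def)
  \<comment> \<open>Variables are distinguished by their second component, the number of the named
    element under \<open>\<nu>\<close>; the first component is its sort.\<close>
  define x where "x = (\<alpha>, \<lambda>i. (fst (\<nu> i), i))"
  have ctx: "is_ctx \<Sigma> x"
    using \<nu>N(1) Nsort by (auto simp: is_ctx_def x_def inj_on_def) (metis prod.collapse)
  define V where "V = ctx_vars x"
  have VN: "(s, n (s, a)) \<in> V" if "(s, a) \<in> N" for s a
    using n[OF that] by (auto simp: V_def ctx_vars_def x_def image_iff)
  have NV: "\<exists>s a. (s, a) \<in> N \<and> v = (s, n (s, a))" if v: "v \<in> V" for v
  proof -
    obtain i where i: "i < \<alpha>" "v = (fst (\<nu> i), i)" using v by (auto simp: V_def ctx_vars_def x_def)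
    then show ?thesis using \<nu>N[OF i(1)]
      by (intro exI[of _ "fst (\<nu> i)"] exI[of _ "snd (\<nu> i)"]) simp
  qed
  define \<phi> where "\<phi> = Conj \<beta> (\<lambda>i. fact_fm \<Sigma> n (\<xi> i))"
  have isvar: "is_term \<Sigma> V (Var (s, n (s, a))) s" if "(s, a) \<in> N" for s a
    using is_term.intros(1)[OF VN[OF that], of \<Sigma>] Nsort[OF that] by simp
  have fact_formula: "is_formula \<Sigma> V (fact_fm \<Sigma> n F)" if F: "F \<in> X" for F
  proof -
    have N: "(s, a) \<in> N" if "(s, a) \<in> elems \<Sigma> F" for s a
      using that F by (auto simp: N_def elemset_def)
    show ?thesis
    proof (cases F)
      case (El s a)
      then show ?thesis by (simp add: is_formula.intros)
    next
      case (Fun f a b)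
      then have "fint M f a = Some b" using F X by (auto simp: facts_def)
      then have f: "f \<in> funs \<Sigma>" using structure_fun[OF M] by blast
      show ?thesis
        unfolding Fun fact_fm.simps
        by (rule is_formula.intros(2)[OF is_term.intros(2)[OF f] isvar]) (auto intro!: isvar N simp: Fun)
    next
      case (Holds R a)
      then have "a \<in> rint M R" using F X by (auto simp: facts_def)
      then have R: "R \<in> rels \<Sigma>" using structure_rel[OF M] by blast
      show ?thesis
        unfolding Holds fact_fm.simps
        by (rule is_formula.intros(1)[OF R]) (auto intro!: isvar N simp: Holds)
    qed
  qed
  have \<xi>X: "\<xi> i \<in> X" if "i < \<beta>" for i using bij_betwE[OF \<xi>] that by auto
  have \<phi>: "is_formula \<Sigma> V \<phi>"
    unfolding \<phi>_def by (rule is_formula.intros(4)) (rule fact_formula[OF \<xi>X])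
  have holds_\<phi>: "holds \<Sigma> B e \<phi> \<longleftrightarrow> (\<forall>F\<in>X. sat \<Sigma> B h F)"
    if "\<And>s a. (s, a) \<in> N \<Longrightarrow> e (s, n (s, a)) = h s a" for B :: "('s, 'f, 'r, 'k, 'u) pstructure" and e h
  proof -
    have "holds \<Sigma> B e (fact_fm \<Sigma> n F) \<longleftrightarrow> sat \<Sigma> B h F" if F: "F \<in> X" for F
      by (rule holds_fact_fm) (use F \<open>\<And>s a. (s, a) \<in> N \<Longrightarrow> e (s, n (s, a)) = h s a\<close> in
        \<open>auto simp: N_def elemset_def\<close>)
    moreover have "X = \<xi> ` {..<\<beta>}" using \<xi> by (simp add: bij_betw_def)
    ultimately show ?thesis unfolding \<phi>_def by auto
  qed
  define \<phi>' where "\<phi>' = (map_fm id Inl id \<phi> :: ('s, 'f + 'w, 'r, 'k) fm)"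
  have \<phi>': "is_formula \<Theta> V \<phi>'" unfolding \<phi>'_def by (rule is_formula_plus[OF \<phi>])
  \<comment> \<open>All interpretations of the facts in members of the class; this set need not be
    small.\<close>
  define \<K> where "\<K> = {(B, e). B \<in> \<E> \<and> wf_asg B V e \<and> holds \<Theta> B e \<phi>'}"
  have Vs: "fst v \<in> sorts \<Theta>" if "v \<in> V" for v using NV[OF that] Nsort by auto
  have \<K>: "is_structure \<Theta> (fst p) \<and> wf_asg (fst p) V (snd p)" if "p \<in> \<K>" for p
    using that \<E>_structure by (auto simp: \<K>_def)
  obtain R \<pi> g0 where R: "jemb \<Theta> \<K> fst R \<pi>" and gen: "generated \<Theta> V R g0"
    and \<pi>: "\<And>p v. p \<in> \<K> \<Longrightarrow> v \<in> V \<Longrightarrow> push (\<pi> p) g0 v = snd p v"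
    using plus.term_model[OF Vs \<K>] by blast
  have wg: "wf_asg R V g0" using gen by (simp add: generated_def)
  have RE: "R \<in> \<E>"
  proof -
    \<comment> \<open>Closure under products covers only small families, so \<open>\<K>\<close> is
      first cut down to a small subfamily that still embeds \<open>R\<close>.\<close>
    obtain W where W: "W \<subseteq> \<K>" "small TYPE('u) W" "jemb \<Theta> W fst R \<pi>"
      using plus.jemb_small[OF R] by blast
    show ?thesis
      by (rule closed_subproduct[OF E \<E> prods subs W(2,3)]) (use W(1) in \<open>auto simp: \<K>_def\<close>)
  qed
  define g where "g s a = g0 (s, n (s, a))" for s a
  have "holds \<Theta> R g0 \<phi>'"
  proof (rule jemb_holds[OF R \<phi>' wg])
    fix p assume p: "p \<in> \<K>"
    then have "holds \<Theta> (fst p) (snd p) \<phi>'" by (auto simp: \<K>_def)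
    then show "holds \<Theta> (fst p) (push (\<pi> p) g0) \<phi>'"
      using holds_cong[where M = "fst p", OF \<phi>' \<pi>[OF p]] by simp
  qed
  moreover have "g s a \<in> car R s" if "(s, a) \<in> N" for s a
    using wg VN[OF that] by (auto simp: g_def wf_asg_def)
  ultimately have "realizes \<Sigma> (reduct R) g X"
    using holds_\<phi>[of g0 g "reduct R"]
    by (auto simp: realizes_def \<phi>'_def holds_reduct g_def N_def[symmetric])
  moreover have "\<exists>k\<in>homs \<Theta> R B. \<forall>(s, a)\<in>elemset \<Sigma> X. k s (g s a) = h s a"
    if B: "B \<in> Ob (Alg \<Sigma> \<S> \<Omega> (E \<union> valid_judgments))" and h: "realizes \<Sigma> (reduct B) h X" for B h
  proof -
    have Bs: "is_structure \<Theta> B" using B by (simp add: Ob_Alg_iff algebra_structure)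
    define e where "e v = h (fst v) (snd (\<nu> (snd v)))" for v :: "('s, 'k) var"
    have en: "e (s, n (s, a)) = h s a" if "(s, a) \<in> N" for s a using n[OF that] by (simp add: e_def)
    have we: "wf_asg B V e"
      using h NV en by (fastforce simp: wf_asg_def realizes_def N_def)
    have he: "holds \<Theta> B e \<phi>'"
      using h holds_\<phi>[of e h "reduct B"] en by (simp add: \<phi>'_def holds_reduct realizes_def)
    \<comment> \<open>This is where the judgments satisfied by \<open>B\<close> are used: what holds
      at the generators of \<open>R\<close> must hold at their intended images in
      \<open>B\<close>.\<close>
    have "holds \<Theta> B e \<psi>" if \<psi>: "is_formula \<Theta> V \<psi>" and hP: "holds \<Theta> R g0 \<psi>" for \<psi>
    proof -
      have sq: "is_sequent \<Theta> (x, \<phi>', \<psi>)" using \<phi>' \<psi> ctx by (simp add: V_def)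
      have "is_judgment \<Sigma> \<Omega> (x, \<phi>', \<psi>)"
        using sq ctx \<phi> by (auto simp: \<phi>'_def V_def)
      moreover have "valid \<Theta> B' (x, \<phi>', \<psi>)" if B': "B' \<in> \<E>" for B'
        unfolding valid_iff[OF sq]
      proof (intro allI impI)
        fix e' assume "wf_asg B' (ctx_vars x) e'" "holds \<Theta> B' e' \<phi>'"
        then have p: "(B', e') \<in> \<K>" using B' by (simp add: \<K>_def V_def)
        have "holds \<Theta> B' (push (\<pi> (B', e')) g0) \<psi>"
          using holds_hom[OF jemb_hom[OF R p] \<psi> hP] by simp
        then show "holds \<Theta> B' e' \<psi>"
          using holds_cong[where M = B', OF \<psi> \<pi>[OF p]] by simp
      qed
      ultimately have "valid \<Theta> B (x, \<phi>', \<psi>)"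
        using B by (simp add: Ob_Alg_iff valid_judgments_def del: valid.simps)
      then show ?thesis unfolding valid_iff[OF sq] using we he by (simp add: V_def)
    qed
    then obtain k where k: "k \<in> homs \<Theta> R B" "\<And>v. v \<in> V \<Longrightarrow> k (fst v) (g0 v) = e v"
      using generated_hom_exists[OF jemb_structure[OF R] gen Bs we] by blast
    have "k s (g s a) = h s a" if "(s, a) \<in> elemset \<Sigma> X" for s a
      using k(2)[OF VN, of s a] en[of s a] that by (simp add: g_def N_def)
    then show ?thesis using k(1) by blast
  qed
  moreover have "k = k'"
    if "k \<in> homs \<Theta> R B" "k' \<in> homs \<Theta> R B" "\<forall>(s, a)\<in>elemset \<Sigma> X. k s (g s a) = k' s (g s a)"
    for B :: "('s, 'f + 'w, 'r, 'k, 'u) pstructure" and k k'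
  proof (rule generated_hom_unique[OF gen that(1,2)])
    fix v assume "v \<in> V"
    then obtain s a where "(s, a) \<in> N" "v = (s, n (s, a))" using NV by blast
    then show "k (fst v) (g0 v) = k' (fst v) (g0 v)" using that(3) by (auto simp: g_def N_def)
  qed
  ultimately show ?thesis using RE unfolding is_free_def by blast
qed

end

section \<open>Elimination of directed colimits\<close>

context closed_class
begin

section \<open>The directed system of free algebras over a single algebra\<close>

context
  fixes A :: "('s, 'f + 'w, 'r, 'k, 'u) pstructure"
  assumes acc: "ACC (PMod \<Sigma> \<S> :: (('s, 'f, 'r, 'k, 'u) pstructure, ('s, 'u) hom) category)"
    and A: "A \<in> Ob (Alg \<Sigma> \<S> \<Omega> (E \<union> valid_judgments))"
begin

definition fact_sets :: "('s, 'f, 'r, 'k, 'u) fact set set" where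
  "fact_sets = {X. X \<subseteq> facts (reduct A) \<and> |X| <o (lam :: 'k rel)}"

text \<open>\<open>free\<close> and \<open>gen\<close> are the two components of the same choice,
  since the generators make sense only in the algebra chosen with them.\<close>

definition free where "free X = fst (SOME p. is_free X (fst p) (snd p))"
definition gen where "gen X = snd (SOME p. is_free X (fst p) (snd p))"

lemma A_structure: "is_structure \<Theta> A"
  using A by (simp add: Ob_Alg_iff algebra_structure)

lemma A_reduct: "is_structure \<Sigma> (reduct A)"
  by (rule structure_reduct[OF A_structure])

lemma free_spec:
  assumes X: "X \<in> fact_sets"
  shows "free X \<in> \<E>" "realizes \<Sigma> (reduct (free X)) (gen X) X"
    "B \<in> Ob (Alg \<Sigma> \<S> \<Omega> (E \<union> valid_judgments)) \<Longrightarrow> realizes \<Sigma> (reduct B) h X \<Longrightarrow>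
      \<exists>k\<in>homs \<Theta> (free X) B. \<forall>(s, a)\<in>elemset \<Sigma> X. k s (gen X s a) = h s a"
    "k \<in> homs \<Theta> (free X) B' \<Longrightarrow> k' \<in> homs \<Theta> (free X) B' \<Longrightarrow>
      (\<And>s a. (s, a) \<in> elemset \<Sigma> X \<Longrightarrow> k s (gen X s a) = k' s (gen X s a)) \<Longrightarrow> k = k'"
proof -
  have "\<exists>p. is_free X (fst p) (snd p)"
    using free_algebra[OF A_reduct, of X] X by (simp add: fact_sets_def)
  from someI_ex[OF this] have *: "is_free X (free X) (gen X)" unfolding free_def gen_def .
  from *[unfolded is_free_def] show "free X \<in> \<E>" "realizes \<Sigma> (reduct (free X)) (gen X) X" by blast+
  from *[unfolded is_free_def] show "B \<in> Ob (Alg \<Sigma> \<S> \<Omega> (E \<union> valid_judgments)) \<Longrightarrow> realizes \<Sigma> (reduct B) h X \<Longrightarrow>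
      \<exists>k\<in>homs \<Theta> (free X) B. \<forall>(s, a)\<in>elemset \<Sigma> X. k s (gen X s a) = h s a" by blast
  from *[unfolded is_free_def] show "k \<in> homs \<Theta> (free X) B' \<Longrightarrow> k' \<in> homs \<Theta> (free X) B' \<Longrightarrow>
      (\<And>s a. (s, a) \<in> elemset \<Sigma> X \<Longrightarrow> k s (gen X s a) = k' s (gen X s a)) \<Longrightarrow> k = k'" by blast
qed

lemma free_structure: "X \<in> fact_sets \<Longrightarrow> is_structure \<Theta> (free X)"
  by (rule \<E>_structure[OF free_spec(1)])

lemma free_model: "X \<in> fact_sets \<Longrightarrow> is_model \<Sigma> \<S> (reduct (free X))"
  using free_spec(1)[of X] \<E> by (auto simp: Ob_Alg_iff is_algebra_def)

lemma gen_mem: "X \<in> fact_sets \<Longrightarrow> (s, a) \<in> elemset \<Sigma> X \<Longrightarrow> gen X s a \<in> car (free X) s"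
  using free_spec(2) by (fastforce simp: realizes_def)

definition conn where
  "conn X Y = (SOME k. k \<in> homs \<Theta> (free X) (free Y) \<and> (\<forall>(s, a)\<in>elemset \<Sigma> X. k s (gen X s a) = gen Y s a))"

definition ev where
  "ev X = (SOME k. k \<in> homs \<Theta> (free X) A \<and> (\<forall>(s, a)\<in>elemset \<Sigma> X. k s (gen X s a) = a))"

lemma conn_spec:
  assumes X: "X \<in> fact_sets" and Y: "Y \<in> fact_sets" and XY: "X \<subseteq> Y"
  shows "conn X Y \<in> homs \<Theta> (free X) (free Y)" "(s, a) \<in> elemset \<Sigma> X \<Longrightarrow> conn X Y s (gen X s a) = gen Y s a"
proof -
  have "\<exists>k. k \<in> homs \<Theta> (free X) (free Y) \<and> (\<forall>(s, a)\<in>elemset \<Sigma> X. k s (gen X s a) = gen Y s a)"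
    using free_spec(3)[OF X \<E>_valid[OF free_spec(1)[OF Y]] realizes_mono[OF free_spec(2)[OF Y] XY]]
    by blast
  from someI_ex[OF this]
  show "conn X Y \<in> homs \<Theta> (free X) (free Y)" "(s, a) \<in> elemset \<Sigma> X \<Longrightarrow> conn X Y s (gen X s a) = gen Y s a"
    unfolding conn_def[symmetric] by blast+
qed

lemma ev_spec:
  assumes X: "X \<in> fact_sets"
  shows "ev X \<in> homs \<Theta> (free X) A" "(s, a) \<in> elemset \<Sigma> X \<Longrightarrow> ev X s (gen X s a) = a"
proof -
  have "realizes \<Sigma> (reduct A) (\<lambda>s a. a) X"
    by (rule realizes_facts[OF A_reduct]) (use X in \<open>simp add: fact_sets_def\<close>)
  from free_spec(3)[OF X A this]
  have "\<exists>k. k \<in> homs \<Theta> (free X) A \<and> (\<forall>(s, a)\<in>elemset \<Sigma> X. k s (gen X s a) = a)" by blast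
  from someI_ex[OF this]
  show "ev X \<in> homs \<Theta> (free X) A" "(s, a) \<in> elemset \<Sigma> X \<Longrightarrow> ev X s (gen X s a) = a"
    unfolding ev_def[symmetric] by blast+
qed

text \<open>Homomorphisms out of \<open>free X\<close> are determined by the generators;
  functoriality of \<open>conn\<close> and its compatibility with \<open>ev\<close> both reduce to
  this.\<close>

lemma comp_conn:
  assumes X: "X \<in> fact_sets" and Y: "Y \<in> fact_sets" and XY: "X \<subseteq> Y" and h: "h \<in> homs \<Theta> (free Y) B"
    and h': "h' \<in> homs \<Theta> (free X) B"
    and eq: "\<And>s a. (s, a) \<in> elemset \<Sigma> X \<Longrightarrow> h s (gen Y s a) = h' s (gen X s a)"
    and x: "x \<in> car (free X) s"
  shows "h s (conn X Y s x) = h' s x"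
proof -
  have "comp_hom (free X) h (conn X Y) = h'"
    by (rule free_spec(4)[OF X comp_hom_mem[OF free_structure[OF X] conn_spec(1)[OF X Y XY] h] h'])
      (simp add: compose_eq gen_mem[OF X] conn_spec(2)[OF X Y XY] eq)
  then show ?thesis using x by (rule comp_homD)
qed

lemma conn_conn:
  assumes "X \<in> fact_sets" "Y \<in> fact_sets" "Z \<in> fact_sets" "X \<subseteq> Y" "Y \<subseteq> Z" "x \<in> car (free X) s"
  shows "conn Y Z s (conn X Y s x) = conn X Z s x"
proof (rule comp_conn[OF assms(1,2,4) conn_spec(1)[OF assms(2,3,5)] _ _ assms(6)])
  have XZ: "X \<subseteq> Z" using assms(4,5) by blast
  show "conn X Z \<in> homs \<Theta> (free X) (free Z)" by (rule conn_spec(1)[OF assms(1,3) XZ])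
  fix s a assume sa: "(s, a) \<in> elemset \<Sigma> X"
  then have "(s, a) \<in> elemset \<Sigma> Y" using elemset_mono[OF assms(4)] by blast
  then show "conn Y Z s (gen Y s a) = conn X Z s (gen X s a)"
    using sa by (simp add: conn_spec(2)[OF assms(2,3,5)] conn_spec(2)[OF assms(1,3) XZ])
qed

lemma ev_conn:
  assumes "X \<in> fact_sets" "Y \<in> fact_sets" "X \<subseteq> Y" "x \<in> car (free X) s"
  shows "ev Y s (conn X Y s x) = ev X s x"
proof (rule comp_conn[OF assms(1-3) ev_spec(1)[OF assms(2)] ev_spec(1)[OF assms(1)] _ assms(4)])
  fix s a assume sa: "(s, a) \<in> elemset \<Sigma> X"
  then have "(s, a) \<in> elemset \<Sigma> Y" using elemset_mono[OF assms(3)] by blast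
  then show "ev Y s (gen Y s a) = ev X s (gen X s a)"
    using sa by (simp add: ev_spec(2)[OF assms(2)] ev_spec(2)[OF assms(1)])
qed

lemma conn_same:
  assumes X: "X \<in> fact_sets" shows "conn X X = (\<lambda>s. \<lambda>a\<in>car (free X) s. a)"
proof -
  show ?thesis
    by (rule free_spec(4)[OF X conn_spec(1)[OF X X] id_hom[OF free_structure[OF X]]])
      (use conn_spec(2)[OF X X] gen_mem[OF X] in auto)
qed

lemma fact_sets_Un: "X \<in> fact_sets \<Longrightarrow> Y \<in> fact_sets \<Longrightarrow> X \<union> Y \<in> fact_sets"
  by (auto simp: fact_sets_def lam_Un)

lemma fact_sets_UN: "|J| <o (lam :: 'k rel) \<Longrightarrow> (\<And>j. j \<in> J \<Longrightarrow> X j \<in> fact_sets) \<Longrightarrow> (\<Union>j\<in>J. X j) \<in> fact_sets"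
  by (auto simp: fact_sets_def intro: lam_UN)

lemma fact_sets_fact: "F \<in> facts (reduct A) \<Longrightarrow> {F} \<in> fact_sets"
  by (simp add: fact_sets_def lam_finite)

text \<open>Otherwise the free algebras on an increasing sequence of sets of facts would form a chain
  without homomorphisms backwards.\<close>

lemma connected_stage:
  obtains X0 where "X0 \<in> fact_sets" "\<And>Y. Y \<in> fact_sets \<Longrightarrow> X0 \<subseteq> Y \<Longrightarrow> homs \<Sigma> (reduct (free Y)) (reduct (free X0)) \<noteq> {}"
proof (rule ccontr)
  assume "\<not> thesis"
  then have "\<forall>X\<in>fact_sets. \<exists>Y. Y \<in> fact_sets \<and> X \<subseteq> Y \<and> homs \<Sigma> (reduct (free Y)) (reduct (free X)) = {}"
    using that by blast
  from bchoice[OF this] obtain succ where succ: "\<And>X. X \<in> fact_sets \<Longrightarrow> succ X \<in> fact_sets"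
    "\<And>X. X \<in> fact_sets \<Longrightarrow> X \<subseteq> succ X"
    "\<And>X. X \<in> fact_sets \<Longrightarrow> homs \<Sigma> (reduct (free (succ X))) (reduct (free X)) = {}"
    by blast
  define Y where "Y n = (succ ^^ n) {}" for n :: nat
  have Y: "Y n \<in> fact_sets" for n
    by (induction n) (simp_all add: Y_def succ(1), simp add: fact_sets_def lam_finite)
  have YS: "Y (Suc n) = succ (Y n)" for n by (simp add: Y_def)
  have "Y n \<subseteq> Y (Suc n)" for n using succ(2)[OF Y] by (simp add: YS)
  then have "(\<forall>n. reduct (free (Y n)) \<in> Ob (PMod \<Sigma> \<S>) \<and>
      conn (Y n) (Y (Suc n)) \<in> Hom (PMod \<Sigma> \<S>) (reduct (free (Y n))) (reduct (free (Y (Suc n)))))"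
    using free_model[OF Y] homs_reduct[OF conn_spec(1)[OF Y Y]] by simp
  then obtain N where "\<forall>m\<ge>N. \<forall>n\<ge>N. strongly_connected (PMod \<Sigma> \<S>) (reduct (free (Y m))) (reduct (free (Y n)))"
    using acc unfolding ACC_def by (elim allE[of _ "\<lambda>n. reduct (free (Y n))"] allE[of _ "\<lambda>n. conn (Y n) (Y (Suc n))"]) blast
  then have "homs \<Sigma> (reduct (free (Y (Suc N)))) (reduct (free (Y N))) \<noteq> {}"
    by (auto simp: strongly_connected_def)
  then show False using succ(3)[OF Y[of N]] by (simp add: YS)
qed

text \<open>The colimit \<open>C\<close> of the reducts serves to test purity. As
  \<open>\<rho>\<close> after \<open>\<sigma>\<close> is the identity, a factorization of
  \<open>\<sigma>\<close> after \<open>f\<close> through a stage \<open>X\<close> turns into one of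
  \<open>f\<close> through \<open>ev X\<close>, and \<open>lift\<close> in turn factors
  \<open>ev X\<close> through \<open>p\<close>.\<close>

lemma pure_cover:
  obtains S p where "S \<in> \<E>" "p \<in> homs \<Theta> S A"
    "pure_epi TYPE('u) (lam :: 'k rel) (PMod \<Sigma> \<S>) (reduct S) (reduct A) p"
proof -
  obtain X0 where X0: "X0 \<in> fact_sets"
    and return: "\<And>Y. Y \<in> fact_sets \<Longrightarrow> X0 \<subseteq> Y \<Longrightarrow> homs \<Sigma> (reduct (free Y)) (reduct (free X0)) \<noteq> {}"
    using connected_stage by blast
  \<comment> \<open>Above \<open>X0\<close> any two stages are connected: a return map leads to
    \<open>X0\<close> and \<open>conn\<close> leads on from there.\<close>
  define I where "I = {X \<in> fact_sets. X0 \<subseteq> X}"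
  have I: "X \<in> fact_sets" if "X \<in> I" for X using that by (simp add: I_def)
  have X0I: "X0 \<in> I" using X0 by (simp add: I_def)
  have I_small: "small TYPE('u) I"
    by (rule small_subset[OF small_Pow[OF small_facts[OF A_reduct]]]) (auto simp: I_def fact_sets_def)
  have I_Un: "X \<union> Y \<in> I" if "X \<in> I" "Y \<in> fact_sets" for X Y
    using that fact_sets_Un by (auto simp: I_def)
  \<comment> \<open>Adding \<open>X0\<close> keeps the union in \<open>I\<close> even when
    \<open>J\<close> is empty, as happens for a nullary operation.\<close>
  have I_UN: "X0 \<union> (\<Union>j\<in>J. X j) \<in> I" if "|J| <o (lam :: 'k rel)" "\<And>j. j \<in> J \<Longrightarrow> X j \<in> I"
    for J :: "'j set" and X
    using that by (intro I_Un[OF X0I] fact_sets_UN) (auto simp: I)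
  \<comment> \<open>Coherence is required only from some stage on, and this stage may depend on the
    family; the coordinates at stages not above it are free.\<close>
  define Sub where "Sub s = {t \<in> \<Pi>\<^sub>E X\<in>I. car (free X) s. \<exists>X\<in>I. \<forall>Y\<in>I. X \<subseteq> Y \<longrightarrow> t Y = conn X Y s (t X)}" for s
  have sub: "Sub s \<subseteq> (\<Pi>\<^sub>E X\<in>I. car (free X) s)" for s by (auto simp: Sub_def)
  obtain S \<pi> where S: "jemb \<Theta> I free S \<pi>"
    and im: "\<And>s. s \<in> sorts \<Theta> \<Longrightarrow> (\<lambda>x. \<lambda>X\<in>I. \<pi> X s x) ` car S s = Sub s"
  proof (rule subproduct[OF plus.sig, of I free Sub])
    show "is_structure \<Theta> (free X)" if "X \<in> I" for X by (rule free_structure[OF I[OF that]])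
    show "small TYPE('u) (Sub s)" if "s \<in> sorts \<Theta>" for s
      by (rule small_subset[OF small_PiE[OF I_small] sub])
        (use that free_structure[OF I] in \<open>auto simp: is_structure_def\<close>)
    fix f a b
    assume f: "f \<in> funs \<Theta>" and a: "\<And>i. i < fst (fdom \<Theta> f) \<Longrightarrow> a i \<in> Sub (snd (fdom \<Theta> f) i)"
      and bx: "b \<in> extensional I"
      and b: "\<And>X. X \<in> I \<Longrightarrow> fint (free X) f (\<lambda>i\<in>{..<fst (fdom \<Theta> f)}. a i X) = Some (b X)"
    define t where "t = fdom \<Theta> f"
    have "\<forall>i\<in>{..<fst t}. \<exists>X. X \<in> I \<and> (\<forall>Y\<in>I. X \<subseteq> Y \<longrightarrow> a i Y = conn X Y (snd t i) (a i X))"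
      using a unfolding Sub_def t_def by blast
    from bchoice[OF this] obtain Z where Z: "\<And>i. i < fst t \<Longrightarrow> Z i \<in> I"
      "\<And>i Y. i < fst t \<Longrightarrow> Y \<in> I \<Longrightarrow> Z i \<subseteq> Y \<Longrightarrow> a i Y = conn (Z i) Y (snd t i) (a i (Z i))"
      by blast
    \<comment> \<open>The arity is below \<open>lam\<close>, so this common stage of the arguments
      is again in \<open>I\<close>, and the result is coherent from it on.\<close>
    define X where "X = X0 \<union> (\<Union>i\<in>{..<fst t}. Z i)"
    have X: "X \<in> I" unfolding X_def by (rule I_UN[OF lam_initial]) (use Z in auto)
    have ZX: "Z i \<subseteq> X" if "i < fst t" for i using that by (auto simp: X_def)
    have aX: "a i Y = conn X Y (snd t i) (a i X)" if i: "i < fst t" and Y: "Y \<in> I" "X \<subseteq> Y" for i Y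
    proof -
      have "a i (Z i) \<in> car (free (Z i)) (snd t i)" using a[of i] i Z(1)[OF i] sub by (fastforce simp: t_def)
      then show ?thesis
        using conn_conn[OF I[OF Z(1)[OF i]] I[OF X] I[OF Y(1)] ZX[OF i] Y(2)]
          Z(2)[OF i X ZX[OF i]] Z(2)[OF i Y(1)] ZX[OF i] Y(2) by simp
    qed
    have "b Y = conn X Y (fcod \<Theta> f) (b X)" if Y: "Y \<in> I" "X \<subseteq> Y" for Y
    proof -
      have "map_tuple t (conn X Y) (\<lambda>i\<in>{..<fst t}. a i X) = (\<lambda>i\<in>{..<fst t}. a i Y)"
        using aX[OF _ Y] by (auto simp: map_tuple_def fun_eq_iff)
      then show ?thesis
        using hom_fun[OF conn_spec(1)[OF I[OF X] I[OF Y(1)] Y(2)] f b[OF X]] b[OF Y(1)] by (simp add: t_def)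
    qed
    moreover have "b \<in> (\<Pi>\<^sub>E X\<in>I. car (free X) (fcod \<Theta> f))"
      using bx structure_fun[OF free_structure[OF I] b] by (auto simp: PiE_def)
    ultimately show "b \<in> Sub (fcod \<Theta> f)" using X by (auto simp: Sub_def)
  qed (rule sub, blast)
  have SE: "S \<in> \<E>"
    by (rule closed_subproduct[OF E \<E> prods subs I_small S]) (auto intro: free_spec(1)[OF I])
  note Ss = jemb_structure[OF S]
  \<comment> \<open>\<open>y\<close> is the value in \<open>A\<close> that the family
    \<open>z\<close> takes at every stage from \<open>X\<close> on; coherence makes
    \<open>ev\<close> constant there.\<close>
  define at where "at s z X y \<longleftrightarrow> (\<forall>Y\<in>I. X \<subseteq> Y \<longrightarrow> ev Y s (\<pi> Y s z) = y)" for s z X y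
  have at_ex: "\<exists>y. \<exists>X\<in>I. at s z X y" if z: "z \<in> car S s" for s z
  proof -
    have "s \<in> sorts \<Theta>" using z Ss unfolding is_structure_def by blast
    then have "(\<lambda>X\<in>I. \<pi> X s z) \<in> Sub s" using im z by blast
    then obtain X where X: "X \<in> I" "\<And>Y. Y \<in> I \<Longrightarrow> X \<subseteq> Y \<Longrightarrow> \<pi> Y s z = conn X Y s (\<pi> X s z)"
      by (auto simp: Sub_def)
    have "ev Y s (\<pi> Y s z) = ev X s (\<pi> X s z)" if Y: "Y \<in> I" "X \<subseteq> Y" for Y
      unfolding X(2)[OF Y]
      by (rule ev_conn[OF I[OF X(1)] I[OF Y(1)] Y(2) hom_mem[OF jemb_hom[OF S X(1)] z]])
    then show ?thesis using X(1) unfolding at_def by blast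
  qed
  have at_unique: "y = y'" if "X \<in> I" "at s z X y" "X' \<in> I" "at s z X' y'" for s z X y X' y'
  proof -
    have "X \<union> X' \<in> I" by (rule I_Un[OF that(1) I[OF that(3)]])
    then have "ev (X \<union> X') s (\<pi> (X \<union> X') s z) = y" "ev (X \<union> X') s (\<pi> (X \<union> X') s z) = y'"
      using that(2,4) unfolding at_def by blast+
    then show ?thesis by simp
  qed
  define p where "p s = (\<lambda>z\<in>car S s. SOME y. \<exists>X\<in>I. at s z X y)" for s
  have p_at: "\<exists>X\<in>I. at s z X (p s z)" if z: "z \<in> car S s" for s z
    using someI_ex[OF at_ex[OF z]] z by (simp add: p_def)
  have pI: "p s z = y" if z: "z \<in> car S s"
    and X: "X \<in> I" "\<And>Y. Y \<in> I \<Longrightarrow> X \<subseteq> Y \<Longrightarrow> ev Y s (\<pi> Y s z) = y" for s z X y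
  proof -
    have y: "at s z X y" using X(2) by (simp add: at_def)
    obtain X' where "X' \<in> I" "at s z X' (p s z)" using p_at[OF z] by blast
    then show ?thesis using at_unique[OF _ _ X(1) y] by blast
  qed
  have p_tuple: "\<exists>X\<in>I. \<forall>Y\<in>I. X \<subseteq> Y \<longrightarrow> map_tuple t (ev Y) (map_tuple t (\<pi> Y) a) = map_tuple t p a"
    if a: "a \<in> tuples S t" for t a
  proof -
    have "\<forall>i\<in>{..<fst t}. \<exists>X. X \<in> I \<and> at (snd t i) (a i) X (p (snd t i) (a i))"
      using p_at tuples_mem[OF a] by blast
    from bchoice[OF this] obtain Z where Z: "\<And>i. i < fst t \<Longrightarrow> Z i \<in> I"
      "\<And>i. i < fst t \<Longrightarrow> at (snd t i) (a i) (Z i) (p (snd t i) (a i))" by blast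
    define X where "X = X0 \<union> (\<Union>i\<in>{..<fst t}. Z i)"
    have X: "X \<in> I" unfolding X_def by (rule I_UN[OF lam_initial]) (use Z in auto)
    have "map_tuple t (ev Y) (map_tuple t (\<pi> Y) a) = map_tuple t p a" if Y: "Y \<in> I" "X \<subseteq> Y" for Y
    proof -
      have "ev Y (snd t i) (\<pi> Y (snd t i) (a i)) = p (snd t i) (a i)" if "i < fst t" for i
        using Z(2)[OF that] Y that unfolding at_def X_def by blast
      then show ?thesis by (auto simp: map_tuple_def fun_eq_iff)
    qed
    then show ?thesis using X by blast
  qed
  have p: "p \<in> homs \<Theta> S A"
  proof (rule homsI)
    fix s z assume z: "z \<in> car S s"
    obtain X where X: "X \<in> I" "at s z X (p s z)" using p_at[OF z] by blast
    then have "p s z = ev X s (\<pi> X s z)" by (simp add: at_def)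
    then show "p s z \<in> car A s"
      using hom_mem[OF ev_spec(1)[OF I[OF X(1)]] hom_mem[OF jemb_hom[OF S X(1)] z]] by simp
  next
    fix f a b assume f: "f \<in> funs \<Theta>" and b: "fint S f a = Some b"
    note F = structure_fun[OF Ss b]
    have aT: "a \<in> tuples S (fdom \<Theta> f)" and bC: "b \<in> car S (fcod \<Theta> f)" using F by auto
    obtain X where X: "X \<in> I" "\<And>Y. Y \<in> I \<Longrightarrow> X \<subseteq> Y \<Longrightarrow>
        map_tuple (fdom \<Theta> f) (ev Y) (map_tuple (fdom \<Theta> f) (\<pi> Y) a) = map_tuple (fdom \<Theta> f) p a"
      using p_tuple[OF aT] by blast
    obtain X' where X': "X' \<in> I" "at (fcod \<Theta> f) b X' (p (fcod \<Theta> f) b)" using p_at[OF bC] by blast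
    \<comment> \<open>At this stage \<open>ev\<close> computes \<open>p\<close> for the arguments
      and for the result simultaneously.\<close>
    have Y: "X \<union> X' \<in> I" by (rule I_Un[OF X(1) I[OF X'(1)]])
    have "fint A f (map_tuple (fdom \<Theta> f) p a) = Some (ev (X \<union> X') (fcod \<Theta> f) (\<pi> (X \<union> X') (fcod \<Theta> f) b))"
      using hom_fun[OF ev_spec(1)[OF I[OF Y]] f hom_fun[OF jemb_hom[OF S Y] f b]] X(2)[OF Y] by simp
    also have "ev (X \<union> X') (fcod \<Theta> f) (\<pi> (X \<union> X') (fcod \<Theta> f) b) = p (fcod \<Theta> f) b"
      using X'(2) Y by (simp add: at_def)
    finally show "fint A f (map_tuple (fdom \<Theta> f) p a) = Some (p (fcod \<Theta> f) b)" .
  next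
    fix Q a assume Q: "Q \<in> rels \<Theta>" and a: "a \<in> rint S Q"
    have aT: "a \<in> tuples S (rdom \<Theta> Q)" using structure_rel[OF Ss a] by simp
    obtain X where X: "X \<in> I" "\<And>Y. Y \<in> I \<Longrightarrow> X \<subseteq> Y \<Longrightarrow>
        map_tuple (rdom \<Theta> Q) (ev Y) (map_tuple (rdom \<Theta> Q) (\<pi> Y) a) = map_tuple (rdom \<Theta> Q) p a"
      using p_tuple[OF aT] by blast
    show "map_tuple (rdom \<Theta> Q) p a \<in> rint A Q"
      using hom_rel[OF ev_spec(1)[OF I[OF X(1)]] Q hom_rel[OF jemb_hom[OF S X(1)] Q a]] X(2)[OF X(1)] by simp
  qed (simp add: p_def)
  have p': "p \<in> homs \<Sigma> (reduct S) (reduct A)" by (rule homs_reduct[OF p])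
  define le where "le = {(X, Y). X \<in> I \<and> Y \<in> I \<and> X \<subseteq> Y}"
  interpret D: directed_diagram U K \<Sigma> \<S> I le "\<lambda>X. reduct (free X)" conn
  proof
    show "small TYPE('u) I" by (rule I_small)
    show "directed_poset (lam :: 'k rel) I le"
      unfolding directed_poset_def partial_order_on_def preorder_on_def
    proof (intro conjI allI impI)
      show "refl_on I le" "le \<subseteq> I \<times> I" "trans le" "antisym le"
        by (auto simp: le_def refl_on_def trans_def antisym_def)
      fix J assume J: "J \<subseteq> I" "|J| <o (lam :: 'k rel)"
      have "X0 \<union> (\<Union>j\<in>J. j) \<in> I" by (rule I_UN[OF J(2)]) (use J(1) in auto)
      then show "\<exists>u\<in>I. \<forall>j\<in>J. (j, u) \<in> le"
        using J(1) by (intro bexI[of _ "X0 \<union> (\<Union>j\<in>J. j)"]) (auto simp: le_def)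
    qed
    show "is_diagram (PMod \<Sigma> \<S>) I le (\<lambda>X. reduct (free X)) conn"
      unfolding is_diagram_def PMod_simps
    proof (intro conjI ballI allI impI)
      fix X assume X: "X \<in> I"
      show "reduct (free X) \<in> {M. is_model \<Sigma> \<S> M}" using free_model[OF I[OF X]] by simp
      show "conn X X = (\<lambda>s. \<lambda>a\<in>car (reduct (free X)) s. a)" using conn_same[OF I[OF X]] by simp
    next
      fix q assume "q \<in> le"
      then show "case q of (X, Y) \<Rightarrow> conn X Y \<in> homs \<Sigma> (reduct (free X)) (reduct (free Y))"
        using homs_reduct[OF conn_spec(1)] I by (auto simp: le_def)
    next
      fix X Y Z assume XYZ: "(X, Y) \<in> le \<and> (Y, Z) \<in> le"
      then have X: "X \<in> fact_sets" and Y: "Y \<in> fact_sets" and Z: "Z \<in> fact_sets" and XY: "X \<subseteq> Y" and YZ: "Y \<subseteq> Z"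
        using I by (auto simp: le_def)
      have XZ: "X \<subseteq> Z" using XY YZ by blast
      show "comp_hom (reduct (free X)) (conn Y Z) (conn X Y) = conn X Z"
        unfolding reduct_simps
        by (rule hom_eqI[OF comp_hom_mem[OF free_structure[OF X] conn_spec(1)[OF X Y XY] conn_spec(1)[OF Y Z YZ]]
              conn_spec(1)[OF X Z XZ]])
          (simp add: compose_eq conn_conn[OF X Y Z XY YZ])
    qed
  qed
  obtain C k where C: "D.concrete_cocone C k" using D.concrete_cocone_exists by blast
  have Ccol: "is_colimit (PMod \<Sigma> \<S>) I le (\<lambda>X. reduct (free X)) conn C k" by (rule D.conc_is_colimit[OF C])
  note k = D.conc_hom[OF C]
  have kd: "k Y s (conn X Y s x) = k X s x" if "X \<in> I" "Y \<in> I" "X \<subseteq> Y" "x \<in> car (free X) s" for X Y s x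
    using D.conc_compat[OF C, of X Y x s] that by (simp add: le_def)
  \<comment> \<open>An element is named at the stage obtained by adding its own \<open>El\<close>
    fact; every other stage in \<open>I\<close> that mentions it gives the same point of
    \<open>C\<close>.\<close>
  define \<sigma> where "\<sigma> s = (\<lambda>a\<in>car A s. k (X0 \<union> {El s a}) s (gen (X0 \<union> {El s a}) s a))" for s
  have kgen: "k X s (gen X s a) = k Y s (gen Y s a)"
    if "X \<in> I" "Y \<in> I" "(s, a) \<in> elemset \<Sigma> X" "X \<subseteq> Y" for X Y s a
    using kd[OF that(1,2,4) gen_mem[OF I[OF that(1)] that(3)]] conn_spec(2)[OF I[OF that(1)] I[OF that(2)] that(4,3)]
    by simp
  have \<sigma>: "\<sigma> s a = k X s (gen X s a)" if X: "X \<in> I" "(s, a) \<in> elemset \<Sigma> X" and a: "a \<in> car A s" for X s a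
  proof -
    have "El s a \<in> facts (reduct A)" using a by (simp add: facts_def)
    then have Y: "X0 \<union> {El s a} \<in> I" by (intro I_Un[OF X0I] fact_sets_fact)
    have Z: "X \<union> (X0 \<union> {El s a}) \<in> I" by (rule I_Un[OF X(1) I[OF Y]])
    have e: "(s, a) \<in> elemset \<Sigma> (X0 \<union> {El s a})" by (simp add: elemset_def)
    have "\<sigma> s a = k (X0 \<union> {El s a}) s (gen (X0 \<union> {El s a}) s a)" using a by (simp add: \<sigma>_def)
    also have "\<dots> = k (X \<union> (X0 \<union> {El s a})) s (gen (X \<union> (X0 \<union> {El s a})) s a)"
      by (rule kgen[OF Y Z e]) blast
    also have "\<dots> = k X s (gen X s a)" by (rule kgen[OF X(1) Z X(2), symmetric]) blast
    finally show ?thesis .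
  qed
  have stage: "\<exists>X\<in>I. F \<in> X \<and> (\<forall>s a. (s, a) \<in> elems \<Sigma> F \<longrightarrow> (s, a) \<in> elemset \<Sigma> X \<and> a \<in> car A s)"
    if F: "F \<in> facts (reduct A)" for F
  proof
    show "X0 \<union> {F} \<in> I" by (rule I_Un[OF X0I fact_sets_fact[OF F]])
    show "F \<in> X0 \<union> {F} \<and> (\<forall>s a. (s, a) \<in> elems \<Sigma> F \<longrightarrow> (s, a) \<in> elemset \<Sigma> (X0 \<union> {F}) \<and> a \<in> car A s)"
      using elems_facts(1)[OF A_reduct F] by (auto simp: elemset_def)
  qed
  \<comment> \<open>Every single fact of the reduct belongs to some stage, where \<open>gen\<close>
    realizes it. This is why the stages record operations and relations and not only
    elements.\<close>
  have \<sigma>h: "\<sigma> \<in> homs \<Sigma> (reduct A) C"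
  proof (rule homsI)
    fix s a assume "a \<in> car (reduct A) s"
    then have a: "a \<in> car A s" and "El s a \<in> facts (reduct A)" by (auto simp: facts_def)
    then obtain X where X: "X \<in> I" "(s, a) \<in> elemset \<Sigma> X" using stage[of "El s a"] by auto
    show "\<sigma> s a \<in> car C s"
      using \<sigma>[OF X a] hom_mem[OF k[OF X(1)]] gen_mem[OF I[OF X(1)] X(2)] by simp
  next
    fix f a b assume f: "f \<in> funs \<Sigma>" and "fint (reduct A) f a = Some b"
    then have "Fun f a b \<in> facts (reduct A)" by (simp add: facts_def)
    then obtain X where X: "X \<in> I" "Fun f a b \<in> X"
      and el: "\<And>s c. (s, c) \<in> elems \<Sigma> (Fun f a b) \<Longrightarrow> (s, c) \<in> elemset \<Sigma> X \<and> c \<in> car A s"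
      using stage by blast
    have "sat \<Sigma> (reduct (free X)) (gen X) (Fun f a b)"
      using free_spec(2)[OF I[OF X(1)]] X(2) unfolding realizes_def by blast
    then have "fint (reduct (free X)) f (map_tuple (fdom \<Sigma> f) (gen X) a) = Some (gen X (fcod \<Sigma> f) b)" by simp
    from hom_fun[OF k[OF X(1)] f this]
    have "fint C f (map_tuple (fdom \<Sigma> f) (k X) (map_tuple (fdom \<Sigma> f) (gen X) a)) =
        Some (k X (fcod \<Sigma> f) (gen X (fcod \<Sigma> f) b))" .
    moreover have "map_tuple (fdom \<Sigma> f) (k X) (map_tuple (fdom \<Sigma> f) (gen X) a) = map_tuple (fdom \<Sigma> f) \<sigma> a"
      using el \<sigma>[OF X(1)] by (auto simp: map_tuple_def fun_eq_iff)
    moreover have "k X (fcod \<Sigma> f) (gen X (fcod \<Sigma> f) b) = \<sigma> (fcod \<Sigma> f) b"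
      using el[of "fcod \<Sigma> f" b] \<sigma>[OF X(1)] by simp
    ultimately show "fint C f (map_tuple (fdom \<Sigma> f) \<sigma> a) = Some (\<sigma> (fcod \<Sigma> f) b)" by simp
  next
    fix Q a assume Q: "Q \<in> rels \<Sigma>" and "a \<in> rint (reduct A) Q"
    then have "Holds Q a \<in> facts (reduct A)" by (simp add: facts_def)
    then obtain X where X: "X \<in> I" "Holds Q a \<in> X"
      and el: "\<And>s c. (s, c) \<in> elems \<Sigma> (Holds Q a :: ('s, 'f, 'r, 'k, 'u) fact) \<Longrightarrow> (s, c) \<in> elemset \<Sigma> X \<and> c \<in> car A s"
      using stage by blast
    have "sat \<Sigma> (reduct (free X)) (gen X) (Holds Q a)"
      using free_spec(2)[OF I[OF X(1)]] X(2) unfolding realizes_def by blast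
    then have "map_tuple (rdom \<Sigma> Q) (gen X) a \<in> rint (reduct (free X)) Q" by simp
    from hom_rel[OF k[OF X(1)] Q this]
    have "map_tuple (rdom \<Sigma> Q) (k X) (map_tuple (rdom \<Sigma> Q) (gen X) a) \<in> rint C Q" .
    moreover have "map_tuple (rdom \<Sigma> Q) (k X) (map_tuple (rdom \<Sigma> Q) (gen X) a) = map_tuple (rdom \<Sigma> Q) \<sigma> a"
      using el \<sigma>[OF X(1)] by (auto simp: map_tuple_def fun_eq_iff)
    ultimately show "map_tuple (rdom \<Sigma> Q) \<sigma> a \<in> rint C Q" by simp
  qed (simp add: \<sigma>_def)
  have "is_cocone (PMod \<Sigma> \<S>) I le (\<lambda>X. reduct (free X)) conn (reduct A) ev"
    unfolding is_cocone_def PMod_simps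
  proof (intro conjI ballI)
    show "reduct A \<in> {M. is_model \<Sigma> \<S> M}" using A by (simp add: Ob_Alg_iff is_algebra_def)
    show "ev X \<in> homs \<Sigma> (reduct (free X)) (reduct A)" if "X \<in> I" for X
      by (rule homs_reduct[OF ev_spec(1)[OF I[OF that]]])
    fix q assume q: "q \<in> le"
    obtain X Y where XY: "q = (X, Y)" by (cases q)
    have X: "X \<in> fact_sets" and Y: "Y \<in> fact_sets" and sb: "X \<subseteq> Y" using q I by (auto simp: XY le_def)
    show "case q of (X, Y) \<Rightarrow> comp_hom (reduct (free X)) (ev Y) (conn X Y) = ev X"
      unfolding XY prod.case reduct_simps
      by (rule hom_eqI[OF comp_hom_mem[OF free_structure[OF X] conn_spec(1)[OF X Y sb] ev_spec(1)[OF Y]] ev_spec(1)[OF X]])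
        (simp add: compose_eq ev_conn[OF X Y sb])
  qed
  from colimit_unique_map[OF Ccol this] obtain \<rho> where \<rho>: "\<rho> \<in> homs \<Sigma> C (reduct A)"
    "\<And>X. X \<in> I \<Longrightarrow> comp_hom (reduct (free X)) \<rho> (k X) = ev X"
    unfolding PMod_simps by blast
  have \<rho>k: "\<rho> s (k X s x) = ev X s x" if "X \<in> I" "x \<in> car (free X) s" for X s x
    using comp_homD[OF \<rho>(2)[OF that(1)]] that(2) by simp
  \<comment> \<open>The reduct of \<open>A\<close> is thereby a retract of \<open>C\<close>; the
    other composite is not claimed to be the identity.\<close>
  have \<rho>\<sigma>: "\<rho> s (\<sigma> s a) = a" if a: "a \<in> car A s" for s a
  proof -
    have "El s a \<in> facts (reduct A)" using a by (simp add: facts_def)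
    then obtain X where X: "X \<in> I" "(s, a) \<in> elemset \<Sigma> X" using stage[of "El s a"] by auto
    show ?thesis
      using \<sigma>[OF X a] \<rho>k[OF X(1) gen_mem[OF I[OF X(1)] X(2)]] ev_spec(2)[OF I[OF X(1)] X(2)] by simp
  qed
  have connect: "homs \<Sigma> (reduct (free X)) (reduct (free Y)) \<noteq> {}" if X: "X \<in> I" and Y: "Y \<in> I" for X Y
  proof -
    obtain h where h: "h \<in> homs \<Sigma> (reduct (free X)) (reduct (free X0))" using return X by (auto simp: I_def)
    have "conn X0 Y \<in> homs \<Sigma> (reduct (free X0)) (reduct (free Y))"
      by (rule homs_reduct[OF conn_spec(1)[OF X0]]) (use Y in \<open>auto simp: I_def\<close>)
    from comp_hom_mem[OF structure_reduct[OF free_structure[OF I[OF X]]] h this] show ?thesis by blast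
  qed
  have lift: "\<exists>w\<in>homs \<Sigma> (reduct (free X)) (reduct S). \<forall>s. \<forall>x\<in>car (free X) s. p s (w s x) = ev X s x"
    if X: "X \<in> I" for X
  proof -
    \<comment> \<open>At stages not above \<open>X\<close> any \<open>\<Sigma>\<close>-homomorphism
      will do: the map \<open>w\<close> built from \<open>m\<close> is needed only in
      \<open>PMod\<close>, and \<open>p\<close> reads only the stages above
      \<open>X\<close>.\<close>
    define m where "m Y = (if X \<subseteq> Y then conn X Y else (SOME h. h \<in> homs \<Sigma> (reduct (free X)) (reduct (free Y))))" for Y
    have m: "m Y \<in> homs \<Sigma> (reduct (free X)) (reduct (free Y))" if Y: "Y \<in> I" for Y
      using homs_reduct[OF conn_spec(1)[OF I[OF X] I[OF Y]]] some_in_eq[of "homs \<Sigma> (reduct (free X)) (reduct (free Y))"]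
        connect[OF X Y] by (simp add: m_def some_in_eq)
    define w0 where "w0 s x = (SOME z. z \<in> car S s \<and> (\<forall>Y\<in>I. \<pi> Y s z = m Y s x))" for s x
    have w0: "w0 s x \<in> car S s \<and> (\<forall>Y\<in>I. \<pi> Y s (w0 s x) = m Y s x)" if x: "x \<in> car (free X) s" for s x
      unfolding w0_def
    proof (rule someI_ex)
      have s: "s \<in> sorts \<Theta>" using x free_structure[OF I[OF X]] unfolding is_structure_def by blast
      have "(\<lambda>Y\<in>I. m Y s x) \<in> Sub s"
      proof -
        have "m Y s x \<in> car (free Y) s" if "Y \<in> I" for Y using hom_mem[OF m[OF that]] x by simp
        \<comment> \<open>\<open>m X\<close> is \<open>conn X X\<close>, which is the identity on
          the carrier, so the family is coherent from \<open>X\<close> on.\<close>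
        moreover have "m Y s x = conn X Y s (m X s x)" if "Y \<in> I" "X \<subseteq> Y" for Y
          using x conn_same[OF I[OF X]] that by (simp add: m_def)
        ultimately show ?thesis using X by (auto simp: Sub_def intro!: bexI[of _ X])
      qed
      then obtain z where z: "z \<in> car S s" "(\<lambda>Y\<in>I. m Y s x) = (\<lambda>Y\<in>I. \<pi> Y s z)"
        unfolding im[OF s, symmetric] by auto
      have "\<pi> Y s z = m Y s x" if "Y \<in> I" for Y using fun_cong[OF z(2), of Y] that by simp
      then show "\<exists>z. z \<in> car S s \<and> (\<forall>Y\<in>I. \<pi> Y s z = m Y s x)" using z(1) by blast
    qed
    define w where "w s = restrict (w0 s) (car (free X) s)" for s
    have "w \<in> homs \<Sigma> (reduct (free X)) (reduct S)"
      by (rule jemb_lift[OF jemb_reduct[OF S] structure_reduct[OF free_structure[OF I[OF X]]] m])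
        (use w0 in \<open>auto simp: w_def\<close>)
    moreover have "p s (w s x) = ev X s x" if x: "x \<in> car (free X) s" for s x
    proof (rule pI[OF _ X])
      show "w s x \<in> car S s" using w0[OF x] x by (simp add: w_def)
      fix Y assume Y: "Y \<in> I" "X \<subseteq> Y"
      have "\<pi> Y s (w s x) = conn X Y s x" using w0[OF x] x Y by (simp add: w_def m_def)
      then show "ev Y s (\<pi> Y s (w s x)) = ev X s x" using ev_conn[OF I[OF X] I[OF Y(1)] Y(2) x] by simp
    qed
    ultimately show ?thesis by blast
  qed
  have "pure_epi TYPE('u) (lam :: 'k rel) (PMod \<Sigma> \<S>) (reduct S) (reduct A) p"
    unfolding pure_epi_def PMod_simps
  proof (intro conjI p' allI impI ballI)
    fix \<Gamma> f assume \<Gamma>: "presentable TYPE('u) (lam :: 'k rel) (PMod \<Sigma> \<S>) \<Gamma>" and f: "f \<in> homs \<Sigma> \<Gamma> (reduct A)"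
    have \<Gamma>s: "is_structure \<Sigma> \<Gamma>" using \<Gamma> by (simp add: presentable_def is_model_def)
    \<comment> \<open>Presentability cannot be applied to \<open>f\<close> directly, as the target
      is not given as a colimit; it is applied to \<open>f\<close> followed by the section.\<close>
    obtain X h where X: "X \<in> I" and h: "h \<in> homs \<Sigma> \<Gamma> (reduct (free X))"
      and eq: "comp_hom \<Gamma> (k X) h = comp_hom \<Gamma> \<sigma> f"
      using D.presentable_factor[OF \<Gamma> Ccol comp_hom_mem[OF \<Gamma>s f \<sigma>h]] by blast
    obtain w where w: "w \<in> homs \<Sigma> (reduct (free X)) (reduct S)"
      "\<And>s x. x \<in> car (free X) s \<Longrightarrow> p s (w s x) = ev X s x"
      using lift[OF X] by blast
    have wh: "comp_hom \<Gamma> w h \<in> homs \<Sigma> \<Gamma> (reduct S)" by (rule comp_hom_mem[OF \<Gamma>s h w(1)])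
    have "comp_hom \<Gamma> p (comp_hom \<Gamma> w h) = f"
    proof (rule hom_eqI[OF comp_hom_mem[OF \<Gamma>s wh p'] f])
      fix s x assume x: "x \<in> car \<Gamma> s"
      have hx: "h s x \<in> car (free X) s" using hom_mem[OF h x] by simp
      have fx: "f s x \<in> car A s" using hom_mem[OF f x] by simp
      have "k X s (h s x) = \<sigma> s (f s x)" using comp_homD[OF eq x] x by (simp add: compose_eq)
      then have "ev X s (h s x) = f s x" using \<rho>k[OF X hx] \<rho>\<sigma>[OF fx] by simp
      then show "comp_hom \<Gamma> p (comp_hom \<Gamma> w h) s x = f s x" using x w(2)[OF hx] by (simp add: compose_eq)
    qed
    then show "\<exists>g\<in>homs \<Sigma> \<Gamma> (reduct S). comp_hom \<Gamma> p g = f"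
      using wh by (rule bexI[of _ "comp_hom \<Gamma> w h"])
  qed
  then show thesis using that SE p by blast
qed

end

lemma definable:
  assumes acc: "ACC (PMod \<Sigma> \<S> :: (('s, 'f, 'r, 'k, 'u) pstructure, ('s, 'u) hom) category)"
    and quot: "closed_under_pure_quotients \<Sigma> \<S> (Alg \<Sigma> \<S> \<Omega> E) \<E>"
  shows "\<E> = Ob (Alg \<Sigma> \<S> \<Omega> (E \<union> valid_judgments))"
proof
  show "\<E> \<subseteq> Ob (Alg \<Sigma> \<S> \<Omega> (E \<union> valid_judgments))" using \<E>_valid by blast
  show "Ob (Alg \<Sigma> \<S> \<Omega> (E \<union> valid_judgments)) \<subseteq> \<E>"
  proof
    fix A :: "('s, 'f + 'w, 'r, 'k, 'u) pstructure"
    assume A: "A \<in> Ob (Alg \<Sigma> \<S> \<Omega> (E \<union> valid_judgments))"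
    then have "A \<in> Ob (Alg \<Sigma> \<S> \<Omega> E)" by (simp add: Ob_Alg_iff)
    moreover obtain S p where "S \<in> \<E>" "p \<in> homs \<Theta> S A"
      "pure_epi TYPE('u) (lam :: 'k rel) (PMod \<Sigma> \<S>) (reduct S) (reduct A) p"
      using pure_cover[OF acc A] by blast
    ultimately show "A \<in> \<E>" using quot unfolding closed_under_pure_quotients_def Alg_simps by blast
  qed
qed

end

section \<open>Closure properties of definable classes\<close>

context alg_setting
begin

text \<open>For pure quotients the two sides of a judgment play different roles. The premise is over
  \<open>\<Sigma>\<close>, so its solutions are maps out of a presentable model and lift along
  \<open>p\<close> in \<open>PMod\<close>. The conclusion may involve \<open>\<Omega>\<close> and is
  brought back because \<open>p\<close> is a homomorphism of algebras.\<close>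

lemma definable_closed:
  fixes \<E> :: "('s, 'f + 'w, 'r, 'k, 'u) pstructure set"
  assumes E: "\<And>q. q \<in> E \<Longrightarrow> is_judgment \<Sigma> \<Omega> q" and E': "\<And>q. q \<in> E' \<Longrightarrow> is_judgment \<Sigma> \<Omega> q"
    and \<E>: "\<E> = Ob (Alg \<Sigma> \<S> \<Omega> (E \<union> E'))"
  shows "closed_under_products TYPE('u) (Alg \<Sigma> \<S> \<Omega> E) \<E>"
    "closed_under_sigma_closed_subobjects \<Sigma> (Alg \<Sigma> \<S> \<Omega> E) \<E>"
    "closed_under_pure_quotients \<Sigma> \<S> (Alg \<Sigma> \<S> \<Omega> E) \<E>"
proof -
  have EE: "\<And>q. q \<in> E \<union> E' \<Longrightarrow> is_judgment \<Sigma> \<Omega> q" using E E' by blast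
  show "closed_under_products TYPE('u) (Alg \<Sigma> \<S> \<Omega> E) \<E>"
    unfolding closed_under_products_def
  proof (intro allI impI)
    fix J :: "'u set" and M P p
    assume *: "small TYPE('u) J \<and> (\<forall>j\<in>J. M j \<in> \<E>) \<and> is_product (Alg \<Sigma> \<S> \<Omega> E) J M P p"
    then have "jemb \<Theta> J M P p" using abstract_product_jemb[of J E M P p, OF _ E] by blast
    then show "P \<in> \<E>" unfolding \<E> by (rule jemb_Alg[OF _ _ EE]) (use * \<E> in auto)
  qed
  show "closed_under_sigma_closed_subobjects \<Sigma> (Alg \<Sigma> \<S> \<Omega> E) \<E>"
    unfolding closed_under_sigma_closed_subobjects_def
  proof (intro ballI allI impI)
    fix A B h assume A: "A \<in> Ob (Alg \<Sigma> \<S> \<Omega> E)" and B: "B \<in> \<E>"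
      and h: "mono_in (Alg \<Sigma> \<S> \<Omega> E) A B h \<and> sigma_closed \<Sigma> A B h"
    have BE: "B \<in> Ob (Alg \<Sigma> \<S> \<Omega> E)" using B by (simp add: \<E> Ob_Alg_iff)
    have "jemb \<Theta> {()} (\<lambda>_. B) A (\<lambda>_. h)"
      by (rule sigma_closed_jemb[OF A BE E]) (use h in auto)
    then show "A \<in> \<E>" unfolding \<E> by (rule jemb_Alg[OF _ _ EE]) (use B \<E> in auto)
  qed
  show "closed_under_pure_quotients \<Sigma> \<S> (Alg \<Sigma> \<S> \<Omega> E) \<E>"
    unfolding closed_under_pure_quotients_def Alg_simps
  proof (intro ballI impI)
    fix A B p assume A: "A \<in> \<E>" and B: "B \<in> Ob (Alg \<Sigma> \<S> \<Omega> E)" and p: "p \<in> homs \<Theta> A B"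
      and pure: "pure_epi TYPE('u) (lam :: 'k rel) (PMod \<Sigma> \<S>) (reduct A) (reduct B) p"
    have Bm: "is_model \<Sigma> \<S> (reduct B)" using B by (simp add: Ob_Alg_iff is_algebra_def)
    have "valid \<Theta> B q" if q: "q \<in> E'" for q
    proof -
      obtain x \<phi> \<psi> where qx: "q = (x, \<phi>, \<psi>)" by (cases q) auto
      have sq: "is_sequent \<Theta> (x, \<phi>, \<psi>)" using E'[OF q] by (simp add: qx)
      obtain \<phi>0 where \<phi>0: "is_hformula \<Sigma> (x, \<phi>0)" "\<phi> = map_fm id Inl id \<phi>0"
        using E'[OF q] by (auto simp: qx)
      have ctx: "is_ctx \<Sigma> x" and f0: "is_formula \<Sigma> (ctx_vars x) \<phi>0" using \<phi>0 by auto
      have f\<psi>: "is_formula \<Theta> (ctx_vars x) \<psi>" using sq by simp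
      have in\<phi>: "interp \<Theta> M (x, \<phi>) = interp \<Sigma> (reduct M) (x, \<phi>0)" for M :: "('s, 'f + 'w, 'r, 'k, 'u) pstructure"
        by (simp add: \<phi>0(2) holds_reduct)
      obtain \<Gamma> \<gamma> where \<Gamma>: "is_model \<Sigma> \<S> (\<Gamma> :: ('s, 'f, 'r, 'k, 'u) pstructure)" "\<gamma> \<in> interp \<Sigma> \<Gamma> (x, \<phi>0)"
        "\<And>M m. is_model \<Sigma> \<S> M \<Longrightarrow> m \<in> interp \<Sigma> M (x, \<phi>0) \<Longrightarrow>
           \<exists>h\<in>homs \<Sigma> \<Gamma> M. map_tuple (ctx_arity x) h \<gamma> = m"
        "\<And>M h h'. h \<in> homs \<Sigma> \<Gamma> M \<Longrightarrow> h' \<in> homs \<Sigma> \<Gamma> M \<Longrightarrow>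
           map_tuple (ctx_arity x) h \<gamma> = map_tuple (ctx_arity x) h' \<gamma> \<Longrightarrow> h = h'"
        by (rule presented_model[OF \<phi>0(1)]) blast
      have pres: "presentable TYPE('u) (lam :: 'k rel) (PMod \<Sigma> \<S>) \<Gamma>"
        by (rule presented_presentable[OF \<phi>0(1) \<Gamma>])
      have \<gamma>t: "\<gamma> \<in> tuples \<Gamma> (ctx_arity x)" using \<Gamma>(2) by simp
      have "m \<in> interp \<Theta> B (x, \<psi>)" if mB: "m \<in> interp \<Theta> B (x, \<phi>)" for m
      proof -
        obtain h where h: "h \<in> homs \<Sigma> \<Gamma> (reduct B)" "map_tuple (ctx_arity x) h \<gamma> = m"
          using \<Gamma>(3)[OF Bm] mB unfolding in\<phi> by blast
        \<comment> \<open>Purity lifts the map that represents \<open>m\<close>; the image of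
          \<open>\<gamma>\<close> under the lift is a tuple of \<open>A\<close> that satisfies the
          premise and lies over \<open>m\<close>.\<close>
        obtain g where g: "g \<in> homs \<Sigma> \<Gamma> (reduct A)" "comp_hom \<Gamma> p g = h"
          using pure pres h(1) unfolding pure_epi_def PMod_simps by blast
        define a where "a = map_tuple (ctx_arity x) g \<gamma>"
        have aT: "a \<in> tuples A (ctx_arity x)" using map_tuple_mem[OF g(1) \<gamma>t] by (simp add: a_def)
        have "holds \<Sigma> (reduct A) (push g (assign x \<gamma>)) \<phi>0"
          by (rule holds_hom[OF g(1) f0]) (use \<Gamma>(2) in simp)
        then have "a \<in> interp \<Theta> A (x, \<phi>)"
          unfolding in\<phi> using aT holds_cong[where M = "reduct A", OF f0 assign_map_tuple[OF ctx, of _ g \<gamma>]]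
          by (simp add: a_def)
        moreover have "valid \<Theta> A q" using A q by (simp add: \<E> Ob_Alg_iff)
        ultimately have "a \<in> interp \<Theta> A (x, \<psi>)" unfolding qx valid.simps by blast
        then have "holds \<Theta> A (assign x a) \<psi>" by simp
        from holds_hom[OF p f\<psi> this]
        have "holds \<Theta> B (assign x (map_tuple (ctx_arity x) p a)) \<psi>"
          using holds_cong[where M = B, OF f\<psi> assign_map_tuple[OF ctx, of _ p a]] by simp
        moreover have "map_tuple (ctx_arity x) p a = m"
          using map_tuple_compose[OF \<gamma>t, of p g] g(2) h(2) by (simp add: a_def)
        ultimately show ?thesis using map_tuple_mem[OF p aT] by simp
      qed
      then show ?thesis unfolding qx valid.simps by blast
    qed
    then show "B \<in> \<E>" using B unfolding \<E> Ob_Alg_iff by blast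
  qed
qed

end

section \<open>The equivalence of definability and closure\<close>

theorem corollary5p13:
  fixes \<Sigma> :: "('s, 'f, 'r, 'k::wellorder) signature"
    and \<S> :: "('s, 'f, 'r, 'k) sequent set"
    and \<Omega> :: "('s, 'f, 'r, 'k, 'w) rel_signature"
    and E :: "('s, 'f + 'w, 'r, 'k) sequent set"
    and \<E> :: "('s, 'f + 'w, 'r, 'k, 'u) pstructure set"
  assumes "inaccessible TYPE('u)"
    and "Cinfinite (lam :: 'k rel)" and "regularCard (lam :: 'k rel)"
    and "small TYPE('u) (UNIV :: 'k set)"
    and "is_signature \<Sigma>" and "small_signature TYPE('u) \<Sigma>"
    and "horn_theory \<Sigma> \<S>"
    and "ACC (PMod \<Sigma> \<S> :: (('s, 'f, 'r, 'k, 'u) pstructure, ('s, 'u) hom) category)"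
    and "rel_alg_theory \<Sigma> \<Omega> E" and "small TYPE('u) (ops \<Omega>)"
    and "replete_full_subcategory (Alg \<Sigma> \<S> \<Omega> E) \<E>"
  shows "(\<exists>E'. (\<forall>q\<in>E'. is_judgment \<Sigma> \<Omega> q) \<and> \<E> = Ob (Alg \<Sigma> \<S> \<Omega> (E \<union> E'))) \<longleftrightarrow>
         (closed_under_products TYPE('u) (Alg \<Sigma> \<S> \<Omega> E) \<E> \<and>
          closed_under_sigma_closed_subobjects \<Sigma> (Alg \<Sigma> \<S> \<Omega> E) \<E> \<and>
          closed_under_pure_quotients \<Sigma> \<S> (Alg \<Sigma> \<S> \<Omega> E) \<E>)"
proof -
  interpret alg_setting "TYPE('u)" "TYPE('k)" \<Sigma> \<S> \<Omega>
    using assms by unfold_locales (auto simp: rel_alg_theory_def)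
  have E: "\<And>q. q \<in> E \<Longrightarrow> is_judgment \<Sigma> \<Omega> q" using assms(9) by (simp add: rel_alg_theory_def)
  show ?thesis
  proof
    assume "\<exists>E'. (\<forall>q\<in>E'. is_judgment \<Sigma> \<Omega> q) \<and> \<E> = Ob (Alg \<Sigma> \<S> \<Omega> (E \<union> E'))"
    then obtain E' where "\<And>q. q \<in> E' \<Longrightarrow> is_judgment \<Sigma> \<Omega> q" "\<E> = Ob (Alg \<Sigma> \<S> \<Omega> (E \<union> E'))" by blast
    from definable_closed[OF E this]
    show "closed_under_products TYPE('u) (Alg \<Sigma> \<S> \<Omega> E) \<E> \<and>
        closed_under_sigma_closed_subobjects \<Sigma> (Alg \<Sigma> \<S> \<Omega> E) \<E> \<and>
        closed_under_pure_quotients \<Sigma> \<S> (Alg \<Sigma> \<S> \<Omega> E) \<E>" by blast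
  next
    assume cl: "closed_under_products TYPE('u) (Alg \<Sigma> \<S> \<Omega> E) \<E> \<and>
        closed_under_sigma_closed_subobjects \<Sigma> (Alg \<Sigma> \<S> \<Omega> E) \<E> \<and>
        closed_under_pure_quotients \<Sigma> \<S> (Alg \<Sigma> \<S> \<Omega> E) \<E>"
    interpret closed_class "TYPE('u)" "TYPE('k)" \<Sigma> \<S> \<Omega> E \<E>
      using E assms(11) cl by unfold_locales (auto simp: replete_full_subcategory_def)
    show "\<exists>E'. (\<forall>q\<in>E'. is_judgment \<Sigma> \<Omega> q) \<and> \<E> = Ob (Alg \<Sigma> \<S> \<Omega> (E \<union> E'))"
      using definable[OF assms(8)] cl by (intro exI[of _ valid_judgments]) (auto simp: valid_judgments_def)
  qed
qed

end
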